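(* The Gauss-Manin Lie algebra $\mathfrak{G}$ for local $\mathbb{F}_2$ is isomorphic to the semi-direct product $\mathfrak{L}_V\rtimes\mathfrak{sl}_2(\mathbb{C})$, where $\mathfrak{L}_V$ denotes the Lie algebra of type V in Bianchi's classification, corresponding to an ideal of $\mathfrak{G}$ generated by $\mathsf{R}_2$, $\mathsf{R}_{\mathfrak{g}_{22}}$ and $\mathsf{R}_{\mathfrak{g}_{23}}$.
   Context: **Setting.** The mirror family of local $\mathbb{F}_2$ (the total space of the canonical bundle of the second Hirzebruch surface) has fibres $X_z=\{uv+F_{\pmb a}(t_1,t_2)=0\}\subset\mathbb{C}^2\times(\mathbb{C}^* )^2$, $F_{\pmb a}=a_0+a_1t_1+a_2t_2+\frac{a_3}{t_1}+\frac{a_4}{t_1^2t_2}$, with moduli $z_1=\frac{a_1a_3}{a_0^2}$, $z_2=\frac{a_2a_4}{a_3^2}$; $\theta_i=z_i\frac{\partial}{\partial z_i}$. Let $\Omega$ be the holomorphic 3-form (the residue of $\frac{1}{F_{\pmb a}+uv}\frac{dt_1}{t_1}\wedge\frac{dt_2}{t_2}\wedge du\wedge dv$). The flat Gauss-Manin connection $\nabla$ on the rank 4 bundle with fibres $H^3(X_z,\mathbb{C})$ is determined by the Picard-Fuchs system $\mathcal{L}_1\Omega=\mathcal{L}_2\Omega=0$ (with $\theta_i$ acting as $\nabla_{\theta_i}$), $$\mathcal{L}_1=\theta_1(\theta_1-2\theta_2)-2z_1(2\theta_1+1)\theta_1,\qquad \mathcal{L}_2=\theta_2^2-z_2(\theta_1-2\theta_2-1)(\theta_1-2\theta_2).$$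 Fix the frame $\omega=(\Omega,\nabla_{\theta_1-2\theta_2}\Omega,\nabla_{\theta_1}\Omega,Y_{111}^{-1}\nabla_{\theta_1}^2\Omega)^{\rm tr}$, $Y_{111}=\frac{1}{(1-4z_1)^2-64z_1^2z_2}$, and write $\nabla\omega=A_{GM}\,\omega$. The changes of frame preserving the Hodge filtration ($F^3=\langle\omega_1\rangle\subset F^2=\langle\omega_1,\omega_2,\omega_3\rangle\subset F^1=F^0=H^3$), the weight filtration ($W_3=\langle\omega_3,\omega_4\rangle\subset W_4=W_5=\langle\omega_2,\omega_3,\omega_4\rangle\subset W_6=H^3$) and the pairing matrix $\begin{pmatrix}0&-1\\1&0\end{pmatrix}$ on $\mathrm{Gr}^W_3=W_3/W_2$, with first entry normalized to $1$, form the group $\mathsf{G}$ of matrices $$S=\begin{pmatrix}1&0&0&0\\0&s_{22}&s_{23}&0\\0&0&s_{44}^{-1}&0\\0&0&s_{43}&s_{44}\end{pmatrix}.$$ The (local) moduli space $\mathsf{T}$ of enhanced varieties is a product of an open set in the $(z_1,z_2)$-space and a neighbourhood of $\mathrm{Id}$ in $\mathsf{G}$, with coordinates $(z_1,z_2,s_{22},s_{23},s_{43},s_{44})$; $\mathcal{O}_{\mathsf{T}}$ denotes the ring of regular functions on $\mathsf{T}$. On $\mathsf{T}$ one has the frame $\omega_{\mathsf{t}}=S\omega$ and $\nabla\omega_{\mathsf{t}}=(dS+SA_{GM})S^{-1}\omega_{\mathsf{t}}$. **Gauss-Manin Lie algebra.** The modular vector fields $\mathsf{R}_1,\mathsf{R}_2$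 on $\mathsf{T}$ are the unique ones with $$\nabla_{\mathsf{R}_1}\omega_{\mathsf{t}}=\begin{pmatrix}0&Y_1^{-1}&Y_2^{-1}&0\\0&0&0&0\\0&0&0&1\\0&0&0&0\end{pmatrix}\omega_{\mathsf{t}},\qquad \nabla_{\mathsf{R}_2}\omega_{\mathsf{t}}=\begin{pmatrix}0&Y_3^{-1}&Y_4^{-1}&0\\0&0&0&1\\0&0&0&0\\0&0&0&0\end{pmatrix}\omega_{\mathsf{t}}$$ for some $Y_i\in\mathcal{O}_{\mathsf{T}}$. For $\mathfrak{g}\in\mathrm{Lie}(\mathsf{G})$, $\mathsf{R}_{\mathfrak{g}}$ is the unique vector field on $\mathsf{T}$ with $\nabla_{\mathsf{R}_{\mathfrak{g}}}\omega_{\mathsf{t}}=\mathfrak{g}\omega_{\mathsf{t}}$. $\mathrm{Lie}(\mathsf{G})$ is generated by $\mathfrak{g}_{ij}=\left.\left(\frac{\partial S}{\partial s_{ij}}\right)S^{-1}\right|_{S=\mathrm{Id}}$ for $(i,j)\in\{(2,2),(2,3),(4,3),(4,4)\}$. The Gauss-Manin Lie algebra $\mathfrak{G}$ is defined as the $\mathcal{O}_{\mathsf{T}}$-module generated by the vector fields $\mathsf{R}_{\mathfrak{g}}$, $\mathfrak{g}\in\mathrm{Lie}(\mathsf{G})$, and the modular vector fields; the bracket is the commutator of vector fields. **Bianchi type V.** The three-dimensional Lie algebra with basis $e_1,e_2,e_3$ and brackets $[e_1,e_3]=e_1$, $[e_2,e_3]=e_2$, $[e_1,e_2]=0$.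
   Formalization: The isomorphism and the ideal are stated for the complex span of the generating vector fields, since the O_T-module is infinite-dimensional over C; the O_T-module is shown to be free on the same six fields and closed under the commutator. *)

theory Defs
  imports "HOL-Analysis.Analysis" "HOL-Library.Function_Algebras"
begin

section \<open>Holomorphic functions, vector fields and connections on open subsets of complex n-space\<close>

text \<open>Everywhere below the set \<open>S\<close> is meant to be open.\<close>

definition holo_on :: "(complex^'n::finite \<Rightarrow> complex) \<Rightarrow> (complex^'n) set \<Rightarrow> bool" where
  "holo_on f S \<longleftrightarrow>
     (\<forall>x\<in>S. \<exists>D. (f has_derivative D) (at x) \<and> (\<forall>c v. D (c *s v) = c * D v))"

text \<open>A function on \<open>S\<close> is represented by its extension by \<open>0\<close>, so that equality of functions
  on \<open>S\<close> is equality in HOL. The same convention applies to vector fields.\<close>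

definition regular_functions :: "(complex^'n::finite) set \<Rightarrow> (complex^'n \<Rightarrow> complex) set" where
  "regular_functions S = {f. holo_on f S \<and> (\<forall>x. x \<notin> S \<longrightarrow> f x = 0)}"

definition vector_fields :: "(complex^'n::finite) set \<Rightarrow> (complex^'n \<Rightarrow> complex^'n) set" where
  "vector_fields S = {X. \<forall>i. (\<lambda>x. X x $ i) \<in> regular_functions S}"

definition vf_bracket ::
  "(complex^'n::finite) set \<Rightarrow> (complex^'n \<Rightarrow> complex^'n) \<Rightarrow> (complex^'n \<Rightarrow> complex^'n)
     \<Rightarrow> complex^'n \<Rightarrow> complex^'n" where
  "vf_bracket S X Y = (\<lambda>x. if x \<in> S
     then frechet_derivative Y (at x) (X x) - frechet_derivative X (at x) (Y x) else 0)"

definition module_span ::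
  "(complex^'n::finite) set \<Rightarrow> (complex^'n \<Rightarrow> complex^'n) set \<Rightarrow> (complex^'n \<Rightarrow> complex^'n) set" where
  "module_span S B = {(\<lambda>x. \<Sum>b\<in>F. f b x *s b x) | F f.
     finite F \<and> F \<subseteq> B \<and> (\<forall>b\<in>F. f b \<in> regular_functions S)}"

definition const_span ::
  "(complex^'n::finite \<Rightarrow> complex^'n) set \<Rightarrow> (complex^'n \<Rightarrow> complex^'n) set" where
  "const_span B = {(\<lambda>x. \<Sum>b\<in>F. c b *s b x) | F c. finite F \<and> F \<subseteq> B}"

definition module_independent ::
  "(complex^'n::finite) set \<Rightarrow> (complex^'n \<Rightarrow> complex^'n) set \<Rightarrow> bool" where
  "module_independent S B \<longleftrightarrow>
     (\<forall>f. (\<forall>b\<in>B. f b \<in> regular_functions S) \<and> (\<forall>x\<in>S. (\<Sum>b\<in>B. f b x *s b x) = 0)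
        \<longrightarrow> (\<forall>b\<in>B. \<forall>x\<in>S. f b x = 0))"

definition mscale :: "complex \<Rightarrow> complex^'n^'m \<Rightarrow> complex^'n::finite^'m::finite" where
  "mscale c M = (\<chi> i. c *s (M $ i))"

text \<open>A section of the trivialised bundle is the row vector of its coefficients in the chosen
  frame \<open>\<omega>\<close>; \<open>A z v\<close> is the connection matrix contracted with the tangent vector \<open>v\<close>, so that
  \<open>\<nabla>\<^sub>v \<omega> = A z v \<omega>\<close>.\<close>

definition covd ::
  "(complex^'n \<Rightarrow> complex^'n \<Rightarrow> complex^'r^'r) \<Rightarrow> (complex^'n \<Rightarrow> complex^'n)
     \<Rightarrow> (complex^'n \<Rightarrow> complex^'r) \<Rightarrow> complex^'n::finite \<Rightarrow> complex^'r::finite" where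
  "covd A X s = (\<lambda>z. frechet_derivative s (at z) (X z) + s z v* A z (X z))"

definition frame :: "'r \<Rightarrow> complex^'n::finite \<Rightarrow> complex^'r::finite" where
  "frame i = (\<lambda>_. axis i 1)"


section \<open>The Gauss--Manin connection\<close>

definition theta :: "2 \<Rightarrow> complex^2 \<Rightarrow> complex^2" where
  "theta i = (\<lambda>z. axis i (z $ i))"

definition discr :: "complex^2 \<Rightarrow> complex" where
  "discr z = (1 - 4 * z $ 1)^2 - 64 * (z $ 1)^2 * z $ 2"

definition Y111 :: "complex^2 \<Rightarrow> complex" where
  "Y111 z = 1 / discr z"

text \<open>The complement of the discriminant of the Picard--Fuchs system in the torus.\<close>

definition moduli_base :: "(complex^2) set" where
  "moduli_base = {z. z $ 1 \<noteq> 0 \<and> z $ 2 \<noteq> 0 \<and> 1 - 4 * z $ 2 \<noteq> 0 \<and> discr z \<noteq> 0}"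

definition picard_fuchs_1 ::
  "(complex^2 \<Rightarrow> complex^2 \<Rightarrow> complex^4^4) \<Rightarrow> (complex^2 \<Rightarrow> complex^4) \<Rightarrow> complex^2 \<Rightarrow> complex^4" where
  "picard_fuchs_1 A s =
     (let D1 = covd A (theta 1); D2 = covd A (theta 2) in
      (\<lambda>z. D1 (\<lambda>w. D1 s w - 2 *s D2 s w) z - (2 * z $ 1) *s (2 *s D1 (D1 s) z + D1 s z)))"

definition picard_fuchs_2 ::
  "(complex^2 \<Rightarrow> complex^2 \<Rightarrow> complex^4^4) \<Rightarrow> (complex^2 \<Rightarrow> complex^4) \<Rightarrow> complex^2 \<Rightarrow> complex^4" where
  "picard_fuchs_2 A s =
     (let D1 = covd A (theta 1); D2 = covd A (theta 2);
          t = (\<lambda>w. D1 s w - 2 *s D2 s w) in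
      (\<lambda>z. D2 (D2 s) z - z $ 2 *s (D1 t z - 2 *s D2 t z - t z)))"

text \<open>\<open>A\<close> is a holomorphic matrix-valued 1-form on \<open>U\<close>; the frame satisfies
  \<open>\<omega> = (\<Omega>, \<nabla>\<^sub>\<theta>\<^sub>1\<^sub>-\<^sub>2\<^sub>\<theta>\<^sub>2 \<Omega>, \<nabla>\<^sub>\<theta>\<^sub>1 \<Omega>, Y111\<^sup>-\<^sup>1 \<nabla>\<^sub>\<theta>\<^sub>1\<^sup>2 \<Omega>)\<close>; \<open>\<Omega>\<close> satisfies the Picard--Fuchs system; and the
  connection is flat. As \<open>theta 1\<close>, \<open>theta 2\<close> commute and span the tangent spaces over
  \<open>moduli_base\<close>, the curvature vanishes iff the two covariant derivatives commute on the
  frame.\<close>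

definition gauss_manin_connection ::
  "(complex^2) set \<Rightarrow> (complex^2 \<Rightarrow> complex^2 \<Rightarrow> complex^4^4) \<Rightarrow> bool" where
  "gauss_manin_connection U A \<longleftrightarrow>
     (\<forall>z\<in>U. \<forall>v w c. A z (v + w) = A z v + A z w \<and> A z (c *s v) = mscale c (A z v)) \<and>
     (\<forall>v i j. holo_on (\<lambda>z. A z v $ i $ j) U) \<and>
     (let D1 = covd A (theta 1); D2 = covd A (theta 2); \<Omega> = frame 1 in
        (\<forall>z\<in>U. frame 2 z = covd A (\<lambda>w. theta 1 w - 2 *s theta 2 w) \<Omega> z) \<and>
        (\<forall>z\<in>U. frame 3 z = D1 \<Omega> z) \<and>
        (\<forall>z\<in>U. frame 4 z = inverse (Y111 z) *s D1 (D1 \<Omega>) z) \<and>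
        (\<forall>z\<in>U. picard_fuchs_1 A \<Omega> z = 0) \<and>
        (\<forall>z\<in>U. picard_fuchs_2 A \<Omega> z = 0) \<and>
        (\<forall>z\<in>U. \<forall>i. D1 (D2 (frame i)) z = D2 (D1 (frame i)) z))"


section \<open>The moduli space of enhanced varieties\<close>

text \<open>Coordinates on the group: \<open>s $ 1, s $ 2, s $ 3, s $ 4\<close> are \<open>s\<^sub>2\<^sub>2, s\<^sub>2\<^sub>3, s\<^sub>4\<^sub>3, s\<^sub>4\<^sub>4\<close>.\<close>

definition Smat :: "complex^4 \<Rightarrow> complex^4^4" where
  "Smat s = vector [vector [1, 0, 0, 0],
                    vector [0, s $ 1, s $ 2, 0],
                    vector [0, 0, inverse (s $ 4), 0],
                    vector [0, 0, s $ 3, s $ 4]]"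

definition s_id :: "complex^4" where
  "s_id = vector [1, 0, 0, 1]"

definition local_moduli_data :: "(complex^2) set \<Rightarrow> (complex^4) set \<Rightarrow> bool" where
  "local_moduli_data U V \<longleftrightarrow>
     open U \<and> U \<noteq> {} \<and> U \<subseteq> moduli_base \<and>
     open V \<and> s_id \<in> V \<and> (\<forall>s\<in>V. s $ 1 \<noteq> 0 \<and> s $ 4 \<noteq> 0)"

text \<open>Coordinates \<open>(z\<^sub>1, z\<^sub>2, s\<^sub>2\<^sub>2, s\<^sub>2\<^sub>3, s\<^sub>4\<^sub>3, s\<^sub>4\<^sub>4)\<close>.\<close>

definition zpart :: "complex^6 \<Rightarrow> complex^2" where
  "zpart p = vector [p $ 1, p $ 2]"

definition spart :: "complex^6 \<Rightarrow> complex^4" where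
  "spart p = vector [p $ 3, p $ 4, p $ 5, p $ 6]"

definition enhanced_moduli :: "(complex^2) set \<Rightarrow> (complex^4) set \<Rightarrow> (complex^6) set" where
  "enhanced_moduli U V = {p. zpart p \<in> U \<and> spart p \<in> V}"

text \<open>The matrix \<open>(dS + S A) S\<^sup>-\<^sup>1\<close> at \<open>p\<close>, contracted with the tangent vector \<open>v\<close>; as \<open>zpart\<close> is
  linear, it is its own differential.\<close>

definition gm_matrix ::
  "(complex^2 \<Rightarrow> complex^2 \<Rightarrow> complex^4^4) \<Rightarrow> complex^6 \<Rightarrow> complex^6 \<Rightarrow> complex^4^4" where
  "gm_matrix A p v =
     (frechet_derivative (\<lambda>q. Smat (spart q)) (at p) v
        + Smat (spart p) ** A (zpart p) (zpart v)) ** matrix_inv (Smat (spart p))"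


section \<open>Modular vector fields and the Gauss--Manin Lie algebra\<close>

definition modular_matrix_1 :: "complex \<Rightarrow> complex \<Rightarrow> complex^4^4" where
  "modular_matrix_1 a b = vector [vector [0, a, b, 0],
                                  vector [0, 0, 0, 0],
                                  vector [0, 0, 0, 1],
                                  vector [0, 0, 0, 0]]"

definition modular_matrix_2 :: "complex \<Rightarrow> complex \<Rightarrow> complex^4^4" where
  "modular_matrix_2 a b = vector [vector [0, a, b, 0],
                                  vector [0, 0, 0, 1],
                                  vector [0, 0, 0, 0],
                                  vector [0, 0, 0, 0]]"

definition is_modular ::
  "(complex \<Rightarrow> complex \<Rightarrow> complex^4^4) \<Rightarrow> (complex^6) set
     \<Rightarrow> (complex^2 \<Rightarrow> complex^2 \<Rightarrow> complex^4^4) \<Rightarrow> (complex^6 \<Rightarrow> complex^6) \<Rightarrow> bool" where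
  "is_modular M T A R \<longleftrightarrow> R \<in> vector_fields T \<and>
     (\<exists>Y\<in>regular_functions T. \<exists>Y'\<in>regular_functions T.
        \<forall>p\<in>T. Y p \<noteq> 0 \<and> Y' p \<noteq> 0 \<and> gm_matrix A p (R p) = M (inverse (Y p)) (inverse (Y' p)))"

definition R_1 where "R_1 T A = (THE R. is_modular modular_matrix_1 T A R)"
definition R_2 where "R_2 T A = (THE R. is_modular modular_matrix_2 T A R)"

definition lie_gen :: "4 \<Rightarrow> complex^4^4" where
  "lie_gen k = frechet_derivative Smat (at s_id) (axis k 1) ** matrix_inv (Smat s_id)"

definition Lie_G :: "(complex^4^4) set" where
  "Lie_G = {(\<Sum>k\<in>UNIV. mscale (c k) (lie_gen k)) | c. True}"

definition is_R_g ::
  "(complex^6) set \<Rightarrow> (complex^2 \<Rightarrow> complex^2 \<Rightarrow> complex^4^4) \<Rightarrow> complex^4^4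
     \<Rightarrow> (complex^6 \<Rightarrow> complex^6) \<Rightarrow> bool" where
  "is_R_g T A g R \<longleftrightarrow> R \<in> vector_fields T \<and> (\<forall>p\<in>T. gm_matrix A p (R p) = g)"

definition R_g where "R_g T A g = (THE R. is_R_g T A g R)"

abbreviation "R_g22 T A \<equiv> R_g T A (lie_gen 1)"
abbreviation "R_g23 T A \<equiv> R_g T A (lie_gen 2)"
abbreviation "R_g43 T A \<equiv> R_g T A (lie_gen 3)"
abbreviation "R_g44 T A \<equiv> R_g T A (lie_gen 4)"

definition gm_generators ::
  "(complex^6) set \<Rightarrow> (complex^2 \<Rightarrow> complex^2 \<Rightarrow> complex^4^4) \<Rightarrow> (complex^6 \<Rightarrow> complex^6) set" where
  "gm_generators T A = R_g T A ` Lie_G \<union> {R_1 T A, R_2 T A}"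

definition gm_module ::
  "(complex^6) set \<Rightarrow> (complex^2 \<Rightarrow> complex^2 \<Rightarrow> complex^4^4) \<Rightarrow> (complex^6 \<Rightarrow> complex^6) set" where
  "gm_module T A = module_span T (gm_generators T A)"


section \<open>Complex Lie algebras\<close>

text \<open>Addition is that of the ambient type.\<close>

record 'a lie_alg =
  lcarrier :: "'a set"
  lscale :: "complex \<Rightarrow> 'a \<Rightarrow> 'a"
  lbracket :: "'a \<Rightarrow> 'a \<Rightarrow> 'a"

definition complex_lie_algebra :: "'a::ab_group_add lie_alg \<Rightarrow> bool" where
  "complex_lie_algebra L \<longleftrightarrow>
     0 \<in> lcarrier L \<and>
     (\<forall>x\<in>lcarrier L. \<forall>y\<in>lcarrier L. x + y \<in> lcarrier L \<and> lbracket L x y \<in> lcarrier L) \<and>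
     (\<forall>c. \<forall>x\<in>lcarrier L. lscale L c x \<in> lcarrier L) \<and>
     (\<forall>x\<in>lcarrier L. lscale L 1 x = x \<and> lbracket L x x = 0) \<and>
     (\<forall>c d. \<forall>x\<in>lcarrier L. lscale L (c + d) x = lscale L c x + lscale L d x
        \<and> lscale L (c * d) x = lscale L c (lscale L d x)) \<and>
     (\<forall>c. \<forall>x\<in>lcarrier L. \<forall>y\<in>lcarrier L.
        lscale L c (x + y) = lscale L c x + lscale L c y
        \<and> lbracket L (lscale L c x) y = lscale L c (lbracket L x y)
        \<and> lbracket L x (lscale L c y) = lscale L c (lbracket L x y)) \<and>
     (\<forall>x\<in>lcarrier L. \<forall>y\<in>lcarrier L. \<forall>w\<in>lcarrier L.
        lbracket L (x + y) w = lbracket L x w + lbracket L y w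
        \<and> lbracket L w (x + y) = lbracket L w x + lbracket L w y
        \<and> lbracket L x (lbracket L y w) + lbracket L y (lbracket L w x)
            + lbracket L w (lbracket L x y) = 0)"

definition lie_ideal :: "'a::ab_group_add set \<Rightarrow> 'a lie_alg \<Rightarrow> bool" where
  "lie_ideal I L \<longleftrightarrow> I \<subseteq> lcarrier L \<and> 0 \<in> I \<and>
     (\<forall>x\<in>I. \<forall>y\<in>I. x + y \<in> I) \<and> (\<forall>c. \<forall>x\<in>I. lscale L c x \<in> I) \<and>
     (\<forall>x\<in>lcarrier L. \<forall>y\<in>I. lbracket L x y \<in> I)"

definition ideal_generated :: "'a::ab_group_add lie_alg \<Rightarrow> 'a set \<Rightarrow> 'a set" where
  "ideal_generated L B = \<Inter>{I. lie_ideal I L \<and> B \<subseteq> I}"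

definition lie_iso :: "'a::ab_group_add lie_alg \<Rightarrow> 'b::ab_group_add lie_alg \<Rightarrow> ('a \<Rightarrow> 'b) \<Rightarrow> bool" where
  "lie_iso L L' f \<longleftrightarrow> bij_betw f (lcarrier L) (lcarrier L') \<and>
     (\<forall>c. \<forall>x\<in>lcarrier L. f (lscale L c x) = lscale L' c (f x)) \<and>
     (\<forall>x\<in>lcarrier L. \<forall>y\<in>lcarrier L.
        f (x + y) = f x + f y \<and> f (lbracket L x y) = lbracket L' (f x) (f y))"

text \<open>\<open>\<phi>\<close> is a Lie algebra homomorphism from \<open>K\<close> to the derivations of \<open>L\<close>.\<close>

definition lie_action ::
  "'b::ab_group_add lie_alg \<Rightarrow> 'a::ab_group_add lie_alg \<Rightarrow> ('b \<Rightarrow> 'a \<Rightarrow> 'a) \<Rightarrow> bool" where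
  "lie_action K L \<phi> \<longleftrightarrow>
     (\<forall>m\<in>lcarrier K. \<forall>x\<in>lcarrier L. \<phi> m x \<in> lcarrier L) \<and>
     (\<forall>m\<in>lcarrier K. \<forall>c. \<forall>x\<in>lcarrier L. \<phi> m (lscale L c x) = lscale L c (\<phi> m x)) \<and>
     (\<forall>m\<in>lcarrier K. \<forall>x\<in>lcarrier L. \<forall>y\<in>lcarrier L.
        \<phi> m (x + y) = \<phi> m x + \<phi> m y
        \<and> \<phi> m (lbracket L x y) = lbracket L (\<phi> m x) y + lbracket L x (\<phi> m y)) \<and>
     (\<forall>m\<in>lcarrier K. \<forall>c. \<forall>x\<in>lcarrier L. \<phi> (lscale K c m) x = lscale L c (\<phi> m x)) \<and>
     (\<forall>m\<in>lcarrier K. \<forall>n\<in>lcarrier K. \<forall>x\<in>lcarrier L.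
        \<phi> (m + n) x = \<phi> m x + \<phi> n x
        \<and> \<phi> (lbracket K m n) x = \<phi> m (\<phi> n x) - \<phi> n (\<phi> m x))"

definition semidirect ::
  "'a::ab_group_add lie_alg \<Rightarrow> 'b::ab_group_add lie_alg \<Rightarrow> ('b \<Rightarrow> 'a \<Rightarrow> 'a) \<Rightarrow> ('a \<times> 'b) lie_alg" where
  "semidirect L K \<phi> = \<lparr>
     lcarrier = lcarrier L \<times> lcarrier K,
     lscale = (\<lambda>c (x, m). (lscale L c x, lscale K c m)),
     lbracket = (\<lambda>(x, m) (y, n). (lbracket L x y + \<phi> m y - \<phi> n x, lbracket K m n))\<rparr>"

definition sl2 :: "(complex^2^2) lie_alg" where
  "sl2 = \<lparr>lcarrier = {M. trace M = 0}, lscale = mscale, lbracket = (\<lambda>M N. M ** N - N ** M)\<rparr>"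

text \<open>Bianchi type V: \<open>[e\<^sub>1, e\<^sub>3] = e\<^sub>1\<close>, \<open>[e\<^sub>2, e\<^sub>3] = e\<^sub>2\<close>, \<open>[e\<^sub>1, e\<^sub>2] = 0\<close>, extended bilinearly.\<close>

definition L_V :: "(complex^3) lie_alg" where
  "L_V = \<lparr>lcarrier = UNIV, lscale = (*s),
     lbracket = (\<lambda>x y. vector [x $ 1 * y $ 3 - x $ 3 * y $ 1, x $ 2 * y $ 3 - x $ 3 * y $ 2, 0])\<rparr>"

text \<open>The bracket of vector fields is not bilinear over the functions on \<open>T\<close>, so \<open>gm_module\<close> is
  not a Lie algebra over that ring, while over \<open>\<complex>\<close> it is infinite-dimensional. The
  finite-dimensional complex Lie algebra is the \<open>\<complex>\<close>-span of the module generators.\<close>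

definition gm_lie_algebra ::
  "(complex^6) set \<Rightarrow> (complex^2 \<Rightarrow> complex^2 \<Rightarrow> complex^4^4) \<Rightarrow> (complex^6 \<Rightarrow> complex^6) lie_alg" where
  "gm_lie_algebra T A = \<lparr>
     lcarrier = const_span (gm_generators T A),
     lscale = (\<lambda>c X p. c *s X p),
     lbracket = vf_bracket T\<rparr>"

end

theory Submission
  imports Defs "HOL-Complex_Analysis.Cauchy_Integral_Formula"
begin

text \<open>
  Solving the Picard--Fuchs equations together with flatness determines the connection matrices of
  \<open>\<theta>\<^sub>1\<close> and \<open>\<theta>\<^sub>2\<close> explicitly. In the frame \<open>S \<omega>\<close> the block of rows and columns 2, 3, 4 of the
  connection matrix takes values in a six-dimensional Lie algebra \<open>hh\<close>, consisting of a free first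
  row and a trace-free 2 by 2 block, and at every point it maps the tangent space isomorphically onto
  \<open>hh\<close>. Hence every \<open>m\<close> in \<open>hh\<close> is the block of a unique vector field, depending linearly on \<open>m\<close>; the modular
  vector fields and the \<open>R_g\<close> are exactly the fields obtained from a basis of \<open>hh\<close>. As the first column
  of the full matrix vanishes, its first row, which carries the functions \<open>Y\<^sub>i\<close>, does not enter
  the structure equation for the block, so these fields satisfy
  \<open>[X\<^sub>m, X\<^sub>n] = X\<^bsub>nm - mn\<^esub>\<close>. The first row of the block is the radical \<open>L_V\<close>, the trace-free part
  is \<open>sl\<^sub>2\<close>. Because pointwise the fields form a basis with holomorphic dual coframe,
  the module they generate consists of all vector fields; its closure under the bracket reduces to
  the fact that partial derivatives of holomorphic functions are holomorphic.
\<close>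

section \<open>Derivatives of holomorphic functions of several variables\<close>

text \<open>Two obstacles shape the proof. \<open>holo_on\<close> asks only for a complex-linear
  derivative at each point and says nothing about how it varies, so holomorphy of the partial
  derivatives has to be extracted from one-variable Cauchy estimates on complex lines. Secondly, a
  modular vector field must have non-vanishing entries (1,2) and (1,3), since these are inverses of
  functions. The block leaves a single candidate, and its entries vanish where s23 + 4 z1 s22 or
  discr s22^2 - (1 - 4 z2) (s23 + 4 z1 s22)^2 does; therefore \<open>U\<close> and \<open>V\<close>
  may have to be shrunk. At the identity of the group these two functions are 4 z1 and 1 - 8 z1. In
  the connection matrices the frame, the Picard-Fuchs equations and flatness on \<Omega> yield rows
  1 to 3. Row 4 comes from flatness on rows 2 and 3: two linear equations whose determinant, once
  denominators are cleared, is twice the discriminant.\<close>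

lemma norm_vector_scalar_mult: "norm (c *s v) = cmod c * norm v"
  for v :: "complex^'n::finite"
  by (simp add: norm_vec_def norm_mult L2_set_right_distrib)

lemma bounded_linear_vector_scalar_mult: "bounded_linear (\<lambda>c. c *s v)"
  for v :: "complex^'n::finite"
  by (intro bounded_linear_intro[where K = "norm v"])
    (simp_all add: vec_eq_iff norm_vector_scalar_mult algebra_simps)

lemma holo_onD:
  assumes "holo_on f S" "x \<in> S"
  shows "(f has_derivative frechet_derivative f (at x)) (at x)"
    and "frechet_derivative f (at x) (c *s v) = c * frechet_derivative f (at x) v"
proof -
  obtain D where "(f has_derivative D) (at x)" "\<forall>c v. D (c *s v) = c * D v"
    using assms unfolding holo_on_def by blast
  then show "(f has_derivative frechet_derivative f (at x)) (at x)"
    and "frechet_derivative f (at x) (c *s v) = c * frechet_derivative f (at x) v"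
    using frechet_derivative_at by metis+
qed

lemma holo_onI:
  assumes "\<And>x. x \<in> S \<Longrightarrow> (f has_derivative D x) (at x)"
    and "\<And>x c v. x \<in> S \<Longrightarrow> D x (c *s v) = c * D x v"
  shows "holo_on f S"
  using assms unfolding holo_on_def by blast

lemma holo_on_cong_open:
  assumes "holo_on f S" "open S" "\<And>x. x \<in> S \<Longrightarrow> g x = f x"
  shows "holo_on g S"
proof (rule holo_onI)
  fix x c v assume "x \<in> S"
  show "(g has_derivative frechet_derivative f (at x)) (at x)"
    by (rule has_derivative_transform_within_open[OF holo_onD(1)[OF assms(1) \<open>x \<in> S\<close>] assms(2) \<open>x \<in> S\<close>])
      (simp add: assms(3))
  show "frechet_derivative f (at x) (c *s v) = c * frechet_derivative f (at x) v"
    by (rule holo_onD(2)[OF assms(1) \<open>x \<in> S\<close>])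
qed

lemma holo_on_subset: "holo_on f S \<Longrightarrow> S' \<subseteq> S \<Longrightarrow> holo_on f S'"
  unfolding holo_on_def by blast

lemma holo_on_const [intro]: "holo_on (\<lambda>x. c) S"
  by (rule holo_onI[where D = "\<lambda>x v. 0"]) auto

lemma holo_on_nth [intro]: "holo_on (\<lambda>x. x $ i) S"
  by (rule holo_onI[where D = "\<lambda>x v. v $ i"])
    (auto intro: bounded_linear_imp_has_derivative bounded_linear_vec_nth)

lemma holo_on_add [intro]:
  assumes "holo_on f S" "holo_on g S" shows "holo_on (\<lambda>x. f x + g x) S"
  by (rule holo_onI, rule has_derivative_add)
    (auto intro: holo_onD(1)[OF assms(1)] holo_onD(1)[OF assms(2)]
      simp: holo_onD(2)[OF assms(1)] holo_onD(2)[OF assms(2)] algebra_simps)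

lemma holo_on_mult [intro]:
  assumes "holo_on f S" "holo_on g S" shows "holo_on (\<lambda>x. f x * g x) S"
  by (rule holo_onI, rule has_derivative_mult)
    (auto intro: holo_onD(1)[OF assms(1)] holo_onD(1)[OF assms(2)]
      simp: holo_onD(2)[OF assms(1)] holo_onD(2)[OF assms(2)] algebra_simps)

lemma holo_on_uminus [intro]: "holo_on f S \<Longrightarrow> holo_on (\<lambda>x. - f x) S"
  using holo_on_mult[of "\<lambda>_. -1" S f] by (auto)

lemma holo_on_diff [intro]:
  "holo_on f S \<Longrightarrow> holo_on g S \<Longrightarrow> holo_on (\<lambda>x. f x - g x) S"
  using holo_on_add[of f S "\<lambda>x. - g x"] by auto

lemma holo_on_inverse [intro]:
  assumes "holo_on f S" "\<And>x. x \<in> S \<Longrightarrow> f x \<noteq> 0"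
  shows "holo_on (\<lambda>x. inverse (f x)) S"
proof (rule holo_onI)
  fix x c v assume "x \<in> S"
  show "((\<lambda>x. inverse (f x)) has_derivative
      (\<lambda>v. - (inverse (f x) * frechet_derivative f (at x) v * inverse (f x)))) (at x)"
    by (rule Deriv.has_derivative_inverse) (simp_all add: \<open>x \<in> S\<close> assms holo_onD(1)[OF assms(1)])
  show "- (inverse (f x) * frechet_derivative f (at x) (c *s v) * inverse (f x))
      = c * - (inverse (f x) * frechet_derivative f (at x) v * inverse (f x))"
    by (simp add: holo_onD(2)[OF assms(1) \<open>x \<in> S\<close>])
qed

lemma holo_on_divide [intro]:
  assumes "holo_on f S" "holo_on g S" "\<And>x. x \<in> S \<Longrightarrow> g x \<noteq> 0"
  shows "holo_on (\<lambda>x. f x / g x) S"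
  unfolding divide_inverse by (rule holo_on_mult[OF assms(1) holo_on_inverse[OF assms(2,3)]])

lemma holo_on_power [intro]: "holo_on f S \<Longrightarrow> holo_on (\<lambda>x. f x ^ k) S"
  by (induction k) auto

lemma holo_on_sum [intro]:
  "(\<And>i. i \<in> I \<Longrightarrow> holo_on (f i) S) \<Longrightarrow> holo_on (\<lambda>x. \<Sum>i\<in>I. f i x) S"
  by (induction I rule: infinite_finite_induct) auto

lemma holo_on_imp_continuous_on: "holo_on f S \<Longrightarrow> continuous_on S f"
  by (meson continuous_at_imp_continuous_on has_derivative_continuous holo_onD(1))

text \<open>Complex linearity of the derivative is what turns the restriction to a complex line into
  a holomorphic function of one variable; this is the bridge to Cauchy's theory.\<close>

lemma holo_on_line_derivative:
  assumes "holo_on f S" "x + \<zeta> *s v \<in> S"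
  shows "((\<lambda>\<zeta>. f (x + \<zeta> *s v)) has_field_derivative frechet_derivative f (at (x + \<zeta> *s v)) v) (at \<zeta>)"
proof -
  have 1: "((\<lambda>\<zeta>. x + \<zeta> *s v) has_derivative (\<lambda>\<zeta>. \<zeta> *s v)) (at \<zeta>)"
    by (auto intro!: derivative_eq_intros bounded_linear_imp_has_derivative
        bounded_linear_vector_scalar_mult)
  have "((\<lambda>\<zeta>. f (x + \<zeta> *s v)) has_derivative
      (\<lambda>\<eta>. frechet_derivative f (at (x + \<zeta> *s v)) (\<eta> *s v))) (at \<zeta>)"
    by (rule has_derivative_compose[OF 1 holo_onD(1)[OF assms]])
  then show ?thesis
    by (simp add: holo_onD(2)[OF assms] has_field_derivative_def mult.commute[of _ "frechet_derivative _ _ _"])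
qed

lemma holo_on_line:
  assumes "holo_on f S" "r > 0" "ball x r \<subseteq> S" "norm v \<le> 1"
  shows "(\<lambda>\<zeta>. f (x + \<zeta> *s v)) holomorphic_on ball 0 r"
    and "\<And>\<zeta>. \<zeta> \<in> ball 0 r \<Longrightarrow> x + \<zeta> *s v \<in> ball x r"
proof -
  show *: "x + \<zeta> *s v \<in> ball x r" if "\<zeta> \<in> ball 0 r" for \<zeta>
  proof -
    have "cmod \<zeta> * norm v \<le> cmod \<zeta> * 1"
      by (rule mult_left_mono[OF assms(4)]) simp
    then show ?thesis
      using that by (simp add: dist_norm norm_vector_scalar_mult)
  qed
  show "(\<lambda>\<zeta>. f (x + \<zeta> *s v)) holomorphic_on ball 0 r"
    unfolding holomorphic_on_open[OF open_ball]
    using holo_on_line_derivative[OF assms(1)] * assms(3) by blast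
qed

text \<open>Cauchy's inequality on the complex line through x in direction w. The circle has radius
  r/2, so that its closed disc stays inside the open ball where f is bounded; hence the factor
  2.\<close>

lemma holo_on_derivative_bound:
  assumes "holo_on f S" "r > 0" "ball x r \<subseteq> S"
    and M: "\<And>y. y \<in> ball x r \<Longrightarrow> cmod (f y) \<le> M"
  shows "cmod (frechet_derivative f (at x) w) \<le> 2 * M / r * norm w"
proof -
  have xS: "x \<in> S" using assms by auto
  interpret D: bounded_linear "frechet_derivative f (at x)"
    using holo_onD(1)[OF assms(1) xS] by (rule has_derivative_bounded_linear)
  show ?thesis
  proof (cases "w = 0")
    case True
    then show ?thesis by simp
  next
    case False
    define u where "u = of_real (inverse (norm w)) *s w"
    have u: "norm u = 1"
      using False by (simp add: u_def norm_vector_scalar_mult norm_inverse)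
    have w: "w = of_real (norm w) *s u"
      using False by (simp add: u_def vector_smult_assoc flip: of_real_mult)
    let ?\<phi> = "\<lambda>\<zeta>. f (x + \<zeta> *s u)"
    have hol: "?\<phi> holomorphic_on ball 0 r"
      by (rule holo_on_line[OF assms(1-3)]) (simp add: u)
    have "norm ((deriv ^^ 1) ?\<phi> 0) \<le> fact 1 * M / (r/2) ^ 1"
    proof (rule Cauchy_inequality)
      show "?\<phi> holomorphic_on ball 0 (r/2)" using hol by (rule holomorphic_on_subset) (use assms(2) in auto)
      show "continuous_on (cball 0 (r/2)) ?\<phi>"
        using hol by (intro holomorphic_on_imp_continuous_on) (rule holomorphic_on_subset, use assms(2) in auto)
      show "cmod (?\<phi> z) \<le> M" if "cmod (0 - z) = r/2" for z
        using that assms(2) by (intro M holo_on_line(2)[OF assms(1-3)]) (auto simp: u)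
    qed (use assms(2) in auto)
    moreover have "deriv ?\<phi> 0 = frechet_derivative f (at x) u"
      using holo_on_line_derivative[OF assms(1), of x 0 u] xS by (auto intro: DERIV_imp_deriv)
    ultimately have "cmod (frechet_derivative f (at x) u) \<le> 2 * M / r" by (simp add: mult.commute)
    moreover have "frechet_derivative f (at x) w = of_real (norm w) * frechet_derivative f (at x) u"
      by (subst w) (rule holo_onD(2)[OF assms(1) xS])
    ultimately show ?thesis
      using mult_right_mono[of "cmod (frechet_derivative f (at x) u)" "2 * M / r" "norm w"]
      by (simp add: norm_mult mult.commute[of "norm w"])
  qed
qed

text \<open>Taylor's formula along the line. For |\<zeta>| \<le> r/4 the disc of radius r/4 about
  \<zeta> stays in the disc of radius r, so Cauchy bounds the second derivative by 2! M / (r/4)^2 =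
  32 M / r^2. The bound depends on x only through M and r, which makes the convergence locally
  uniform.\<close>

lemma holo_on_quotient_bound:
  assumes "holo_on f S" "r > 0" "ball x r \<subseteq> S" "norm v \<le> 1"
    and M: "\<And>y. y \<in> ball x r \<Longrightarrow> cmod (f y) \<le> M"
    and h: "h \<noteq> 0" "cmod h \<le> r/4"
  shows "cmod ((f (x + h *s v) - f x) / h - frechet_derivative f (at x) v) \<le> 32 * M / r^2 * cmod h"
proof -
  let ?\<phi> = "\<lambda>\<zeta>. f (x + \<zeta> *s v)"
  have xS: "x \<in> S" using assms by auto
  have hol: "?\<phi> holomorphic_on ball 0 r"
    by (rule holo_on_line[OF assms(1-4)])
  have "cmod ((deriv ^^ 0) ?\<phi> h - (\<Sum>i\<le>1. (deriv ^^ i) ?\<phi> 0 * (h - 0)^i / fact i))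
      \<le> (32 * M / r^2) * cmod (h - 0)^(Suc 1) / fact 1"
  proof (rule complex_Taylor)
    show "convex (cball (0::complex) (r/4))" by simp
    show "((deriv ^^ i) ?\<phi> has_field_derivative (deriv ^^ Suc i) ?\<phi> z) (at z within cball 0 (r/4))"
      if "z \<in> cball 0 (r/4)" for i z
    proof -
      have "(deriv ^^ i) ?\<phi> holomorphic_on ball 0 r"
        by (rule holomorphic_higher_deriv[OF hol]) simp
      then have "((deriv ^^ i) ?\<phi> has_field_derivative deriv ((deriv ^^ i) ?\<phi>) z) (at z)"
        by (rule holomorphic_derivI) (use that assms(2) in auto)
      then show ?thesis by (simp add: has_field_derivative_at_within)
    qed
    show "cmod ((deriv ^^ Suc 1) ?\<phi> z) \<le> 32 * M / r^2" if "z \<in> cball 0 (r/4)" for z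
    proof -
      have sub: "cball z (r/4) \<subseteq> ball 0 r"
      proof
        fix y assume "y \<in> cball z (r/4)"
        then have "cmod y \<le> r/4 + r/4"
          using that norm_triangle_sub[of y z] by (auto simp: dist_norm norm_minus_commute)
        then show "y \<in> ball 0 r" using assms(2) by auto
      qed
      have "norm ((deriv ^^ 2) ?\<phi> z) \<le> fact 2 * M / (r/4) ^ 2"
      proof (rule Cauchy_inequality)
        show "?\<phi> holomorphic_on ball z (r/4)"
          using hol by (rule holomorphic_on_subset) (use sub ball_subset_cball in blast)
        show "continuous_on (cball z (r/4)) ?\<phi>"
          using hol by (intro holomorphic_on_imp_continuous_on) (rule holomorphic_on_subset, use sub in auto)
        show "cmod (?\<phi> y) \<le> M" if "cmod (z - y) = r/4" for y
        proof (intro M holo_on_line(2)[OF assms(1-4)])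
          show "y \<in> ball 0 r" using that sub by (auto simp: dist_norm)
        qed
      qed (use assms(2) in auto)
      then show ?thesis by (simp add: power_divide field_simps numeral_2_eq_2)
    qed
  qed (use assms(2) h(2) in auto)
  moreover have "deriv ?\<phi> 0 = frechet_derivative f (at x) v"
    using holo_on_line_derivative[OF assms(1), of x 0 v] xS by (auto intro: DERIV_imp_deriv)
  ultimately have *: "cmod (f (x + h *s v) - f x - frechet_derivative f (at x) v * h) \<le> 32 * M / r^2 * cmod h^2"
    by (simp add: power2_eq_square diff_diff_eq)
  have "(f (x + h *s v) - f x) / h - frechet_derivative f (at x) v
      = (f (x + h *s v) - f x - frechet_derivative f (at x) v * h) / h"
    using h(1) by (simp add: field_simps)
  also have "cmod \<dots> \<le> (32 * M / r^2 * cmod h^2) / cmod h"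
    unfolding norm_divide using * by (rule divide_right_mono) simp
  also have "\<dots> = 32 * M / r^2 * cmod h"
    using h(1) by (simp add: power2_eq_square)
  finally show ?thesis .
qed

text \<open>The difference quotients converge locally uniformly to the directional derivative; by Cauchy's
  estimate their derivatives then converge uniformly as well.\<close>

lemma holo_on_directional_derivative_local:
  assumes f: "holo_on f S" and "r > 0" and sub: "cball x0 (3 * r) \<subseteq> S" and v: "norm v \<le> 1"
  shows "\<exists>D. ((\<lambda>x. frechet_derivative f (at x) v) has_derivative D) (at x0)
    \<and> (\<forall>c w. D (c *s w) = c * D w)"
proof -
  \<comment> \<open>Three nested balls: f is bounded on radius 3r, the quotients converge uniformly
    on radius 2r and their derivatives on radius r. Each passage gives up r, the size of the ball on
    which the Cauchy estimate is applied.\<close>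
  have "compact (f ` cball x0 (3 * r))"
    by (rule compact_continuous_image[OF continuous_on_subset[OF holo_on_imp_continuous_on[OF f] sub]]) simp
  then obtain M where M: "\<And>y. y \<in> cball x0 (3 * r) \<Longrightarrow> cmod (f y) \<le> M"
    using compact_imp_bounded[of "f ` cball x0 (3 * r)"] unfolding bounded_iff by blast
  have "0 \<le> M" using \<open>r > 0\<close> by (intro order_trans[OF norm_ge_zero M[of x0]]) simp
  define F where "F x = frechet_derivative f (at x) v" for x
  define h :: "nat \<Rightarrow> complex" where "h n = of_real (r / 4 / real (Suc n))" for n
  define C where "C = 32 * M / r^2"
  have "0 \<le> C" using \<open>0 \<le> M\<close> by (simp add: C_def)
  have h0: "h n \<noteq> 0" for n
    using \<open>r > 0\<close> by (simp add: h_def del: of_nat_Suc)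
  have h_norm: "cmod (h n) = r / 4 / real (Suc n)" for n
    unfolding h_def norm_of_real using \<open>r > 0\<close> by simp
  have h_le: "cmod (h n) \<le> r / 4" for n
    using \<open>r > 0\<close> by (simp add: h_norm divide_le_eq)
  have h_lim: "(\<lambda>n. cmod (h n)) \<longlonglongrightarrow> 0"
    unfolding h_norm by (rule LIMSEQ_Suc[OF lim_const_over_n])
  define g where "g n x = (f (x + h n *s v) - f x) / h n" for n x
  have ball2: "ball x r \<subseteq> cball x0 (3 * r)" if "x \<in> ball x0 (2 * r)" for x
  proof
    fix y assume "y \<in> ball x r"
    then show "y \<in> cball x0 (3 * r)"
      using that dist_triangle[of x0 y x] by auto
  qed
  have gF: "cmod (g n x - F x) \<le> C * cmod (h n)" if "x \<in> ball x0 (2 * r)" for n x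
    unfolding g_def F_def C_def
    by (rule holo_on_quotient_bound[OF f \<open>r > 0\<close> _ v M h0 h_le]) (use ball2[OF that] sub in auto)
  have hv: "x + h n *s v \<in> S" if "x \<in> ball x0 (2 * r)" for n x
  proof -
    have "norm (h n *s v) \<le> cmod (h n) * 1"
      unfolding norm_vector_scalar_mult by (rule mult_left_mono[OF v]) simp
    also have "\<dots> < r" using h_le[of n] \<open>r > 0\<close> by simp
    finally have "x + h n *s v \<in> ball x r" by (simp add: dist_norm)
    then show ?thesis using ball2[OF that] sub by auto
  qed
  have g: "holo_on (g n) (ball x0 (2 * r))" for n
  proof -
    have "holo_on (\<lambda>x. f (x + h n *s v)) (ball x0 (2 * r))"
    proof (rule holo_onI)
      fix x c w assume x: "x \<in> ball x0 (2 * r)"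
      show "((\<lambda>x. f (x + h n *s v)) has_derivative frechet_derivative f (at (x + h n *s v))) (at x)"
        by (rule has_derivative_compose[OF has_derivative_add_const[OF has_derivative_ident]
              holo_onD(1)[OF f hv[OF x]]])
      show "frechet_derivative f (at (x + h n *s v)) (c *s w)
          = c * frechet_derivative f (at (x + h n *s v)) w"
        by (rule holo_onD(2)[OF f hv[OF x]])
    qed
    moreover have "holo_on f (ball x0 (2 * r))"
      using f by (rule holo_on_subset) (use sub \<open>r > 0\<close> in \<open>auto simp: subset_iff\<close>)
    ultimately show ?thesis
      unfolding g_def by (intro holo_on_divide holo_on_diff holo_on_const) (use h0 in auto)
  qed
  define G where "G n x w = frechet_derivative (g n) (at x) w" for n x w
  have sub2: "x \<in> ball x0 (2 * r)" if "x \<in> ball x0 r" for x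
    using that \<open>r > 0\<close> by auto
  \<comment> \<open>On the ball of radius r about x both \<open>g n\<close> and \<open>g m\<close>
    are close to \<open>F\<close>, so Cauchy's estimate controls the derivative of their difference
    without presupposing that \<open>F\<close> is differentiable.\<close>
  have G_diff: "cmod (G n x w - G m x w) \<le> 2 * C / r * (cmod (h n) + cmod (h m)) * norm w"
    if x: "x \<in> ball x0 r" for n m x w
  proof -
    have b: "ball x r \<subseteq> ball x0 (2 * r)"
    proof
      fix y assume "y \<in> ball x r"
      then show "y \<in> ball x0 (2 * r)"
        using x dist_triangle[of x0 y x] by auto
    qed
    have "cmod (frechet_derivative (\<lambda>x. g n x - g m x) (at x) w)
        \<le> 2 * (C * cmod (h n) + C * cmod (h m)) / r * norm w"
    proof (rule holo_on_derivative_bound[OF holo_on_diff[OF g g] \<open>r > 0\<close> b])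
      fix y assume "y \<in> ball x r"
      then have y: "y \<in> ball x0 (2 * r)" using b by auto
      have "cmod (g n y - g m y) \<le> cmod (g n y - F y) + cmod (g m y - F y)"
        using norm_triangle_ineq4[of "g n y - F y" "g m y - F y"] by simp
      then show "cmod (g n y - g m y) \<le> C * cmod (h n) + C * cmod (h m)"
        using gF[OF y, of n] gF[OF y, of m] by linarith
    qed
    moreover have "frechet_derivative (\<lambda>x. g n x - g m x) (at x) = (\<lambda>w. G n x w - G m x w)"
      unfolding G_def
      by (rule frechet_derivative_at[symmetric], rule has_derivative_diff)
        (rule holo_onD(1)[OF g sub2[OF x]])+
    ultimately show ?thesis by (simp add: field_simps)
  qed
  have Cauchy: "Cauchy (\<lambda>n. G n x w)" if x: "x \<in> ball x0 r" for x w
  proof (rule metric_CauchyI)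
    fix e :: real assume "e > 0"
    have "(\<lambda>n. 2 * C / r * cmod (h n) * norm w) \<longlonglongrightarrow> 2 * C / r * 0 * norm w"
      by (intro tendsto_intros h_lim)
    then have "\<forall>\<^sub>F n in sequentially. 2 * C / r * cmod (h n) * norm w < e / 2"
      by (rule order_tendstoD(2)) (use \<open>e > 0\<close> in simp)
    then obtain N where N: "\<And>n. n \<ge> N \<Longrightarrow> 2 * C / r * cmod (h n) * norm w < e / 2"
      unfolding eventually_sequentially by blast
    have "dist (G m x w) (G n x w) < e" if "m \<ge> N" "n \<ge> N" for m n
    proof -
      have "dist (G m x w) (G n x w) \<le> 2 * C / r * cmod (h m) * norm w + 2 * C / r * cmod (h n) * norm w"
        using G_diff[OF x, of m w n] by (simp add: dist_norm algebra_simps add_divide_distrib)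
      then show ?thesis using N[OF that(1)] N[OF that(2)] by linarith
    qed
    then show "\<exists>N. \<forall>m\<ge>N. \<forall>n\<ge>N. dist (G m x w) (G n x w) < e" by blast
  qed
  define G' where "G' x w = lim (\<lambda>n. G n x w)" for x w
  have G': "(\<lambda>n. G n x w) \<longlonglongrightarrow> G' x w" if "x \<in> ball x0 r" for x w
    unfolding G'_def using Cauchy_convergent[OF Cauchy[OF that]] by (rule convergent_LIMSEQ_iff[THEN iffD1])
  have GG': "cmod (G n x w - G' x w) \<le> 2 * C / r * cmod (h n) * norm w" if x: "x \<in> ball x0 r" for n x w
  proof (rule tendsto_le[OF sequentially_bot])
    show "(\<lambda>m. 2 * C / r * (cmod (h n) + cmod (h m)) * norm w) \<longlonglongrightarrow> 2 * C / r * cmod (h n) * norm w"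
      using tendsto_mult_right[OF tendsto_mult_left[OF tendsto_add[OF tendsto_const[of "cmod (h n)"] h_lim]], of "2 * C / r" "norm w"]
      by simp
    show "(\<lambda>m. cmod (G n x w - G m x w)) \<longlonglongrightarrow> cmod (G n x w - G' x w)"
      by (intro tendsto_intros G'[OF x])
    show "\<forall>\<^sub>F m in sequentially. cmod (G n x w - G m x w) \<le> 2 * C / r * (cmod (h n) + cmod (h m)) * norm w"
      using G_diff[OF x] by simp
  qed
  have gF_lim: "(\<lambda>n. g n x) \<longlonglongrightarrow> F x" if "x \<in> ball x0 r" for x
  proof -
    have "(\<lambda>n. C * cmod (h n)) \<longlonglongrightarrow> 0"
      using tendsto_mult_left[OF h_lim, of C] by simp
    then have "(\<lambda>n. g n x - F x) \<longlonglongrightarrow> 0"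
      by (rule Lim_null_comparison[rotated]) (simp add: gF[OF sub2[OF that]])
    then show ?thesis by (simp add: LIM_zero_iff)
  qed
  have "\<exists>l. \<forall>x\<in>ball x0 r. (\<lambda>n. g n x) \<longlonglongrightarrow> l x \<and> (l has_derivative G' x) (at x within ball x0 r)"
  proof (rule has_derivative_sequence[where f' = G and ?x0.0 = x0])
    show "(g n has_derivative G n x) (at x within ball x0 r)" if "x \<in> ball x0 r" for n x
      using holo_onD(1)[OF g sub2[OF that]] unfolding G_def
      by (simp add: has_derivative_at_withinI)
    show "\<forall>\<^sub>F n in sequentially. \<forall>x\<in>ball x0 r. \<forall>w. cmod (G n x w - G' x w) \<le> e * norm w" if "e > 0" for e
    proof -
      have "(\<lambda>n. 2 * C / r * cmod (h n)) \<longlonglongrightarrow> 2 * C / r * 0"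
        by (intro tendsto_intros h_lim)
      then have "\<forall>\<^sub>F n in sequentially. 2 * C / r * cmod (h n) < e"
        by (rule order_tendstoD(2)) (use \<open>e > 0\<close> in simp)
      then show ?thesis
      proof eventually_elim
        case (elim n)
        show ?case
        proof (intro ballI allI)
          fix x w assume x: "x \<in> ball x0 r"
          show "cmod (G n x w - G' x w) \<le> e * norm w"
            using GG'[OF x, of n w] mult_right_mono[OF less_imp_le[OF elim], of "norm w"] by simp
        qed
      qed
    qed
    show "(\<lambda>n. g n x0) \<longlonglongrightarrow> F x0" using \<open>r > 0\<close> by (intro gF_lim) simp
  qed (use \<open>r > 0\<close> in auto)
  then obtain l where l: "\<And>x. x \<in> ball x0 r \<Longrightarrow> (\<lambda>n. g n x) \<longlonglongrightarrow> l x"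
    "\<And>x. x \<in> ball x0 r \<Longrightarrow> (l has_derivative G' x) (at x within ball x0 r)" by blast
  have x0: "x0 \<in> ball x0 r" using \<open>r > 0\<close> by simp
  have "(l has_derivative G' x0) (at x0)"
    using l(2)[OF x0] by (simp add: at_within_open[OF x0])
  \<comment> \<open>\<open>has_derivative_sequence\<close> provides only some limit function
    \<open>l\<close>; it agrees with \<open>F\<close> near x0 by uniqueness of limits.\<close>
  then have "(F has_derivative G' x0) (at x0)"
    by (rule has_derivative_transform_within_open[OF _ open_ball x0])
      (metis l(1) gF_lim LIMSEQ_unique)
  moreover have "G' x0 (c *s w) = c * G' x0 w" for c w
  proof (rule LIMSEQ_unique[OF G'[OF x0]])
    have "G n x0 (c *s w) = c * G n x0 w" for n
      unfolding G_def by (rule holo_onD(2)[OF g sub2[OF x0]])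
    then show "(\<lambda>n. G n x0 (c *s w)) \<longlonglongrightarrow> c * G' x0 w"
      using tendsto_mult_left[OF G'[OF x0]] by simp
  qed
  ultimately show ?thesis unfolding F_def by blast
qed

lemma holo_on_directional_derivative:
  assumes "open S" "holo_on f S"
  shows "holo_on (\<lambda>x. frechet_derivative f (at x) v) S"
  unfolding holo_on_def
proof
  fix x assume x: "x \<in> S"
  obtain e where e: "e > 0" "cball x e \<subseteq> S"
    using assms(1) x open_contains_cball by blast
  \<comment> \<open>Scaling by \<open>norm v + 1\<close> instead of \<open>norm v\<close> includes
    the case v = 0.\<close>
  define u where "u = of_real (inverse (norm v + 1)) *s v"
  have pos: "norm v + 1 > 0" by (rule add_nonneg_pos) auto
  have u: "norm u \<le> 1"
    unfolding u_def norm_vector_scalar_mult norm_of_real using pos by (simp add: field_simps)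
  have v: "v = of_real (norm v + 1) *s u"
    using pos by (simp add: u_def vector_smult_assoc del: of_real_inverse of_real_add flip: of_real_mult)
  obtain D where D: "((\<lambda>x. frechet_derivative f (at x) u) has_derivative D) (at x)"
    "\<And>c w. D (c *s w) = c * D w"
    using holo_on_directional_derivative_local[OF assms(2), of "e/3" x u] e u by auto
  have "((\<lambda>x. of_real (norm v + 1) * frechet_derivative f (at x) u) has_derivative
      (\<lambda>w. of_real (norm v + 1) * D w)) (at x)"
    by (rule has_derivative_mult_right[OF D(1)])
  then have "((\<lambda>x. frechet_derivative f (at x) v) has_derivative (\<lambda>w. of_real (norm v + 1) * D w)) (at x)"
    by (rule has_derivative_transform_within_open[OF _ assms(1) x])
      (subst (2) v, simp only: holo_onD(2)[OF assms(2)])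
  then show "\<exists>D. ((\<lambda>x. frechet_derivative f (at x) v) has_derivative D) (at x) \<and> (\<forall>c w. D (c *s w) = c * D w)"
    using D(2) by (auto simp: algebra_simps)
qed

section \<open>Regular functions, holomorphic vector fields and their brackets\<close>

lemma regular_functionsD: "f \<in> regular_functions S \<Longrightarrow> holo_on f S"
  by (simp add: regular_functions_def)

lemma vector_fieldsD:
  assumes "X \<in> vector_fields S"
  shows "holo_on (\<lambda>x. X x $ i) S" "x \<notin> S \<Longrightarrow> X x = 0"
  using assms by (auto simp: vector_fields_def regular_functions_def vec_eq_iff)

lemma vector_fieldsI:
  assumes "\<And>i. holo_on (\<lambda>x. X x $ i) S" "\<And>x. x \<notin> S \<Longrightarrow> X x = 0"
  shows "X \<in> vector_fields S"
  using assms by (auto simp: vector_fields_def regular_functions_def)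

text \<open>The components lie in an arbitrary normed space, so that one application splits a matrix
  into rows and a second one splits the rows into entries.\<close>

lemma has_derivative_vec_nth_iff:
  fixes f :: "'a::real_normed_vector \<Rightarrow> 'b::real_normed_vector^'n::finite"
  shows "(f has_derivative D) (at x) \<longleftrightarrow> (\<forall>i. ((\<lambda>x. f x $ i) has_derivative (\<lambda>v. D v $ i)) (at x))"
    (is "?l \<longleftrightarrow> ?r")
proof
  assume ?l then show ?r
    using bounded_linear.has_derivative[OF bounded_linear_vec_nth] by blast
next
  assume r: ?r
  have e: "(\<Sum>i\<in>UNIV. axis i (v $ i)) = v" for v :: "'b^'n"
    by (simp add: vec_eq_iff axis_def if_distrib cong: if_cong)
  have "bounded_linear (axis i :: 'b \<Rightarrow> 'b^'n)" for i
  proof (rule bounded_linear_intro[where K = 1])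
    show "norm (axis i x :: 'b^'n) \<le> norm x * 1" for x
      using L2_set_le_sum[of UNIV "\<lambda>j. norm ((axis i x :: 'b^'n) $ j)"]
      by (simp add: norm_vec_def axis_def if_distrib cong: if_cong)
  qed (simp_all add: vec_eq_iff axis_def)
  then have "((\<lambda>x. \<Sum>i\<in>UNIV. axis i (f x $ i)) has_derivative (\<lambda>v. \<Sum>i\<in>UNIV. axis i (D v $ i))) (at x)"
    by (intro has_derivative_sum bounded_linear.has_derivative[of "axis _"] r[rule_format])
  then show ?l by (simp only: e)
qed

lemma vector_field_has_derivative:
  assumes "X \<in> vector_fields S" "x \<in> S"
  shows "(X has_derivative frechet_derivative X (at x)) (at x)"
    and "frechet_derivative X (at x) v $ i = frechet_derivative (\<lambda>x. X x $ i) (at x) v"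
    and "frechet_derivative X (at x) (c *s v) = c *s frechet_derivative X (at x) v"
proof -
  have *: "(X has_derivative (\<lambda>v. \<chi> i. frechet_derivative (\<lambda>x. X x $ i) (at x) v)) (at x)"
    unfolding has_derivative_vec_nth_iff using holo_onD(1)[OF vector_fieldsD(1)[OF assms(1)] assms(2)] by simp
  note ** = frechet_derivative_at[OF *]
  show "(X has_derivative frechet_derivative X (at x)) (at x)" using * ** by simp
  show "frechet_derivative X (at x) v $ i = frechet_derivative (\<lambda>x. X x $ i) (at x) v"
    unfolding **[symmetric] by simp
  show "frechet_derivative X (at x) (c *s v) = c *s frechet_derivative X (at x) v"
    unfolding **[symmetric] by (simp add: vec_eq_iff holo_onD(2)[OF vector_fieldsD(1)[OF assms(1)] assms(2)])
qed

text \<open>The direction moves with the point. Expanding it in the coordinate axes leaves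
  derivatives in constant directions, which are holomorphic, with the components of X as
  coefficients.\<close>

lemma holo_on_derivative_along:
  assumes "open S" "holo_on f S" "X \<in> vector_fields S"
  shows "holo_on (\<lambda>x. frechet_derivative f (at x) (X x)) S"
proof (rule holo_on_cong_open[OF _ assms(1)])
  show "holo_on (\<lambda>x. \<Sum>j\<in>UNIV. X x $ j * frechet_derivative f (at x) (axis j 1)) S"
    by (intro holo_on_sum holo_on_mult vector_fieldsD(1)[OF assms(3)]
        holo_on_directional_derivative[OF assms(1,2)])
next
  fix x assume x: "x \<in> S"
  interpret D: bounded_linear "frechet_derivative f (at x)"
    using holo_onD(1)[OF assms(2) x] by (rule has_derivative_bounded_linear)
  have "frechet_derivative f (at x) (X x) = frechet_derivative f (at x) (\<Sum>j\<in>UNIV. X x $ j *s axis j 1)"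
    by (simp add: basis_expansion)
  then show "frechet_derivative f (at x) (X x) = (\<Sum>j\<in>UNIV. X x $ j * frechet_derivative f (at x) (axis j 1))"
    by (simp add: D.sum holo_onD(2)[OF assms(2) x])
qed

lemma vf_bracket_vector_fields:
  assumes "open S" "X \<in> vector_fields S" "Y \<in> vector_fields S"
  shows "vf_bracket S X Y \<in> vector_fields S"
proof (rule vector_fieldsI)
  fix i
  show "holo_on (\<lambda>x. vf_bracket S X Y x $ i) S"
    by (rule holo_on_cong_open[OF _ assms(1)],
        rule holo_on_diff[OF holo_on_derivative_along[OF assms(1) vector_fieldsD(1)[OF assms(3), of i] assms(2)]
            holo_on_derivative_along[OF assms(1) vector_fieldsD(1)[OF assms(2), of i] assms(3)]])
      (simp add: vf_bracket_def vector_field_has_derivative(2)[OF assms(2)] vector_field_has_derivative(2)[OF assms(3)])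
qed (simp add: vf_bracket_def)

section \<open>Connection matrices\<close>

text \<open>\<open>frechet_derivative\<close> chooses from the set of all derivatives at the point,
  and both functions have the same such set; so the equality holds even where no derivative
  exists.\<close>

lemma frechet_derivative_cong_open:
  assumes "open S" "x \<in> S" "\<And>y. y \<in> S \<Longrightarrow> f y = g y"
  shows "frechet_derivative f (at x) = frechet_derivative g (at x)"
proof -
  have "(f has_derivative D) (at x) \<longleftrightarrow> (g has_derivative D) (at x)" for D
    using has_derivative_transform_within_open[OF _ assms(1,2), of f D UNIV g]
      has_derivative_transform_within_open[OF _ assms(1,2), of g D UNIV f] assms(3) by auto
  then show ?thesis unfolding frechet_derivative_def by simp
qed

lemma covd_cong_open:
  assumes "open S" "x \<in> S" "\<And>y. y \<in> S \<Longrightarrow> s y = t y"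
  shows "covd A X s x = covd A X t x"
proof -
  have "frechet_derivative s (at x) = frechet_derivative t (at x)"
    by (rule frechet_derivative_cong_open[OF assms])
  then show ?thesis by (simp add: covd_def assms(2,3))
qed

lemma axis_vector_matrix_mult: "axis i 1 v* M = M $ i" for M :: "complex^'n::finite^'m::finite"
  by (simp add: vector_matrix_mult_def axis_def vec_eq_iff if_distrib[of "\<lambda>c. c * _"] cong: if_cong)

lemma covd_frame: "covd A X (frame i) z = A z (X z) $ i"
  by (simp add: covd_def frame_def axis_vector_matrix_mult)

lemma covd_const: "covd A X (\<lambda>_. c) z = c v* A z (X z)"
  by (simp add: covd_def)

text \<open>The connection along \<theta>1. Row 1 says that \<theta>1 \<Omega> is the third frame
  element, row 3 restates the definition of the fourth, row 2 is L1 solved for \<theta>1 (\<theta>1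
  - 2 \<theta>2) \<Omega>, and row 4 is forced by flatness.\<close>

definition gm1 :: "complex^2 \<Rightarrow> complex^4^4" where
  "gm1 z = vector
    [vector [0, 0, 1, 0],
     vector [0, 0, 2 * z $ 1, 4 * z $ 1 / discr z],
     vector [0, 0, 0, 1 / discr z],
     vector [0, 0, 2 * z $ 1 - 12 * (z $ 1)^2 + 48 * (z $ 1)^2 * z $ 2, 0]]"

text \<open>The connection along \<theta>2. Row 1 is half the difference of the third and second
  frame elements, row 3 follows because the two covariant derivatives commute on \<Omega>, row 2 is
  L2 solved for \<theta>2 (\<theta>1 - 2 \<theta>2) \<Omega>, which creates the denominator 1 - 4
  z2, and row 4 is again forced by flatness.\<close>

definition gm2 :: "complex^2 \<Rightarrow> complex^4^4" where
  "gm2 z = vector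
    [vector [0, - 1 / 2, 1 / 2, 0],
     vector [0, 2 * z $ 2 / (1 - 4 * z $ 2), - z $ 1 * (1 + 4 * z $ 2) / (1 - 4 * z $ 2),
       (1 - 4 * z $ 1 - 16 * z $ 1 * z $ 2) / (2 * (1 - 4 * z $ 2) * discr z)],
     vector [0, 0, - z $ 1, (1 - 4 * z $ 1) / (2 * discr z)],
     vector [0, 0, 2 * (z $ 1)^2 * (4 * z $ 1 + 12 * z $ 2 - 16 * z $ 1 * z $ 2 - 1), z $ 1]]"

definition gm_form :: "complex^2 \<Rightarrow> complex^2 \<Rightarrow> complex^4^4" where
  "gm_form z v = mscale (v $ 1 / z $ 1) (gm1 z) + mscale (v $ 2 / z $ 2) (gm2 z)"

lemma vector_4_nth [simp]:
  "(vector [a, b, c, d] :: 'a::zero^4) $ 1 = a" "(vector [a, b, c, d] :: 'a::zero^4) $ 2 = b"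
  "(vector [a, b, c, d] :: 'a::zero^4) $ 3 = c" "(vector [a, b, c, d] :: 'a::zero^4) $ 4 = d"
  by (simp_all add: vector_def)

lemma vec_eq_4_iff: "v = w \<longleftrightarrow> v $ 1 = w $ 1 \<and> v $ 2 = w $ 2 \<and> v $ 3 = w $ 3 \<and> v $ 4 = w $ 4"
  for v w :: "'a^4"
  by (simp add: vec_eq_iff forall_4)

lemma axis_4_nth:
  "(axis i c :: complex^4) $ j = (if j = i then c else 0)" by (simp add: axis_def)

lemma vector_matrix_mult_4_nth:
  "(v v* M) $ j = v $ 1 * M $ 1 $ j + v $ 2 * M $ 2 $ j + v $ 3 * M $ 3 $ j + v $ 4 * M $ 4 $ j"
  for M :: "complex^'n::finite^4"
  by (simp add: vector_matrix_mult_def sum_4 mult.commute)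

lemma theta_nth [simp]:
  "theta 1 z $ 1 = z $ 1" "theta 1 z $ 2 = 0" "theta 2 z $ 1 = 0" "theta 2 z $ 2 = z $ 2"
  by (simp_all add: theta_def axis_def)

lemma has_derivative_nth [derivative_intros]: "((\<lambda>z. z $ i) has_derivative (\<lambda>v. v $ i)) F"
  by (rule bounded_linear_imp_has_derivative[OF bounded_linear_vec_nth])

lemma has_derivative_discr [derivative_intros]:
  "(discr has_derivative (\<lambda>v. (- 8 * (1 - 4 * z $ 1) - 128 * z $ 1 * z $ 2) * v $ 1 - 64 * (z $ 1)^2 * v $ 2)) (at z)"
  unfolding discr_def[abs_def]
  by (auto intro!: derivative_eq_intros simp: fun_eq_iff) (simp add: algebra_simps)

text \<open>The derivatives of the discriminant along \<theta>1 and, for \<open>discr2\<close>,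
  along \<theta>2.\<close>

definition discr1 where "discr1 z = z $ 1 * (- 8 * (1 - 4 * z $ 1) - 128 * z $ 1 * z $ 2)"
definition discr2 where "discr2 z = - 64 * (z $ 1)^2 * z $ 2"

lemma moduli_baseD:
  assumes "z \<in> moduli_base"
  shows "z $ 1 \<noteq> 0" "z $ 2 \<noteq> 0" "1 - 4 * z $ 2 \<noteq> 0" "discr z \<noteq> 0" "4 * z $ 2 \<noteq> 1"
  using assms by (auto simp: moduli_base_def)

text \<open>Entrywise derivative of \<open>gm1\<close> along \<theta>2; \<open>dgm2\<close> is that
  of \<open>gm2\<close> along \<theta>1. Only these mixed derivatives enter the curvature.\<close>

definition dgm1 :: "complex^2 \<Rightarrow> complex^4^4" where
  "dgm1 z = vector
    [vector [0, 0, 0, 0],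
     vector [0, 0, 0, - 4 * z $ 1 * discr2 z / (discr z)^2],
     vector [0, 0, 0, - discr2 z / (discr z)^2],
     vector [0, 0, 48 * (z $ 1)^2 * z $ 2, 0]]"

definition dgm2 :: "complex^2 \<Rightarrow> complex^4^4" where
  "dgm2 z = vector
    [vector [0, 0, 0, 0],
     vector [0, 0, - z $ 1 * (1 + 4 * z $ 2) / (1 - 4 * z $ 2),
       (- 4 * z $ 1 - 16 * z $ 1 * z $ 2) / (2 * (1 - 4 * z $ 2) * discr z)
       - (1 - 4 * z $ 1 - 16 * z $ 1 * z $ 2) * discr1 z / (2 * (1 - 4 * z $ 2) * (discr z)^2)],
     vector [0, 0, - z $ 1, - 2 * z $ 1 / discr z - (1 - 4 * z $ 1) * discr1 z / (2 * (discr z)^2)],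
     vector [0, 0, 4 * (z $ 1)^2 * (4 * z $ 1 + 12 * z $ 2 - 16 * z $ 1 * z $ 2 - 1)
       + 2 * (z $ 1)^2 * (4 * z $ 1 - 16 * z $ 1 * z $ 2), z $ 1]]"

text \<open>The derivative stays existentially quantified: the derivative rules synthesise it, and
  only its value on the single vector \<open>v\<close> has to be recognised.\<close>

lemma matrix_row_derivative:
  fixes M :: "complex^'n::finite \<Rightarrow> complex^'r::finite^'s::finite"
  assumes "\<And>j. \<exists>D. ((\<lambda>w. M w $ i $ j) has_derivative D) (at z) \<and> D v = N $ i $ j"
  shows "\<exists>D. ((\<lambda>w. M w $ i) has_derivative D) (at z) \<and> D v = N $ i"
proof -
  obtain D where "\<And>j. ((\<lambda>w. M w $ i $ j) has_derivative D j) (at z)" "\<And>j. D j v = N $ i $ j"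
    using assms by metis
  then show ?thesis
    by (intro exI[where x = "\<lambda>v. \<chi> j. D j v"]) (simp add: has_derivative_vec_nth_iff vec_eq_iff)
qed

lemma gm1_row_derivative:
  assumes "z \<in> moduli_base"
  shows "\<exists>D. ((\<lambda>w. gm1 w $ i) has_derivative D) (at z) \<and> D (theta 2 z) = dgm1 z $ i"
proof (rule matrix_row_derivative)
  note nz = moduli_baseD[OF assms]
  have 0: "\<exists>D. ((\<lambda>w. c) has_derivative D) (at z) \<and> D (theta 2 z) = 0" for c :: complex
    by (rule exI[where x = "\<lambda>_. 0"]) auto
  have 43: "\<exists>D. ((\<lambda>w::complex^2. 2 * w $ 1 - 12 * (w $ 1)^2 + 48 * (w $ 1)^2 * w $ 2) has_derivative D) (at z)
      \<and> D (theta 2 z) = 48 * (z $ 1)^2 * z $ 2"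
    by (rule exI, rule conjI, (rule derivative_eq_intros refl | simp add: nz)+)
  show "\<exists>D. ((\<lambda>w. gm1 w $ i $ j) has_derivative D) (at z) \<and> D (theta 2 z) = dgm1 z $ i $ j" for j
    using exhaust_4[of i] exhaust_4[of j]
    apply (elim disjE)
    apply (simp_all only: gm1_def dgm1_def vector_4_nth 0 43)
    by (rule exI, rule conjI, (rule derivative_eq_intros refl | simp add: nz)+,
      simp add: nz discr2_def power2_eq_square divide_simps algebra_simps)+
qed

lemma gm2_row_derivative:
  assumes "z \<in> moduli_base"
  shows "\<exists>D. ((\<lambda>w. gm2 w $ i) has_derivative D) (at z) \<and> D (theta 1 z) = dgm2 z $ i"
proof (rule matrix_row_derivative)
  note nz = moduli_baseD[OF assms]
  have 0: "\<exists>D. ((\<lambda>w. c) has_derivative D) (at z) \<and> D (theta 1 z) = 0" for c :: complex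
    by (rule exI[where x = "\<lambda>_. 0"]) auto
  have 22: "\<exists>D. ((\<lambda>w::complex^2. 2 * w $ 2 / (1 - 4 * w $ 2)) has_derivative D) (at z) \<and> D (theta 1 z) = 0"
    by (rule exI, rule conjI, (rule derivative_eq_intros refl | simp add: nz)+)
  have 23: "\<exists>D. ((\<lambda>w::complex^2. - w $ 1 * (1 + 4 * w $ 2) / (1 - 4 * w $ 2)) has_derivative D) (at z)
      \<and> D (theta 1 z) = - z $ 1 * (1 + 4 * z $ 2) / (1 - 4 * z $ 2)"
    by (rule exI, rule conjI, (rule derivative_eq_intros refl | simp add: nz)+)
  have 33: "\<exists>D. ((\<lambda>w::complex^2. - w $ 1) has_derivative D) (at z) \<and> D (theta 1 z) = - z $ 1"
    by (rule exI, rule conjI, (rule derivative_eq_intros refl | simp add: nz)+)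
  have 44: "\<exists>D. ((\<lambda>w::complex^2. w $ 1) has_derivative D) (at z) \<and> D (theta 1 z) = z $ 1"
    by (rule exI, rule conjI, (rule derivative_eq_intros refl | simp add: nz)+)
  have 43: "\<exists>D. ((\<lambda>w::complex^2. 2 * (w $ 1)^2 * (4 * w $ 1 + 12 * w $ 2 - 16 * w $ 1 * w $ 2 - 1)) has_derivative D) (at z)
      \<and> D (theta 1 z) = 4 * (z $ 1)^2 * (4 * z $ 1 + 12 * z $ 2 - 16 * z $ 1 * z $ 2 - 1)
       + 2 * (z $ 1)^2 * (4 * z $ 1 - 16 * z $ 1 * z $ 2)"
    by (rule exI, rule conjI, (rule derivative_eq_intros refl | simp add: nz)+) (simp add: power2_eq_square algebra_simps)
  have 34: "\<exists>D. ((\<lambda>w. (1 - 4 * w $ 1) / (2 * discr w)) has_derivative D) (at z)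
      \<and> D (theta 1 z) = - 2 * z $ 1 / discr z - (1 - 4 * z $ 1) * discr1 z / (2 * (discr z)^2)"
    by (rule exI, rule conjI, (rule derivative_eq_intros refl | simp add: nz)+)
      (simp add: nz discr1_def power2_eq_square divide_simps, simp add: algebra_simps)
  have 24: "\<exists>D. ((\<lambda>w. (1 - 4 * w $ 1 - 16 * w $ 1 * w $ 2) / (2 * (1 - 4 * w $ 2) * discr w)) has_derivative D) (at z)
      \<and> D (theta 1 z) = (- 4 * z $ 1 - 16 * z $ 1 * z $ 2) / (2 * (1 - 4 * z $ 2) * discr z)
       - (1 - 4 * z $ 1 - 16 * z $ 1 * z $ 2) * discr1 z / (2 * (1 - 4 * z $ 2) * (discr z)^2)"
    by (rule exI, rule conjI, (rule derivative_eq_intros refl | simp add: nz)+)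
      (simp add: nz discr1_def power2_eq_square divide_simps, simp add: algebra_simps)
  show "\<exists>D. ((\<lambda>w. gm2 w $ i $ j) has_derivative D) (at z) \<and> D (theta 1 z) = dgm2 z $ i $ j" for j
    using exhaust_4[of i] exhaust_4[of j]
    by (elim disjE) (simp_all only: gm2_def dgm2_def vector_4_nth 0 22 23 24 33 34 43 44)
qed

text \<open>Zero curvature for the commuting fields \<theta>1 and \<theta>2. Sections are row
  vectors, so connection matrices multiply from the right.\<close>

lemma gm_flat:
  assumes "z \<in> moduli_base"
  shows "dgm2 z $ i + gm2 z $ i v* gm1 z = dgm1 z $ i + gm1 z $ i v* gm2 z"
proof -
  \<comment> \<open>The discriminant stays an atom \<open>d\<close> while denominators are cleared;
    its expansion is substituted only in the polynomial identities that remain.\<close>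
  define x y d where xy: "x = z $ 1" "y = z $ 2" "d = discr z"
  have nz: "1 - 4 * y \<noteq> 0" "d \<noteq> 0" "4 * y \<noteq> 1" using moduli_baseD[OF assms] by (simp_all add: xy)
  have d: "d = (1 - 4 * x)^2 - 64 * x^2 * y" by (simp add: xy discr_def)
  note defs = gm1_def gm2_def dgm1_def dgm2_def discr1_def discr2_def xy[symmetric]
  consider "i = 1" | "i = 2" | "i = 3" | "i = 4" using exhaust_4[of i] by blast
  then show ?thesis
  proof cases
    case 1
    show ?thesis unfolding 1
      by (simp add: vec_eq_4_iff vector_matrix_mult_4_nth defs nz divide_simps)
  next
    case 2
    show ?thesis unfolding 2
      by (simp add: vec_eq_4_iff vector_matrix_mult_4_nth defs nz divide_simps;
          (intro conjI)?; (simp only: d)?; algebra)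
  next
    case 3
    show ?thesis unfolding 3
      by (simp add: vec_eq_4_iff vector_matrix_mult_4_nth defs nz divide_simps;
          (intro conjI)?; (simp only: d)?; algebra)
  next
    case 4
    show ?thesis unfolding 4
      by (simp add: vec_eq_4_iff vector_matrix_mult_4_nth defs nz divide_simps;
          (intro conjI)?; (simp only: d)?; algebra)
  qed
qed


section \<open>Uniqueness and existence of the Gauss-Manin connection\<close>

lemma theta_expansion:
  fixes v :: "complex^2"
  assumes "z $ 1 \<noteq> 0" "z $ 2 \<noteq> 0"
  shows "v = (v $ 1 / z $ 1) *s theta 1 z + (v $ 2 / z $ 2) *s theta 2 z"
  using assms by (simp add: vec_eq_iff forall_2)

lemma mscale_nth [simp]: "mscale c M $ i = c *s M $ i"
  by (simp add: mscale_def)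

lemma gm_form_theta:
  assumes "z \<in> moduli_base"
  shows "gm_form z (theta 1 z) = gm1 z" "gm_form z (theta 2 z) = gm2 z"
  using moduli_baseD(1,2)[OF assms] by (simp_all add: gm_form_def vec_eq_iff)

text \<open>The rows of an arbitrary connection matrix are identified only on \<open>U\<close>;
  there the explicit expression \<open>t\<close> can be differentiated in their place.\<close>

lemma covd_eq:
  assumes "open U" "z \<in> U" "\<And>w. w \<in> U \<Longrightarrow> s w = t w" "\<exists>D. (t has_derivative D) (at z) \<and> D (X z) = d"
  shows "covd A X s z = d + t z v* A z (X z)"
proof -
  obtain D where D: "(t has_derivative D) (at z)" "D (X z) = d" using assms(4) by blast
  show ?thesis
    using covd_cong_open[OF assms(1-3), where A = A and X = X] D frechet_derivative_at[OF D(1)]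
    by (simp add: covd_def[of A X t])
qed

lemma covd_eq_const:
  assumes "open U" "z \<in> U" "\<And>w. w \<in> U \<Longrightarrow> s w = c"
  shows "covd A X s z = c v* A z (X z)"
  using covd_cong_open[OF assms, where A = A and X = X] by (simp add: covd_const)

lemma gauss_manin_connection_unique:
  assumes U: "open U" "U \<subseteq> moduli_base" and A: "gauss_manin_connection U A" and z: "z \<in> U"
  shows "A z v = gm_form z v"
proof -
  define a1 where "a1 w = A w (theta 1 w)" for w
  define a2 where "a2 w = A w (theta 2 w)" for w
  have lin: "A w (v + v') = A w v + A w v'" "A w (c *s v) = mscale c (A w v)" if "w \<in> U" for w v v' c
    using A that unfolding gauss_manin_connection_def by blast+
  note gm = A[unfolded gauss_manin_connection_def Let_def picard_fuchs_1_def picard_fuchs_2_def]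
  have D1f: "covd A (theta 1) (frame i) = (\<lambda>w. a1 w $ i)" and D2f: "covd A (theta 2) (frame i) = (\<lambda>w. a2 w $ i)" for i
    by (simp_all add: fun_eq_iff covd_frame a1_def a2_def)
  have a1: "A w (theta 1 w) = a1 w" and a2: "A w (theta 2 w) = a2 w" for w
    by (simp_all add: a1_def a2_def)
  have a11: "a1 w $ 1 = axis 3 1" if "w \<in> U" for w
    using gm that unfolding D1f by (simp add: frame_def)
  have a21: "a2 w $ 1 = (1/2) *s (axis 3 1 - axis 2 1)" if w: "w \<in> U" for w
  proof -
    have "frame 2 w = covd A (\<lambda>w. theta 1 w - 2 *s theta 2 w) (frame 1) w"
      using gm w by blast
    then have "axis 2 1 = A w (theta 1 w - 2 *s theta 2 w) $ 1"
      unfolding covd_frame by (simp add: frame_def)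
    also have "theta 1 w - 2 *s theta 2 w = theta 1 w + (-2) *s theta 2 w"
      by (simp add: vec_eq_iff)
    also have "A w \<dots> = a1 w + mscale (-2) (a2 w)"
      by (simp only: lin[OF w] a1 a2)
    finally show ?thesis
      using a11[OF w] by (simp add: vec_eq_iff field_simps)
  qed
  have t: "a1 w $ 1 - 2 *s a2 w $ 1 = axis 2 1" if "w \<in> U" for w
    using a11[OF that] a21[OF that] by (simp add: vec_eq_iff)
  have row2: "((1/2) *s (axis 3 1 - axis 2 1)) v* M = (1/2) *s (M $ 3 - M $ 2)" for M :: "complex^4^4"
    by (simp add: vec_eq_iff vector_matrix_mult_4_nth axis_4_nth field_simps)
  have c: "covd A X (\<lambda>w. a1 w $ 1) z = axis 3 1 v* A z (X z)"
    "covd A X (\<lambda>w. a2 w $ 1) z = (1/2) *s (A z (X z) $ 3 - A z (X z) $ 2)"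
    "covd A X (\<lambda>w. a1 w $ 1 - 2 *s a2 w $ 1) z = axis 2 1 v* A z (X z)" if "z \<in> U" for X z
    using covd_eq_const[OF U(1) that a11] covd_eq_const[OF U(1) that a21] covd_eq_const[OF U(1) that t]
    by (simp_all only: row2)
  have a13: "a1 w $ 3 = gm1 w $ 3" if w: "w \<in> U" for w
  proof -
    have nz: "discr w \<noteq> 0" using moduli_baseD(4) U(2) w by blast
    have "axis 4 1 = inverse (Y111 w) *s (covd A (theta 1) (\<lambda>w. a1 w $ 1) w)"
      using gm w unfolding D1f by (simp add: frame_def)
    then have "axis 4 1 = discr w *s a1 w $ 3"
      using nz by (simp add: c[OF w] a1 axis_vector_matrix_mult Y111_def)
    then show ?thesis
      using nz by (simp add: vec_eq_4_iff gm1_def axis_4_nth field_simps)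
  qed
  have a12: "a1 w $ 2 = gm1 w $ 2" if w: "w \<in> U" for w
  proof -
    have "covd A (theta 1) (\<lambda>w. a1 w $ 1 - 2 *s a2 w $ 1) w
        - (2 * w $ 1) *s (2 *s covd A (theta 1) (\<lambda>w. a1 w $ 1) w + a1 w $ 1) = 0"
      using gm w unfolding D1f D2f by blast
    then have "a1 w $ 2 = (2 * w $ 1) *s (2 *s gm1 w $ 3 + axis 3 1)"
      by (simp add: c[OF w] a1 axis_vector_matrix_mult a13[OF w] a11[OF w])
    then show ?thesis
      by (simp add: vec_eq_4_iff gm1_def axis_4_nth)
  qed
  have flat: "covd A (theta 1) (\<lambda>w. a2 w $ i) w = covd A (theta 2) (\<lambda>w. a1 w $ i) w" if "w \<in> U" for w i
    using gm that unfolding D1f D2f by blast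
  \<comment> \<open>Flatness on \<Omega>: the \<theta>2-derivative of \<theta>1 \<Omega> is the
    \<theta>1-derivative of \<theta>2 \<Omega>, and the latter has constant coefficients by
    \<open>a21\<close>.\<close>
  have a23: "a2 w $ 3 = gm2 w $ 3" if w: "w \<in> U" for w
    using flat[OF w, of 1]
    by (simp add: c[OF w] a1 a2 axis_vector_matrix_mult a13[OF w] a12[OF w])
      (use moduli_baseD(4)[OF subsetD[OF U(2) w]] in \<open>auto simp: vec_eq_4_iff gm1_def gm2_def field_simps\<close>)
  have a22: "a2 w $ 2 = gm2 w $ 2" if w: "w \<in> U" for w
  proof -
    have nz: "4 * w $ 2 \<noteq> 1" "1 - 4 * w $ 2 \<noteq> 0" "discr w \<noteq> 0"
      using moduli_baseD U(2) w by blast+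
    have "covd A (theta 2) (\<lambda>w. a2 w $ 1) w - w $ 2 *s (covd A (theta 1) (\<lambda>w. a1 w $ 1 - 2 *s a2 w $ 1) w
       - 2 *s covd A (theta 2) (\<lambda>w. a1 w $ 1 - 2 *s a2 w $ 1) w - (a1 w $ 1 - 2 *s a2 w $ 1)) = 0"
      using gm w unfolding D1f D2f by blast
    \<comment> \<open>This is L2. The unknown row \<open>a2 w $ 2\<close> stands on both sides with
      total coefficient 1 - 4 z2, which is invertible on \<open>moduli_base\<close>.\<close>
    then have *: "(1/2) *s (gm2 w $ 3 - a2 w $ 2) = w $ 2 *s (gm1 w $ 2 - 2 *s a2 w $ 2 - axis 2 1)"
      by (simp add: c[OF w] a1 a2 axis_vector_matrix_mult a12[OF w] a23[OF w] t[OF w])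
    have "a2 w $ 2 = (1 / (1 - 4 * w $ 2)) *s (gm2 w $ 3 - (2 * w $ 2) *s gm1 w $ 2 + (2 * w $ 2) *s axis 2 1)"
    proof -
      have "(1 - 4 * w $ 2) * a2 w $ 2 $ j = gm2 w $ 3 $ j - (2 * w $ 2) * gm1 w $ 2 $ j + 2 * w $ 2 * axis 2 1 $ j" for j
        using arg_cong[OF *, of "\<lambda>v. 2 * v $ j"] by (simp add: algebra_simps)
      then have "a2 w $ 2 $ j = (gm2 w $ 3 $ j - (2 * w $ 2) * gm1 w $ 2 $ j + 2 * w $ 2 * axis 2 1 $ j)
          / (1 - 4 * w $ 2)" for j
        by (intro eq_divide_imp nz(2)) (simp add: mult.commute)
      then show ?thesis
        by (simp add: vec_eq_iff diff_divide_distrib add_divide_distrib)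
    qed
    then show ?thesis
      using nz by (simp add: vec_eq_4_iff gm1_def gm2_def axis_4_nth divide_simps) (simp add: algebra_simps)?
  qed
  have zb: "z \<in> moduli_base" using z U(2) by blast
  note nz = moduli_baseD[OF zb]
  have rows: "a1 z $ 1 = gm1 z $ 1" "a2 z $ 1 = gm2 z $ 1"
    using a11[OF z] a21[OF z] by (simp_all add: vec_eq_4_iff gm1_def gm2_def axis_4_nth)
  \<comment> \<open>Subtracting the flatness identity of the explicit matrices from that of
    \<open>A\<close> on a row already known cancels everything except the unknown fourth rows,
    weighted by the entries in column 4.\<close>
  have P: "gm2 z $ i $ 4 * (a1 z $ 4 $ j - gm1 z $ 4 $ j) = gm1 z $ i $ 4 * (a2 z $ 4 $ j - gm2 z $ 4 $ j)"
    if i: "\<And>w. w \<in> U \<Longrightarrow> a1 w $ i = gm1 w $ i" "\<And>w. w \<in> U \<Longrightarrow> a2 w $ i = gm2 w $ i" for i j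
  proof -
    have "dgm2 z $ i + gm2 z $ i v* a1 z = dgm1 z $ i + gm1 z $ i v* a2 z"
      using flat[OF z, of i] covd_eq[where s = "\<lambda>w. a2 w $ i" and t = "\<lambda>w. gm2 w $ i" and X = "theta 1" and A = A,
          OF U(1) z i(2) gm2_row_derivative[OF zb]]
        covd_eq[where s = "\<lambda>w. a1 w $ i" and t = "\<lambda>w. gm1 w $ i" and X = "theta 2" and A = A,
          OF U(1) z i(1) gm1_row_derivative[OF zb]]
      by (simp add: a1 a2)
    then have "gm2 z $ i v* a1 z - gm2 z $ i v* gm1 z = gm1 z $ i v* a2 z - gm1 z $ i v* gm2 z"
      using arg_cong2[where f = "(-)", OF _ gm_flat[OF zb, of i]] by (metis add_diff_cancel_left)
    then have "(gm2 z $ i v* a1 z - gm2 z $ i v* gm1 z) $ j = (gm1 z $ i v* a2 z - gm1 z $ i v* gm2 z) $ j"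
      by simp
    then show ?thesis
      by (simp add: vector_matrix_mult_4_nth rows a12[OF z] a13[OF z] a22[OF z] a23[OF z] right_diff_distrib)
  qed
  \<comment> \<open>Rows 2 and 3 give two homogeneous equations for the errors p and q. Eliminating
    q leaves the discriminant times p.\<close>
  have Pj: "a1 z $ 4 $ j = gm1 z $ 4 $ j \<and> a2 z $ 4 $ j = gm2 z $ 4 $ j" for j
  proof -
    define p q where "p = a1 z $ 4 $ j - gm1 z $ 4 $ j" and "q = a2 z $ 4 $ j - gm2 z $ 4 $ j"
    have "discr z * ((1 - 4 * z $ 1) * p - 2 * q) = 0"
      using P[OF a13 a23, of j, folded p_def q_def] nz(4)
      by (simp add: gm1_def[of z] gm2_def[of z] field_simps)
    then have "(1 - 4 * z $ 1) * p = 2 * q" using nz(4) by simp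
    moreover have "(1 - 4 * z $ 1 - 16 * z $ 1 * z $ 2) * p = 8 * z $ 1 * (1 - 4 * z $ 2) * q"
      using P[OF a12 a22, of j, folded p_def q_def] nz
      by (simp add: gm1_def[of z] gm2_def[of z] divide_simps)
    ultimately have "((1 - 4 * z $ 1)^2 - 64 * (z $ 1)^2 * z $ 2) * p = 0" by algebra
    then have "p = 0" using nz(4) by (simp add: discr_def)
    moreover from this have "q = 0" using \<open>(1 - 4 * z $ 1) * p = 2 * q\<close> by simp
    ultimately show ?thesis by (simp add: p_def q_def)
  qed
  have "a1 z = gm1 z" "a2 z = gm2 z"
    using rows a12[OF z] a13[OF z] a22[OF z] a23[OF z] Pj by (simp_all add: vec_eq_4_iff)
  then show ?thesis
    by (subst theta_expansion[of z v, OF moduli_baseD(1,2)[OF zb]])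
      (simp add: lin[OF z] a1 a2 gm_form_def)
qed


lemma holo_on_gm:
  assumes "U \<subseteq> moduli_base"
  shows "holo_on (\<lambda>z. gm1 z $ i $ j) U" "holo_on (\<lambda>z. gm2 z $ i $ j) U"
proof -
  have nz: "z $ 1 \<noteq> 0" "z $ 2 \<noteq> 0" "1 - 4 * z $ 2 \<noteq> 0" "discr z \<noteq> 0" if "z \<in> U" for z
    using moduli_baseD assms that by blast+
  have d: "holo_on discr U"
    unfolding discr_def[abs_def]
    by (intro holo_on_diff holo_on_mult holo_on_power holo_on_const holo_on_nth)
  note rules = holo_on_diff holo_on_add holo_on_mult holo_on_uminus holo_on_divide holo_on_power
    holo_on_const holo_on_nth d
  show "holo_on (\<lambda>z. gm1 z $ i $ j) U"
    using exhaust_4[of i] exhaust_4[of j]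
    by (elim disjE; simp only: gm1_def vector_4_nth; intro rules; simp add: nz)
  show "holo_on (\<lambda>z. gm2 z $ i $ j) U"
    using exhaust_4[of i] exhaust_4[of j]
    by (elim disjE; simp only: gm2_def vector_4_nth; intro rules; use nz in auto)
qed


text \<open>The converse of the uniqueness result: it supplies the connection whose existence the
  theorem asserts.\<close>

lemma gauss_manin_connection_gm_form:
  assumes U: "open U" "U \<subseteq> moduli_base"
  shows "gauss_manin_connection U gm_form"
proof -
  have zb: "z \<in> moduli_base" if "z \<in> U" for z using that U(2) by blast
  have D1f: "covd gm_form (theta 1) (frame i) z = gm1 z $ i"
    and D2f: "covd gm_form (theta 2) (frame i) z = gm2 z $ i" if "z \<in> U" for i z
    by (simp_all add: covd_frame gm_form_theta[OF zb[OF that]])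
  have D1: "covd gm_form (theta 1) (\<lambda>_. c) z = c v* gm1 z"
    and D2: "covd gm_form (theta 2) (\<lambda>_. c) z = c v* gm2 z" if "z \<in> U" for c z
    by (simp_all add: covd_const gm_form_theta[OF zb[OF that]])
  have D1D1: "covd gm_form (theta 1) (covd gm_form (theta 1) (frame 1)) z = axis 3 1 v* gm1 z"
    and D2D2: "covd gm_form (theta 2) (covd gm_form (theta 2) (frame 1)) z = ((1/2) *s (axis 3 1 - axis 2 1)) v* gm2 z"
    and D1t: "covd gm_form (theta 1) (\<lambda>w. covd gm_form (theta 1) (frame 1) w - 2 *s covd gm_form (theta 2) (frame 1) w) z
      = axis 2 1 v* gm1 z"
    and D2t: "covd gm_form (theta 2) (\<lambda>w. covd gm_form (theta 1) (frame 1) w - 2 *s covd gm_form (theta 2) (frame 1) w) z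
      = axis 2 1 v* gm2 z" if z: "z \<in> U" for z
    unfolding D1[OF z, symmetric] D2[OF z, symmetric]
    by (rule covd_cong_open[OF U(1) z]; simp add: D1f D2f vec_eq_4_iff gm1_def gm2_def axis_4_nth)+
  show ?thesis
    unfolding gauss_manin_connection_def Let_def picard_fuchs_1_def picard_fuchs_2_def
  proof (intro conjI ballI allI)
    fix z assume z: "z \<in> U"
    have nz: "z $ 1 \<noteq> 0" "z $ 2 \<noteq> 0" "1 - 4 * z $ 2 \<noteq> 0" "discr z \<noteq> 0" "4 * z $ 2 \<noteq> 1"
      using moduli_baseD[OF zb[OF z]] by blast+
    show "gm_form z (v + w) = gm_form z v + gm_form z w" for v w
      by (simp add: gm_form_def vec_eq_iff add_divide_distrib algebra_simps)
    show lin: "gm_form z (c *s v) = mscale c (gm_form z v)" for c v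
      by (simp add: gm_form_def vec_eq_iff algebra_simps)
    have "gm_form z (theta 1 z - 2 *s theta 2 z) = gm1 z - mscale 2 (gm2 z)"
      using nz by (simp add: gm_form_def vec_eq_iff)
    then show "frame 2 z = covd gm_form (\<lambda>w. theta 1 w - 2 *s theta 2 w) (frame 1) z"
      unfolding covd_frame by (simp add: frame_def vec_eq_4_iff gm1_def gm2_def axis_4_nth)
    show "frame 3 z = covd gm_form (theta 1) (frame 1) z"
      by (simp add: D1f[OF z]) (simp add: frame_def vec_eq_4_iff gm1_def axis_4_nth)
    show "frame 4 z = inverse (Y111 z) *s covd gm_form (theta 1) (covd gm_form (theta 1) (frame 1)) z"
      unfolding D1D1[OF z] axis_vector_matrix_mult
      using nz by (simp add: frame_def Y111_def vec_eq_4_iff gm1_def axis_4_nth)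
    show "covd gm_form (theta 1) (\<lambda>w. covd gm_form (theta 1) (frame 1) w - 2 *s covd gm_form (theta 2) (frame 1) w) z
      - (2 * z $ 1) *s (2 *s covd gm_form (theta 1) (covd gm_form (theta 1) (frame 1)) z
        + covd gm_form (theta 1) (frame 1) z) = 0"
      unfolding D1D1[OF z] D1t[OF z] D1f[OF z] axis_vector_matrix_mult
      by (simp add: vec_eq_4_iff gm1_def)
    show "covd gm_form (theta 2) (covd gm_form (theta 2) (frame 1)) z
      - z $ 2 *s (covd gm_form (theta 1) (\<lambda>w. covd gm_form (theta 1) (frame 1) w - 2 *s covd gm_form (theta 2) (frame 1) w) z
        - 2 *s covd gm_form (theta 2) (\<lambda>w. covd gm_form (theta 1) (frame 1) w - 2 *s covd gm_form (theta 2) (frame 1) w) z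
        - (covd gm_form (theta 1) (frame 1) z - 2 *s covd gm_form (theta 2) (frame 1) z)) = 0"
      unfolding D2D2[OF z] D1t[OF z] D2t[OF z] D1f[OF z] D2f[OF z] axis_vector_matrix_mult
      using nz by (simp add: vec_eq_4_iff gm1_def gm2_def axis_4_nth vector_matrix_mult_4_nth divide_simps;
          simp add: algebra_simps)
    show "covd gm_form (theta 1) (covd gm_form (theta 2) (frame i)) z
        = covd gm_form (theta 2) (covd gm_form (theta 1) (frame i)) z" for i
      using covd_eq[where s = "covd gm_form (theta 2) (frame i)" and t = "\<lambda>w. gm2 w $ i" and X = "theta 1" and A = gm_form,
          OF U(1) z D2f gm2_row_derivative[OF zb[OF z]]]
        covd_eq[where s = "covd gm_form (theta 1) (frame i)" and t = "\<lambda>w. gm1 w $ i" and X = "theta 2" and A = gm_form,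
          OF U(1) z D1f gm1_row_derivative[OF zb[OF z]]]
        gm_flat[OF zb[OF z], of i]
      by (simp add: gm_form_theta[OF zb[OF z]])
  next
    show "holo_on (\<lambda>z. gm_form z v $ i $ j) U" for v i j
      using U(2) unfolding gm_form_def vector_add_component mscale_nth vector_smult_component
      by (intro holo_on_add holo_on_mult holo_on_divide holo_on_const holo_on_nth holo_on_gm)
        (auto simp: moduli_base_def)
  qed
qed

section \<open>The frame matrix and its group\<close>

lemma exhaust_6: "x = 1 \<or> x = 2 \<or> x = 3 \<or> x = 4 \<or> x = 5 \<or> x = 6" for x :: 6
proof (induct x)
  case (of_int z)
  have "0 \<le> z" by (rule of_int)
  have "z < int CARD(6)" by (rule of_int)
  then have "z < 6" by simp
  then have "z = 0 \<or> z = 1 \<or> z = 2 \<or> z = 3 \<or> z = 4 \<or> z = 5" using \<open>0 \<le> z\<close> by presburger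
  then show ?case by (elim disjE) simp_all
qed

lemma vec_eq_6_iff: "v = w \<longleftrightarrow> v $ 1 = w $ 1 \<and> v $ 2 = w $ 2 \<and> v $ 3 = w $ 3
    \<and> v $ 4 = w $ 4 \<and> v $ 5 = w $ 5 \<and> v $ 6 = w $ 6"
  for v w :: "'a^6"
proof
  assume *: "v $ 1 = w $ 1 \<and> v $ 2 = w $ 2 \<and> v $ 3 = w $ 3 \<and> v $ 4 = w $ 4 \<and> v $ 5 = w $ 5 \<and> v $ 6 = w $ 6"
  have "v $ i = w $ i" for i
    using exhaust_6[of i] * by (elim disjE) simp_all
  then show "v = w" by (simp add: vec_eq_iff)
qed simp

lemma vector_6_nth [simp]:
  "(vector [a, b, c, d, e, f] :: 'a::zero^6) $ 1 = a" "(vector [a, b, c, d, e, f] :: 'a::zero^6) $ 2 = b"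
  "(vector [a, b, c, d, e, f] :: 'a::zero^6) $ 3 = c" "(vector [a, b, c, d, e, f] :: 'a::zero^6) $ 4 = d"
  "(vector [a, b, c, d, e, f] :: 'a::zero^6) $ 5 = e" "(vector [a, b, c, d, e, f] :: 'a::zero^6) $ 6 = f"
  by (simp_all add: vector_def)

lemma zpart_nth [simp]: "zpart p $ 1 = p $ 1" "zpart p $ 2 = p $ 2"
  by (simp_all add: zpart_def)

lemma spart_nth [simp]: "spart p $ 1 = p $ 3" "spart p $ 2 = p $ 4" "spart p $ 3 = p $ 5" "spart p $ 4 = p $ 6"
  by (simp_all add: spart_def)

lemma zpart_smult: "zpart (c *s v) = c *s zpart v"
  by (simp add: vec_eq_iff forall_2)

lemma bounded_linear_zpart: "bounded_linear zpart"
  unfolding linear_conv_bounded_linear[symmetric]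
  by (rule linearI) (simp_all add: vec_eq_iff forall_2)

lemma bounded_linear_spart: "bounded_linear spart"
  unfolding linear_conv_bounded_linear[symmetric]
  by (rule linearI) (simp_all add: vec_eq_iff forall_4)

lemma open_enhanced_moduli:
  assumes "open U" "open V" shows "open (enhanced_moduli U V)"
proof -
  have "enhanced_moduli U V = zpart -` U \<inter> spart -` V" by (auto simp: enhanced_moduli_def)
  then show ?thesis
    using assms by (auto intro!: open_Int open_vimage linear_continuous_on
        bounded_linear_zpart bounded_linear_spart)
qed

text \<open>Inverse of the pair \<open>zpart\<close>, \<open>spart\<close>. It yields a point of the
  moduli space and, with base component 0, transfers the derivative of \<open>Sm\<close> to
  \<open>Smat\<close>.\<close>

definition gm_point :: "complex^2 \<Rightarrow> complex^4 \<Rightarrow> complex^6" where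
  "gm_point z s = vector [z $ 1, z $ 2, s $ 1, s $ 2, s $ 3, s $ 4]"

lemma gm_point [simp]: "zpart (gm_point z s) = z" "spart (gm_point z s) = s"
  by (simp_all add: gm_point_def vec_eq_iff forall_2 forall_4)

section \<open>Matrix-valued functions and the differential of the frame matrix\<close>

lemma has_derivative_matrix_iff:
  fixes f :: "'a::real_normed_vector \<Rightarrow> complex^'n::finite^'m::finite"
  shows "(f has_derivative D) (at x) \<longleftrightarrow> (\<forall>i j. ((\<lambda>x. f x $ i $ j) has_derivative (\<lambda>v. D v $ i $ j)) (at x))"
  by (subst has_derivative_vec_nth_iff, subst has_derivative_vec_nth_iff) (rule refl)

lemma bounded_bilinear_matrix_mult:
  "bounded_bilinear ((**) :: complex^'n::finite^'m::finite \<Rightarrow> complex^'k::finite^'n \<Rightarrow> complex^'k^'m)"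
  unfolding bilinear_conv_bounded_bilinear[symmetric] bilinear_def
  by (auto intro!: linearI simp: vec_eq_iff matrix_matrix_mult_def sum.distrib algebra_simps scaleR_sum_right)

lemma bounded_bilinear_mscale:
  "bounded_bilinear (mscale :: complex \<Rightarrow> complex^'n::finite^'m::finite \<Rightarrow> _)"
  unfolding bilinear_conv_bounded_bilinear[symmetric] bilinear_def
  by (auto intro!: linearI simp: vec_eq_iff mscale_def algebra_simps)

lemma mscale_mult: "mscale c M ** N = mscale c (M ** N)" "M ** mscale c N = mscale c (M ** N)"
  for M :: "complex^'n::finite^'m::finite" and N :: "complex^'k::finite^'n"
  by (simp_all add: vec_eq_iff matrix_matrix_mult_def sum_distrib_left algebra_simps)

lemma matrix_mult_row: "(M ** N) $ i = M $ i v* N"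
  for M :: "complex^'n::finite^'m::finite" and N :: "complex^'k::finite^'n"
  by (simp add: vec_eq_iff matrix_matrix_mult_def vector_matrix_mult_def mult.commute)

definition Sm :: "complex^6 \<Rightarrow> complex^4^4" where
  "Sm p = vector [vector [1, 0, 0, 0], vector [0, p $ 3, p $ 4, 0],
     vector [0, 0, inverse (p $ 6), 0], vector [0, 0, p $ 5, p $ 6]]"

definition Sm_inv :: "complex^6 \<Rightarrow> complex^4^4" where
  "Sm_inv p = vector [vector [1, 0, 0, 0], vector [0, 1 / p $ 3, - p $ 4 * p $ 6 / p $ 3, 0],
     vector [0, 0, p $ 6, 0], vector [0, 0, - p $ 5, 1 / p $ 6]]"

definition dSm :: "complex^6 \<Rightarrow> complex^6 \<Rightarrow> complex^4^4" where
  "dSm p v = vector [vector [0, 0, 0, 0], vector [0, v $ 3, v $ 4, 0],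
     vector [0, 0, - v $ 6 / (p $ 6)^2, 0], vector [0, 0, v $ 5, v $ 6]]"

lemma Smat_spart: "Smat (spart p) = Sm p"
  by (simp add: Smat_def Sm_def)

lemma has_derivative_Sm:
  assumes "p $ 6 \<noteq> 0" shows "(Sm has_derivative dSm p) (at p)"
  unfolding has_derivative_matrix_iff
proof (intro allI)
  have inv: "((\<lambda>q. inverse (q $ 6)) has_derivative (\<lambda>v. - v $ 6 / (p $ 6)^2)) (at p)"
    by (rule has_derivative_eq_rhs[OF Deriv.has_derivative_inverse[OF assms has_derivative_nth]])
      (simp add: fun_eq_iff power2_eq_square divide_inverse)
  fix i j
  show "((\<lambda>q. Sm q $ i $ j) has_derivative (\<lambda>v. dSm p v $ i $ j)) (at p)"
    using exhaust_4[of i] exhaust_4[of j]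
    by (elim disjE; simp only: Sm_def dSm_def vector_4_nth;
      intro has_derivative_const has_derivative_nth inv)
qed

lemma matrix_mult_4_nth:
  "(M ** N) $ i $ j = M $ i $ 1 * N $ 1 $ j + M $ i $ 2 * N $ 2 $ j + M $ i $ 3 * N $ 3 $ j + M $ i $ 4 * N $ 4 $ j"
  for M :: "complex^4^'m::finite" and N :: "complex^'k::finite^4"
  by (simp add: matrix_matrix_mult_def sum_4)

lemma Sm_inv:
  assumes "p $ 3 \<noteq> 0" "p $ 6 \<noteq> 0"
  shows "Sm p ** Sm_inv p = mat 1" "Sm_inv p ** Sm p = mat 1"
  using assms by (simp_all add: vec_eq_4_iff matrix_mult_4_nth Sm_def Sm_inv_def mat_def field_simps)

lemma matrix_inv_eqI:
  fixes M :: "complex^'n::finite^'n"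
  assumes "M ** N = mat 1" "N ** M = mat 1"
  shows "matrix_inv M = N"
proof -
  have "M ** matrix_inv M = mat 1 \<and> matrix_inv M ** M = mat 1"
    unfolding matrix_inv_def by (rule someI[where x = N]) (use assms in simp)
  then show ?thesis by (metis assms(2) matrix_mul_assoc matrix_mul_lid matrix_mul_rid)
qed

text \<open>Multiplying by S on the right removes \<open>matrix_inv\<close> and leaves dS + S A = M
  S, an equation linear in the tangent vector.\<close>

lemma gm_matrix_eq_iff:
  assumes "p $ 3 \<noteq> 0" "p $ 6 \<noteq> 0"
  shows "gm_matrix A p v = M \<longleftrightarrow> dSm p v + Sm p ** A (zpart p) (zpart v) = M ** Sm p"
proof -
  have i: "matrix_inv (Sm p) = Sm_inv p"
    using Sm_inv[OF assms] by (rule matrix_inv_eqI)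
  have "frechet_derivative (\<lambda>q. Smat (spart q)) (at p) = dSm p"
    unfolding Smat_spart using frechet_derivative_at[OF has_derivative_Sm[OF assms(2)]] by simp
  then have "gm_matrix A p v = (dSm p v + Sm p ** A (zpart p) (zpart v)) ** Sm_inv p"
    by (simp add: gm_matrix_def Smat_spart i)
  moreover have "B ** Sm_inv p = M \<longleftrightarrow> B = M ** Sm p" for B
  proof
    assume "B ** Sm_inv p = M"
    then have "M ** Sm p = B ** (Sm_inv p ** Sm p)" by (simp add: matrix_mul_assoc)
    then show "B = M ** Sm p" by (simp add: Sm_inv[OF assms])
  next
    assume "B = M ** Sm p"
    then have "B ** Sm_inv p = M ** (Sm p ** Sm_inv p)" by (simp add: matrix_mul_assoc)
    then show "B ** Sm_inv p = M" by (simp add: Sm_inv[OF assms])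
  qed
  ultimately show ?thesis by simp
qed

text \<open>The Lie algebra of the block of rows and columns 2, 3, 4, in which \<open>dS S\<^sup>-\<^sup>1 + S A S\<^sup>-\<^sup>1\<close> takes
  its values.\<close>

definition hh :: "(complex^4^4) set" where
  "hh = {m. m $ 1 = 0 \<and> (\<forall>i. m $ i $ 1 = 0) \<and> m $ 3 $ 2 = 0 \<and> m $ 4 $ 2 = 0 \<and> m $ 3 $ 3 + m $ 4 $ 4 = 0}"

text \<open>The coefficients of \<open>\<theta>\<^sub>1\<close>, \<open>\<theta>\<^sub>2\<close> in the base component of the field with block \<open>m\<close>, obtained by
  matching the entries \<open>n34\<close>, \<open>n24\<close> of \<open>S\<^sup>-\<^sup>1 m S\<close>, to which \<open>dS\<close> does not contribute, with those of the
  connection form.\<close>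

definition gm_alpha_beta :: "complex^4^4 \<Rightarrow> complex^6 \<Rightarrow> complex^2" where
  "gm_alpha_beta m p = (let n34 = (p $ 6)^2 * m $ 3 $ 4;
      n24 = p $ 6 / p $ 3 * m $ 2 $ 4 - p $ 4 * (p $ 6)^2 / p $ 3 * m $ 3 $ 4;
      b = 2 * (1 - 4 * p $ 2) * (n24 - 4 * p $ 1 * n34)
    in vector [discr (zpart p) * n34 - (1 - 4 * p $ 1) / 2 * b, b])"

text \<open>With the base component fixed, \<open>a\<close> is the value of the connection form and
  dS must equal m S - S a. The four group coordinates are read off at the entries of dS where they
  stand alone; entry (3,3), the differential of the inverse of s44, is left as a consistency
  condition.\<close>

definition gm_field_at :: "complex^4^4 \<Rightarrow> complex^6 \<Rightarrow> complex^6" where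
  "gm_field_at m p = (let c = gm_alpha_beta m p;
      a = mscale (c $ 1) (gm1 (zpart p)) + mscale (c $ 2) (gm2 (zpart p));
      w = m ** Sm p - Sm p ** a
    in vector [p $ 1 * c $ 1, p $ 2 * c $ 2, w $ 2 $ 2, w $ 2 $ 3, w $ 4 $ 3, w $ 4 $ 4])"

text \<open>The last two equations recover the \<theta>-coefficients from entries (3,4) and (2,4).
  Subtracting 4 z1 times the former from the latter removes \<theta>1, as column 4 of
  \<open>gm1\<close> has entries 4 z1 / d and 1 / d. The coefficient left for \<theta>2 simplifies
  because its numerator is exactly the discriminant.\<close>

lemma gm_form_entries:
  fixes p v :: "complex^6"
  assumes "zpart p \<in> moduli_base"
  defines "a \<equiv> gm_form (zpart p) (zpart v)"
  shows "a $ i $ 1 = 0" "a $ 3 $ 2 = 0" "a $ 4 $ 2 = 0" "a $ 4 $ 4 = - a $ 3 $ 3"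
    "discr (zpart p) * a $ 3 $ 4 = v $ 1 / p $ 1 + (1 - 4 * p $ 1) / 2 * (v $ 2 / p $ 2)"
    "2 * (1 - 4 * p $ 2) * (a $ 2 $ 4 - 4 * p $ 1 * a $ 3 $ 4) = v $ 2 / p $ 2"
proof -
  note nz = moduli_baseD[OF assms(1)]
  show "a $ i $ 1 = 0" "a $ 3 $ 2 = 0" "a $ 4 $ 2 = 0" "a $ 4 $ 4 = - a $ 3 $ 3"
    using exhaust_4[of i] by (auto simp: a_def gm_form_def gm1_def gm2_def)
  show "discr (zpart p) * a $ 3 $ 4 = v $ 1 / p $ 1 + (1 - 4 * p $ 1) / 2 * (v $ 2 / p $ 2)"
    using nz by (simp add: a_def gm_form_def gm1_def gm2_def divide_simps; simp add: algebra_simps)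
  define x y d \<alpha> \<beta> where xy: "x = p $ 1" "y = p $ 2" "d = discr (zpart p)" "\<alpha> = v $ 1 / p $ 1" "\<beta> = v $ 2 / p $ 2"
  have nz': "d \<noteq> 0" "1 - 4 * y \<noteq> 0" "4 * y \<noteq> 1" using nz by (simp_all add: xy)
  have e: "a $ 3 $ 4 = \<alpha> / d + \<beta> * (1 - 4 * x) / (2 * d)"
    "a $ 2 $ 4 = \<alpha> * (4 * x / d) + \<beta> * (1 - 4 * x - 16 * x * y) / (2 * (1 - 4 * y) * d)"
    by (simp_all add: a_def gm_form_def gm1_def gm2_def xy)
  have "2 * (1 - 4 * y) * (a $ 2 $ 4 - 4 * x * a $ 3 $ 4)
      = \<beta> * (1 - 4 * x - 16 * x * y - 4 * x * (1 - 4 * x) * (1 - 4 * y)) / d"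
    unfolding e using nz' by (simp add: divide_simps; simp add: algebra_simps)
  also have "1 - 4 * x - 16 * x * y - 4 * x * (1 - 4 * x) * (1 - 4 * y) = d"
    by (simp add: xy discr_def power2_eq_square algebra_simps)
  finally have "2 * (1 - 4 * y) * (a $ 2 $ 4 - 4 * x * a $ 3 $ 4) = \<beta>"
    using nz' by simp
  then show "2 * (1 - 4 * p $ 2) * (a $ 2 $ 4 - 4 * p $ 1 * a $ 3 $ 4) = v $ 2 / p $ 2"
    by (simp add: xy)
qed

lemma gm_field_at_entries:
  fixes p :: "complex^6" and m :: "complex^4^4"
  defines "a \<equiv> gm_form (zpart p) (zpart (gm_field_at m p))" and "v \<equiv> gm_field_at m p"
  assumes p: "zpart p \<in> moduli_base" "p $ 3 \<noteq> 0" "p $ 6 \<noteq> 0"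
  shows "a $ 3 $ 4 = (p $ 6)^2 * m $ 3 $ 4"
    "p $ 3 * a $ 2 $ 4 = p $ 6 * m $ 2 $ 4 - p $ 4 * (p $ 6)^2 * m $ 3 $ 4"
    "v $ 3 = (m ** Sm p - Sm p ** a) $ 2 $ 2" "v $ 4 = (m ** Sm p - Sm p ** a) $ 2 $ 3"
    "v $ 5 = (m ** Sm p - Sm p ** a) $ 4 $ 3" "v $ 6 = (m ** Sm p - Sm p ** a) $ 4 $ 4"
proof -
  note nz = moduli_baseD[OF p(1)]
  define c where "c = gm_alpha_beta m p"
  have v12: "v $ 1 / p $ 1 = c $ 1" "v $ 2 / p $ 2 = c $ 2"
    using nz by (simp_all add: v_def gm_field_at_def Let_def c_def)
  have a: "a = mscale (c $ 1) (gm1 (zpart p)) + mscale (c $ 2) (gm2 (zpart p))"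
    unfolding a_def gm_form_def v_def[symmetric] zpart_nth v12 ..
  have "discr (zpart p) * a $ 3 $ 4 = c $ 1 + (1 - 4 * p $ 1) / 2 * c $ 2"
    using gm_form_entries(5)[OF p(1), of v] by (simp add: a_def v_def[symmetric] v12)
  also have "\<dots> = discr (zpart p) * ((p $ 6)^2 * m $ 3 $ 4)"
    by (simp add: c_def gm_alpha_beta_def Let_def)
  finally show a34: "a $ 3 $ 4 = (p $ 6)^2 * m $ 3 $ 4"
    using nz by simp
  define n24 where "n24 = p $ 6 / p $ 3 * m $ 2 $ 4 - p $ 4 * (p $ 6)^2 / p $ 3 * m $ 3 $ 4"
  have "2 * (1 - 4 * p $ 2) * (a $ 2 $ 4 - 4 * p $ 1 * a $ 3 $ 4) = c $ 2"
    using gm_form_entries(6)[OF p(1), of v] by (simp only: a_def v_def[symmetric] v12)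
  also have "c $ 2 = 2 * (1 - 4 * p $ 2) * (n24 - 4 * p $ 1 * a $ 3 $ 4)"
    by (simp add: c_def gm_alpha_beta_def Let_def n24_def a34)
  finally have "a $ 2 $ 4 = n24" using nz by simp
  then show "p $ 3 * a $ 2 $ 4 = p $ 6 * m $ 2 $ 4 - p $ 4 * (p $ 6)^2 * m $ 3 $ 4"
    using p by (simp add: n24_def right_diff_distrib)
  show "v $ 3 = (m ** Sm p - Sm p ** a) $ 2 $ 2" "v $ 4 = (m ** Sm p - Sm p ** a) $ 2 $ 3"
    "v $ 5 = (m ** Sm p - Sm p ** a) $ 4 $ 3" "v $ 6 = (m ** Sm p - Sm p ** a) $ 4 $ 4"
    unfolding a c_def v_def by (simp_all only: gm_field_at_def Let_def vector_6_nth)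
qed

text \<open>Six entries hold by construction, and the zero pattern of \<open>hh\<close> settles the
  others except (3,3). That one follows because the lower 2 by 2 blocks of both m and the connection
  form are trace-free.\<close>

lemma gm_field_at_rows:
  assumes m: "m \<in> hh" and p: "zpart p \<in> moduli_base" "p $ 3 \<noteq> 0" "p $ 6 \<noteq> 0" and i: "i \<noteq> 1"
  shows "(dSm p (gm_field_at m p) + Sm p ** gm_form (zpart p) (zpart (gm_field_at m p))) $ i = (m ** Sm p) $ i"
proof -
  define v where "v = gm_field_at m p"
  define a where "a = gm_form (zpart p) (zpart v)"
  note f = gm_field_at_entries[OF p, of m, folded v_def, folded a_def]
  note e = gm_form_entries(1-4)[OF p(1), of v, folded a_def]
  have m0: "m $ i $ 1 = 0" "m $ 3 $ 2 = 0" "m $ 4 $ 2 = 0" "m $ 4 $ 4 = - m $ 3 $ 3" for i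
    using m by (auto simp: hh_def add_eq_0_iff)
  note simps = vec_eq_4_iff matrix_mult_4_nth Sm_def dSm_def e m0
  consider "i = 2" | "i = 3" | "i = 4" using exhaust_4[of i] i by blast
  then have "(dSm p v + Sm p ** a) $ i = (m ** Sm p) $ i"
  proof cases
    case 1
    show ?thesis unfolding 1 using p f(1,2)
      by (simp add: simps f(3,4); simp add: algebra_simps power2_eq_square)
  next
    case 2
    \<comment> \<open>The value of \<open>v $ 6\<close> was read off at entry (4,4); rewriting (4,4)
      entries as negatives of (3,3) entries prepares it for the (3,3) equation.\<close>
    have "v $ 6 = - p $ 6 * m $ 3 $ 3 - m $ 3 $ 4 * p $ 5 * (p $ 6)^2 + p $ 6 * a $ 3 $ 3"
      using p f(1) by (simp add: simps f(6); simp add: algebra_simps power2_eq_square)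
    then show ?thesis unfolding 2 using p f(1)
      by (simp add: simps; simp add: field_simps power2_eq_square)
  next
    case 3
    show ?thesis unfolding 3 using p f(1,2)
      by (simp add: simps f(5,6))
  qed
  then show ?thesis by (simp add: v_def a_def)
qed

text \<open>The matrix m ranges beyond \<open>hh\<close> so that it can be
  \<open>gm_matrix A p v\<close>, whose first row is in general non-zero; v is then recovered from
  its own connection matrix.\<close>

lemma gm_field_at_unique:
  assumes p: "zpart p \<in> moduli_base" "p $ 3 \<noteq> 0" "p $ 6 \<noteq> 0"
    and rows: "\<And>i. i \<noteq> 1 \<Longrightarrow> (dSm p v + Sm p ** gm_form (zpart p) (zpart v)) $ i = (m ** Sm p) $ i"
  shows "v = gm_field_at m p"
proof -
  note nz = moduli_baseD[OF p(1)]
  define a where "a = gm_form (zpart p) (zpart v)"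
  note e = gm_form_entries[OF p(1), of v, folded a_def]
  note r = rows[of 2, simplified] rows[of 3, simplified] rows[of 4, simplified]
  note simps = matrix_mult_4_nth Sm_def dSm_def a_def[symmetric]
  have r34: "a $ 3 $ 4 = (p $ 6)^2 * m $ 3 $ 4"
    using arg_cong[OF r(2), of "\<lambda>r. r $ 4"] p by (simp add: simps field_simps power2_eq_square)
  have "p $ 3 * a $ 2 $ 4 + p $ 4 * a $ 3 $ 4 = m $ 2 $ 4 * p $ 6"
    using arg_cong[OF r(1), of "\<lambda>r. r $ 4"] by (simp add: simps)
  then have r24: "a $ 2 $ 4 = p $ 6 / p $ 3 * m $ 2 $ 4 - p $ 4 * (p $ 6)^2 / p $ 3 * m $ 3 $ 4"
    using p unfolding r34 by (simp add: field_simps)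
  define c where "c = gm_alpha_beta m p"
  have c2: "c $ 2 = v $ 2 / p $ 2"
    unfolding e(6)[symmetric] by (simp add: c_def gm_alpha_beta_def Let_def r34 r24)
  have c1: "c $ 1 = v $ 1 / p $ 1"
  proof -
    have "c $ 1 = discr (zpart p) * a $ 3 $ 4 - (1 - 4 * p $ 1) / 2 * c $ 2"
      by (simp add: c_def gm_alpha_beta_def Let_def r34)
    then show ?thesis unfolding e(5) c2 by simp
  qed
  have a: "a = mscale (c $ 1) (gm1 (zpart p)) + mscale (c $ 2) (gm2 (zpart p))"
    unfolding a_def gm_form_def c1 c2 zpart_nth ..
  have d: "dSm p v $ i = (m ** Sm p - Sm p ** a) $ i" if "i \<noteq> 1" for i
    using rows[OF that] unfolding a_def[symmetric] by (simp add: algebra_simps)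
  have "v $ 3 = dSm p v $ 2 $ 2" "v $ 4 = dSm p v $ 2 $ 3" "v $ 5 = dSm p v $ 4 $ 3" "v $ 6 = dSm p v $ 4 $ 4"
    by (simp_all add: dSm_def)
  then show ?thesis
    unfolding vec_eq_6_iff gm_field_at_def Let_def vector_6_nth c_def[symmetric] a[symmetric]
    using nz by (simp add: d c1 c2)
qed

lemma gm_field_at_linear:
  "gm_field_at (m + n) p = gm_field_at m p + gm_field_at n p"
  "gm_field_at (mscale c m) p = c *s gm_field_at m p"
proof -
  define n24 where "n24 m = p $ 6 / p $ 3 * m $ 2 $ 4 - p $ 4 * (p $ 6)^2 / p $ 3 * m $ 3 $ 4" for m :: "complex^4^4"
  define k where "k = (1 - 4 * p $ 1) / 2"
  have n24: "n24 (m + n) = n24 m + n24 n" "n24 (mscale c m) = c * n24 m"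
    by (simp_all add: n24_def ring_distribs mult.left_commute)
  have ab_eq: "gm_alpha_beta m p = vector [discr (zpart p) * ((p $ 6)^2 * m $ 3 $ 4)
      - k * (2 * (1 - 4 * p $ 2) * (n24 m - 4 * p $ 1 * ((p $ 6)^2 * m $ 3 $ 4))),
      2 * (1 - 4 * p $ 2) * (n24 m - 4 * p $ 1 * ((p $ 6)^2 * m $ 3 $ 4))]" for m
    by (simp add: gm_alpha_beta_def Let_def n24_def k_def)
  have ab: "gm_alpha_beta (m + n) p = gm_alpha_beta m p + gm_alpha_beta n p"
    "gm_alpha_beta (mscale c m) p = c *s gm_alpha_beta m p"
    unfolding ab_eq n24 by (simp_all add: vec_eq_iff forall_2 algebra_simps)
  have M: "mscale (a + b) M = mscale a M + mscale b M" "mscale (a * b) M = mscale a (mscale b M)" for a b and M :: "complex^4^4"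
    by (simp_all add: vec_eq_iff algebra_simps)
  show "gm_field_at (m + n) p = gm_field_at m p + gm_field_at n p"
    unfolding gm_field_at_def Let_def ab
    by (simp add: vec_eq_6_iff M matrix_add_ldistrib matrix_mult_4_nth algebra_simps)
  show "gm_field_at (mscale c m) p = c *s gm_field_at m p"
    unfolding gm_field_at_def Let_def ab
    by (simp add: vec_eq_6_iff M matrix_mult_4_nth algebra_simps)
qed

text \<open>This is why the modular matrices determine a field although their first rows contain
  unknown functions.\<close>

lemma gm_field_at_cong:
  assumes "\<And>i. i \<noteq> 1 \<Longrightarrow> m $ i = n $ i" shows "gm_field_at m p = gm_field_at n p"
  using assms by (simp add: gm_field_at_def gm_alpha_beta_def Let_def matrix_mult_4_nth)

section \<open>The structure equation\<close>

lemmas matrix_add_rdistrib = bounded_bilinear.add_left[OF bounded_bilinear_matrix_mult]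
lemmas matrix_diff_ldistrib = bounded_bilinear.diff_right[OF bounded_bilinear_matrix_mult]

lemma has_derivative_mscale:
  fixes M :: "'a::real_normed_vector \<Rightarrow> complex^'n::finite^'m::finite"
  assumes "(f has_derivative f') (at x)" "(M has_derivative M') (at x)"
  shows "((\<lambda>x. mscale (f x) (M x)) has_derivative (\<lambda>v. mscale (f x) (M' v) + mscale (f' v) (M x))) (at x)"
  using bounded_bilinear.FDERIV[OF bounded_bilinear_mscale assms] .

lemma has_derivative_matrix_mult:
  fixes M :: "'a::real_normed_vector \<Rightarrow> complex^'n::finite^'m::finite"
  assumes "(M has_derivative M') (at x)" "(N has_derivative N') (at x)"
  shows "((\<lambda>x. M x ** N x) has_derivative (\<lambda>v. M x ** N' v + M' v ** N x)) (at x)"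
  using bounded_bilinear.FDERIV[OF bounded_bilinear_matrix_mult assms] .

lemma matrix_holo_derivative:
  fixes M :: "complex^'n::finite \<Rightarrow> complex^'k::finite^'m::finite"
  assumes "\<And>i j. holo_on (\<lambda>z. M z $ i $ j) S" "z \<in> S"
  obtains D where "(M has_derivative D) (at z)" "\<And>v w. D (v + w) = D v + D w" "\<And>c v. D (c *s v) = mscale c (D v)"
proof
  let ?D = "\<lambda>v. \<chi> i j. frechet_derivative (\<lambda>z. M z $ i $ j) (at z) v"
  show D: "(M has_derivative ?D) (at z)"
    unfolding has_derivative_matrix_iff using holo_onD(1)[OF assms] by simp
  show "?D (v + w) = ?D v + ?D w" for v w
    using linear_add[OF has_derivative_linear[OF D]] .
  show "?D (c *s v) = mscale c (?D v)" for c v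
    by (simp add: vec_eq_iff holo_onD(2)[OF assms])
qed

lemma matrix_derivative_row:
  fixes M :: "'a::real_normed_vector \<Rightarrow> complex^'k::finite^'m::finite"
  assumes D: "(M has_derivative D) (at z)"
    and "\<And>i. \<exists>d. ((\<lambda>w. M w $ i) has_derivative d) (at z) \<and> d v = N $ i"
  shows "D v = N"
proof -
  have "D v $ i = N $ i" for i
  proof -
    obtain d where d: "((\<lambda>w. M w $ i) has_derivative d) (at z)" "d v = N $ i" using assms(2) by blast
    have "((\<lambda>w. M w $ i) has_derivative (\<lambda>v. D v $ i)) (at z)"
      using D by (simp add: has_derivative_vec_nth_iff)
    from has_derivative_unique[OF this d(1)] d(2) show ?thesis by (metis)
  qed
  then show ?thesis by (simp add: vec_eq_iff)
qed

text \<open>The connection form pulled back along \<open>zpart\<close> and contracted with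
  X.\<close>

definition pform :: "(complex^6 \<Rightarrow> complex^6) \<Rightarrow> complex^6 \<Rightarrow> complex^4^4" where
  "pform X q = gm_form (zpart q) (zpart (X q))"

text \<open>Cartan's formula for the flat form: X(A(Y)) - Y(A(X)) + A(Y) A(X) - A(X) A(Y) =
  A([X,Y]).\<close>

lemma pform_flat:
  assumes X: "X \<in> vector_fields T" and Y: "Y \<in> vector_fields T" and p: "p \<in> T" and z: "zpart p \<in> moduli_base"
  obtains DX DY where "(pform X has_derivative DX) (at p)" "(pform Y has_derivative DY) (at p)"
    "DY (X p) - DX (Y p) + pform Y p ** pform X p - pform X p ** pform Y p = pform (vf_bracket T X Y) p"
proof -
  note nz = moduli_baseD[OF z]
  have p12: "p $ 1 \<noteq> 0" "p $ 2 \<noteq> 0" using nz by auto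
  define z where "z = zpart p"
  have zb: "z \<in> moduli_base" using z by (simp add: z_def)
  obtain D1 where D1: "(gm1 has_derivative D1) (at z)" "\<And>v w. D1 (v + w) = D1 v + D1 w" "\<And>c v. D1 (c *s v) = mscale c (D1 v)"
    using matrix_holo_derivative[of gm1, OF holo_on_gm(1)[OF subset_refl] zb] by blast
  obtain D2 where D2: "(gm2 has_derivative D2) (at z)" "\<And>v w. D2 (v + w) = D2 v + D2 w" "\<And>c v. D2 (c *s v) = mscale c (D2 v)"
    using matrix_holo_derivative[of gm2, OF holo_on_gm(2)[OF subset_refl] zb] by blast
  have d1: "D1 (theta 2 z) = dgm1 z"
    by (rule matrix_derivative_row[OF D1(1)]) (rule gm1_row_derivative[OF zb])
  have d2: "D2 (theta 1 z) = dgm2 z"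
    by (rule matrix_derivative_row[OF D2(1)]) (rule gm2_row_derivative[OF zb])
  have zz: "z $ 1 = p $ 1" "z $ 2 = p $ 2" by (simp_all add: z_def)
  have D1z: "D1 (zpart w) = mscale (w $ 1 / p $ 1) (D1 (theta 1 z)) + mscale (w $ 2 / p $ 2) (dgm1 z)"
    and D2z: "D2 (zpart w) = mscale (w $ 1 / p $ 1) (dgm2 z) + mscale (w $ 2 / p $ 2) (D2 (theta 2 z))" for w
    by (subst theta_expansion[of z "zpart w"]; simp add: p12 zz D1(2,3) D2(2,3) d1 d2)+
  have P1: "((\<lambda>q. gm1 (zpart q)) has_derivative (\<lambda>w. D1 (zpart w))) (at p)"
    and P2: "((\<lambda>q. gm2 (zpart q)) has_derivative (\<lambda>w. D2 (zpart w))) (at p)"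
    using D1(1) D2(1) unfolding z_def
    by (auto intro!: has_derivative_compose[OF bounded_linear_imp_has_derivative[OF bounded_linear_zpart]])
  have quot: "((\<lambda>q. W q $ i / q $ i) has_derivative
      (\<lambda>w. frechet_derivative W (at p) w $ i / p $ i - W p $ i * w $ i / (p $ i)^2)) (at p)"
    if W: "W \<in> vector_fields T" and i: "p $ i \<noteq> 0" for W and i :: 6
  proof (rule has_derivative_eq_rhs)
    have "((\<lambda>q. W q $ i) has_derivative (\<lambda>w. frechet_derivative W (at p) w $ i)) (at p)"
      using vector_field_has_derivative(1)[OF W p] by (simp add: has_derivative_vec_nth_iff)
    from has_derivative_divide[OF this has_derivative_nth i]
    show "((\<lambda>q. W q $ i / q $ i) has_derivative (\<lambda>h. - (W p $ i) * (inverse (p $ i) * h $ i * inverse (p $ i))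
        + frechet_derivative W (at p) h $ i / p $ i)) (at p)" .
  qed (simp add: fun_eq_iff divide_inverse power2_eq_square)
  define DW where "DW W w = (mscale (W p $ 1 / p $ 1) (D1 (zpart w))
        + mscale (frechet_derivative W (at p) w $ 1 / p $ 1 - W p $ 1 * w $ 1 / (p $ 1)^2) (gm1 z))
      + (mscale (W p $ 2 / p $ 2) (D2 (zpart w))
        + mscale (frechet_derivative W (at p) w $ 2 / p $ 2 - W p $ 2 * w $ 2 / (p $ 2)^2) (gm2 z))"
    for W :: "complex^6 \<Rightarrow> complex^6" and w :: "complex^6"
  have DW: "(pform W has_derivative DW W) (at p)" if "W \<in> vector_fields T" for W
    unfolding pform_def[abs_def] gm_form_def zpart_nth DW_def[abs_def] z_def
    by (intro has_derivative_add has_derivative_mscale P1 P2 quot that p12)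
  have flat: "dgm2 z + gm2 z ** gm1 z = dgm1 z + gm1 z ** gm2 z"
    using gm_flat[OF zb] by (simp add: vec_eq_iff matrix_mult_row)
  define B where "B = vf_bracket T X Y p"
  have B: "B $ i = frechet_derivative Y (at p) (X p) $ i - frechet_derivative X (at p) (Y p) $ i" for i
    using p by (simp add: B_def vf_bracket_def)
  have "DW Y (X p) - DW X (Y p) + pform Y p ** pform X p - pform X p ** pform Y p = pform (vf_bracket T X Y) p"
  proof -
    \<comment> \<open>In the antisymmetrised sum the pure derivatives of \<open>gm1\<close> along
      \<theta>1 and of \<open>gm2\<close> along \<theta>2 cancel, as do the terms with squared
      denominators. Only the mixed derivatives survive, and flatness trades one for the
      other.\<close>
    have dg: "dgm2 z = dgm1 z + gm1 z ** gm2 z - gm2 z ** gm1 z"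
      using flat by (simp add: algebra_simps)
    have "(DW Y (X p) - DW X (Y p) + pform Y p ** pform X p - pform X p ** pform Y p) $ i $ j
        = pform (vf_bracket T X Y) p $ i $ j" for i j
      unfolding pform_def gm_form_def zpart_nth DW_def z_def[symmetric] B_def[symmetric] B D1z D2z dg
        matrix_add_ldistrib matrix_add_rdistrib mscale_mult
      by (simp add: algebra_simps diff_divide_distrib zz)
    then show ?thesis by (simp add: vec_eq_iff)
  qed
  then show ?thesis using that DW X Y by blast
qed

text \<open>The second differential of \<open>Sm\<close>; the inverse of s44 is its only non-linear
  entry. Its symmetry is what makes the derivatives of dS commute.\<close>

definition ddSm :: "complex^6 \<Rightarrow> complex^6 \<Rightarrow> complex^6 \<Rightarrow> complex^4^4" where
  "ddSm p w v = vector [vector [0, 0, 0, 0], vector [0, 0, 0, 0],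
     vector [0, 0, 2 * w $ 6 * v $ 6 / (p $ 6)^3, 0], vector [0, 0, 0, 0]]"

lemma has_derivative_dSm:
  assumes "(X has_derivative X') (at p)" "p $ 6 \<noteq> 0"
  shows "((\<lambda>q. dSm q (X q)) has_derivative (\<lambda>w. dSm p (X' w) + ddSm p w (X p))) (at p)"
  unfolding has_derivative_matrix_iff
proof (intro allI)
  have X: "((\<lambda>q. X q $ i) has_derivative (\<lambda>w. X' w $ i)) (at p)" for i
    using assms(1) by (simp add: has_derivative_vec_nth_iff)
  have q: "((\<lambda>q. - X q $ 6 / (q $ 6)^2) has_derivative
      (\<lambda>w. - X' w $ 6 / (p $ 6)^2 + 2 * w $ 6 * X p $ 6 / (p $ 6)^3)) (at p)"
    by (rule has_derivative_eq_rhs[OF has_derivative_divide[OF has_derivative_minus[OF X]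
            has_derivative_power[OF has_derivative_nth]]])
      (use assms(2) in \<open>simp_all add: fun_eq_iff power2_eq_square power3_eq_cube divide_simps\<close>)
  fix i j
  show "((\<lambda>q. dSm q (X q) $ i $ j) has_derivative (\<lambda>w. (dSm p (X' w) + ddSm p w (X p)) $ i $ j)) (at p)"
    using exhaust_4[of i] exhaust_4[of j]
    by (elim disjE; simp only: dSm_def ddSm_def vector_4_nth vector_add_component add_0_right;
      intro has_derivative_const X q)
qed

lemma dSm_diff: "dSm p (v - w) = dSm p v - dSm p w"
  by (simp add: dSm_def vec_eq_4_iff diff_divide_distrib)

text \<open>The coefficients in \<omega> of the covariant derivative along X of the moving frame S
  \<omega>.\<close>

definition covS :: "(complex^6 \<Rightarrow> complex^6) \<Rightarrow> complex^6 \<Rightarrow> complex^4^4" where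
  "covS X q = dSm q (X q) + Sm q ** pform X q"

text \<open>Flatness on the moving frame: the commutator of the covariant derivatives along X and Y
  is the covariant derivative along [X,Y]. The second differentials of S cancel by symmetry, the
  products of dS with the form cancel in pairs, and the rest is \<open>pform_flat\<close>.\<close>

lemma covS_commutator:
  assumes X: "X \<in> vector_fields T" and Y: "Y \<in> vector_fields T" and p: "p \<in> T" "zpart p \<in> moduli_base" "p $ 6 \<noteq> 0"
  obtains DX DY where "(covS X has_derivative DX) (at p)" "(covS Y has_derivative DY) (at p)"
    "DY (X p) + covS Y p ** pform X p - (DX (Y p) + covS X p ** pform Y p) = covS (vf_bracket T X Y) p"
proof -
  obtain PX PY where E: "(pform X has_derivative PX) (at p)" "(pform Y has_derivative PY) (at p)"
    "PY (X p) - PX (Y p) + pform Y p ** pform X p - pform X p ** pform Y p = pform (vf_bracket T X Y) p"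
    using pform_flat[OF X Y p(1,2)] by blast
  define DX where "DX w = dSm p (frechet_derivative X (at p) w) + ddSm p w (X p) + (Sm p ** PX w + dSm p w ** pform X p)" for w
  define DY where "DY w = dSm p (frechet_derivative Y (at p) w) + ddSm p w (Y p) + (Sm p ** PY w + dSm p w ** pform Y p)" for w
  have "(covS X has_derivative DX) (at p)" "(covS Y has_derivative DY) (at p)"
    unfolding covS_def[abs_def] DX_def[abs_def] DY_def[abs_def]
    by (intro has_derivative_add has_derivative_dSm has_derivative_matrix_mult has_derivative_Sm
        vector_field_has_derivative(1)[OF X] vector_field_has_derivative(1)[OF Y] E p)+
  moreover have "DY (X p) + covS Y p ** pform X p - (DX (Y p) + covS X p ** pform Y p) = covS (vf_bracket T X Y) p"
  proof -
    have s: "ddSm p (X p) (Y p) = ddSm p (Y p) (X p)" by (simp add: ddSm_def mult.commute mult.left_commute)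
    have b: "vf_bracket T X Y p = frechet_derivative Y (at p) (X p) - frechet_derivative X (at p) (Y p)"
      using p by (simp add: vf_bracket_def)
    show ?thesis
      unfolding covS_def DX_def DY_def E(3)[symmetric] b dSm_diff s
      by (simp add: matrix_add_ldistrib matrix_add_rdistrib matrix_diff_ldistrib matrix_mul_assoc algebra_simps)
  qed
  ultimately show ?thesis using that by blast
qed

section \<open>Vector fields with constant lower block\<close>

lemma Sm_cancel:
  fixes M m :: "complex^4^4"
  assumes "p $ 3 \<noteq> 0" "p $ 6 \<noteq> 0" "(M ** Sm p) $ i = (m ** Sm p) $ i"
  shows "M $ i = m $ i"
proof -
  have "(N ** Sm p) $ i v* Sm_inv p = N $ i" for N :: "complex^4^4"
    unfolding matrix_mult_row[symmetric] matrix_mul_assoc[symmetric] Sm_inv(1)[OF assms(1,2)] by simp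
  then show ?thesis
    using assms(3) by metis
qed

text \<open>The vanishing first column of m hides row 1 of the right factor, the one row in which
  \<open>covS\<close> of a \<open>gm_field\<close> is not prescribed.\<close>

lemma hh_mult_cong:
  assumes "m \<in> hh" "\<And>k. k \<noteq> 1 \<Longrightarrow> M $ k = M' $ k"
  shows "(m ** M) $ i = (m ** M') $ i"
  using assms by (simp add: vec_eq_iff matrix_mult_4_nth hh_def)

lemma holo_on_matrix_mult:
  fixes M N :: "complex^'k::finite \<Rightarrow> complex^4^4"
  assumes "\<And>i j. holo_on (\<lambda>p. M p $ i $ j) S" "\<And>i j. holo_on (\<lambda>p. N p $ i $ j) S"
  shows "holo_on (\<lambda>p. (M p ** N p) $ i $ j) S"
  unfolding matrix_mult_4_nth by (intro holo_on_add holo_on_mult assms)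

locale gm_moduli =
  fixes U V A T
  assumes data: "local_moduli_data U V" and T_eq: "T = enhanced_moduli U V"
    and conn: "gauss_manin_connection U A"
begin

definition gm_field :: "complex^4^4 \<Rightarrow> complex^6 \<Rightarrow> complex^6" where
  "gm_field m p = (if p \<in> T then gm_field_at m p else 0)"

lemma U: "open U" "U \<subseteq> moduli_base"
  using data by (simp_all add: local_moduli_data_def)

lemma open_T: "open T"
  unfolding T_eq using data by (simp add: local_moduli_data_def open_enhanced_moduli)

lemma T_nonempty: "\<exists>p. p \<in> T"
proof -
  obtain z where "z \<in> U" using data by (auto simp: local_moduli_data_def)
  then have "gm_point z s_id \<in> T"
    using data by (simp add: T_eq enhanced_moduli_def local_moduli_data_def)
  then show ?thesis ..
qed

lemma T_memD:
  assumes "p \<in> T"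
  shows "zpart p \<in> U" "zpart p \<in> moduli_base" "p $ 3 \<noteq> 0" "p $ 6 \<noteq> 0"
  using assms data unfolding T_eq enhanced_moduli_def local_moduli_data_def
  by (auto dest!: bspec[of V _ "spart p"])

lemma gm_matrix_iff:
  assumes "p \<in> T"
  shows "gm_matrix A p v = M \<longleftrightarrow> dSm p v + Sm p ** gm_form (zpart p) (zpart v) = M ** Sm p"
  using gm_matrix_eq_iff[OF T_memD(3,4)[OF assms]]
    gauss_manin_connection_unique[OF U conn T_memD(1)[OF assms]] by simp

lemma gm_matrix_explicit:
  assumes "p \<in> T"
  shows "gm_matrix A p v = (dSm p v + Sm p ** gm_form (zpart p) (zpart v)) ** Sm_inv p"
  unfolding gm_matrix_iff[OF assms] matrix_mul_assoc[symmetric] Sm_inv(2)[OF T_memD(3,4)[OF assms]] by simp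

lemma gm_matrix_gm_field:
  assumes p: "p \<in> T" and "m \<in> hh" "i \<noteq> 1"
  shows "gm_matrix A p (gm_field m p) $ i = m $ i"
proof (rule Sm_cancel[OF T_memD(3,4)[OF p]])
  have "dSm p (gm_field m p) + Sm p ** gm_form (zpart p) (zpart (gm_field m p)) = gm_matrix A p (gm_field m p) ** Sm p"
    using gm_matrix_iff[OF p] by blast
  then show "(gm_matrix A p (gm_field m p) ** Sm p) $ i = (m ** Sm p) $ i"
    using gm_field_at_rows[OF assms(2) T_memD(2-4)[OF p] assms(3)] p by (simp add: gm_field_def)
qed

lemma gm_field_at_gm_matrix:
  assumes p: "p \<in> T"
  shows "gm_field_at (gm_matrix A p v) p = v"
proof (rule gm_field_at_unique[OF T_memD(2-4)[OF p], symmetric])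
  have "dSm p v + Sm p ** gm_form (zpart p) (zpart v) = gm_matrix A p v ** Sm p"
    using gm_matrix_iff[OF p] by blast
  then show "(dSm p v + Sm p ** gm_form (zpart p) (zpart v)) $ i = (gm_matrix A p v ** Sm p) $ i" for i
    by simp
qed

lemma eq_gm_fieldI:
  assumes "R \<in> vector_fields T" "\<And>p i. p \<in> T \<Longrightarrow> i \<noteq> 1 \<Longrightarrow> gm_matrix A p (R p) $ i = m $ i"
  shows "R = gm_field m"
proof
  fix p
  show "R p = gm_field m p"
  proof (cases "p \<in> T")
    case True
    have "R p = gm_field_at (gm_matrix A p (R p)) p" by (rule gm_field_at_gm_matrix[OF True, symmetric])
    also have "\<dots> = gm_field_at m p" by (rule gm_field_at_cong) (rule assms(2)[OF True])
    finally show ?thesis using True by (simp add: gm_field_def)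
  next
    case False
    then show ?thesis using vector_fieldsD(2)[OF assms(1)] by (simp add: gm_field_def)
  qed
qed

lemma holo_on_zpart:
  assumes "holo_on f U" shows "holo_on (\<lambda>p. f (zpart p)) T"
proof (rule holo_onI)
  fix p c v assume p: "p \<in> T"
  show "((\<lambda>p. f (zpart p)) has_derivative (\<lambda>v. frechet_derivative f (at (zpart p)) (zpart v))) (at p)"
    by (rule has_derivative_compose[OF bounded_linear_imp_has_derivative[OF bounded_linear_zpart]
          holo_onD(1)[OF assms T_memD(1)[OF p]]])
  show "frechet_derivative f (at (zpart p)) (zpart (c *s v)) = c * frechet_derivative f (at (zpart p)) (zpart v)"
    by (simp add: zpart_smult holo_onD(2)[OF assms T_memD(1)[OF p]])
qed

lemma holo_on_entries:
  "holo_on (\<lambda>p. gm1 (zpart p) $ i $ j) T" "holo_on (\<lambda>p. gm2 (zpart p) $ i $ j) T"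
  "holo_on (\<lambda>p. discr (zpart p)) T" "holo_on (\<lambda>p. Sm p $ i $ j) T" "holo_on (\<lambda>p. Sm_inv p $ i $ j) T"
proof -
  show "holo_on (\<lambda>p. gm1 (zpart p) $ i $ j) T" "holo_on (\<lambda>p. gm2 (zpart p) $ i $ j) T"
    by (rule holo_on_zpart, rule holo_on_gm[OF U(2)])+
  show "holo_on (\<lambda>p. discr (zpart p)) T"
    unfolding discr_def by (intro holo_on_zpart holo_on_diff holo_on_mult holo_on_power holo_on_const holo_on_nth)
  show "holo_on (\<lambda>p. Sm p $ i $ j) T"
    using exhaust_4[of i] exhaust_4[of j]
    by (elim disjE; simp only: Sm_def vector_4_nth; intro holo_on_const holo_on_nth holo_on_inverse T_memD)
  show "holo_on (\<lambda>p. Sm_inv p $ i $ j) T"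
    using exhaust_4[of i] exhaust_4[of j]
    by (elim disjE; simp only: Sm_inv_def vector_4_nth;
      intro holo_on_const holo_on_nth holo_on_mult holo_on_divide holo_on_uminus T_memD)
qed

lemma holo_on_gm_alpha_beta: "holo_on (\<lambda>p. gm_alpha_beta m p $ i) T"
  using exhaust_2[of i]
  by (elim disjE; simp only: gm_alpha_beta_def Let_def vector_2;
    intro holo_on_entries holo_on_add holo_on_diff holo_on_mult holo_on_const holo_on_nth holo_on_power holo_on_divide T_memD;
    simp)

lemma gm_field_vector_fields: "gm_field m \<in> vector_fields T"
proof (rule vector_fieldsI)
  fix i
  have "holo_on (\<lambda>p. gm_field_at m p $ i) T"
    using exhaust_6[of i]
    by (elim disjE; simp only: gm_field_at_def Let_def vector_6_nth vector_minus_component matrix_mult_4_nth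
        vector_add_component mscale_nth vector_smult_component;
      intro holo_on_gm_alpha_beta holo_on_entries holo_on_add holo_on_diff holo_on_mult holo_on_const holo_on_nth)
  then show "holo_on (\<lambda>p. gm_field m p $ i) T"
    by (rule holo_on_cong_open[OF _ open_T]) (simp add: gm_field_def)
qed (simp add: gm_field_def)

text \<open>Serves two purposes: it makes the coefficients of an arbitrary vector field in the basis
  regular, and likewise the functions Y of the modular fields.\<close>

lemma holo_on_gm_matrix:
  assumes W: "W \<in> vector_fields T"
  shows "holo_on (\<lambda>p. gm_matrix A p (W p) $ i $ j) T"
proof (rule holo_on_cong_open[OF _ open_T])
  have d: "holo_on (\<lambda>p. dSm p (W p) $ i $ j) T" for i j
    using exhaust_4[of i] exhaust_4[of j]
    by (elim disjE; simp only: dSm_def vector_4_nth;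
      intro holo_on_const holo_on_uminus vector_fieldsD(1)[OF W] holo_on_divide holo_on_power holo_on_nth;
      use T_memD in simp)
  have f: "holo_on (\<lambda>p. gm_form (zpart p) (zpart (W p)) $ i $ j) T" for i j
    unfolding gm_form_def zpart_nth vector_add_component mscale_nth vector_smult_component
    by (intro holo_on_add holo_on_mult holo_on_entries holo_on_divide vector_fieldsD(1)[OF W] holo_on_nth)
      (use T_memD(2) in \<open>auto simp: moduli_base_def\<close>)
  show "holo_on (\<lambda>p. ((dSm p (W p) + Sm p ** gm_form (zpart p) (zpart (W p))) ** Sm_inv p) $ i $ j) T"
  proof (rule holo_on_matrix_mult)
    show "holo_on (\<lambda>p. (dSm p (W p) + Sm p ** gm_form (zpart p) (zpart (W p))) $ i $ j) T" for i j
      unfolding vector_add_component by (intro holo_on_add d holo_on_matrix_mult holo_on_entries f)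
  qed (rule holo_on_entries)
qed (simp add: gm_matrix_explicit)

lemma gm_field_linear:
  "gm_field (m + n) = gm_field m + gm_field n" "gm_field (mscale c m) = (\<lambda>p. c *s gm_field m p)"
  by (auto simp: fun_eq_iff gm_field_def gm_field_at_linear)

lemma gm_field_at_inj:
  assumes "p \<in> T" "m \<in> hh" "n \<in> hh" "gm_field_at m p = gm_field_at n p"
  shows "m = n"
proof -
  have "m $ i = n $ i" for i
  proof (cases "i = 1")
    case True
    then show ?thesis using assms by (simp add: hh_def)
  next
    case False
    then show ?thesis
      using gm_matrix_gm_field[OF assms(1,2) False] gm_matrix_gm_field[OF assms(1,3) False] assms(1,4)
      by (simp add: gm_field_def)
  qed
  then show ?thesis by (simp add: vec_eq_iff)
qed

lemma gm_field_inj: "inj_on gm_field hh"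
proof (rule inj_onI)
  fix m n assume *: "m \<in> hh" "n \<in> hh" "gm_field m = gm_field n"
  obtain p where p: "p \<in> T" using T_nonempty by blast
  show "m = n"
    using gm_field_at_inj[OF p *(1,2)] fun_cong[OF *(3), of p] p by (simp add: gm_field_def)
qed

lemma covS_gm_field:
  assumes "p \<in> T" "m \<in> hh" "i \<noteq> 1"
  shows "covS (gm_field m) p $ i = (m ** Sm p) $ i"
  using gm_field_at_rows[OF assms(2) T_memD(2-4)[OF assms(1)] assms(3)] assms(1)
  by (simp add: covS_def pform_def gm_field_def)

text \<open>If the derivative of the moving frame along X is m times the frame and along Y it is n
  times the frame, then differentiating first along Y and then along X gives n m, because the
  constant n passes through. Hence the reversed order n m - m n.\<close>

lemma gm_field_bracket:
  assumes m: "m \<in> hh" and n: "n \<in> hh"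
  shows "vf_bracket T (gm_field m) (gm_field n) = gm_field (n ** m - m ** n)"
proof
  fix p
  show "vf_bracket T (gm_field m) (gm_field n) p = gm_field (n ** m - m ** n) p"
  proof (cases "p \<in> T")
    case False
    then show ?thesis by (simp add: vf_bracket_def gm_field_def)
  next
    case p: True
    define X Y where "X = gm_field m" and "Y = gm_field n"
    note XY = gm_field_vector_fields[of m, folded X_def] gm_field_vector_fields[of n, folded Y_def]
    obtain DX DY where D: "(covS X has_derivative DX) (at p)" "(covS Y has_derivative DY) (at p)"
      "DY (X p) + covS Y p ** pform X p - (DX (Y p) + covS X p ** pform Y p) = covS (vf_bracket T X Y) p"
      using covS_commutator[OF XY p T_memD(2,4)[OF p]] by blast
    \<comment> \<open>Outside row 1, \<open>covS (gm_field k)\<close> equals k S on the open set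
      \<open>T\<close>, so its covariant derivative is k times that of S.\<close>
    have row: "(Df w + covS (gm_field k) p ** B) $ i = (k ** (dSm p w + Sm p ** B)) $ i"
      if k: "k \<in> hh" and i: "i \<noteq> 1" and Df: "(covS (gm_field k) has_derivative Df) (at p)" for k Df w B i
    proof -
      have "((\<lambda>q. k ** Sm q) has_derivative (\<lambda>w. k ** dSm p w)) (at p)"
        using has_derivative_matrix_mult[OF has_derivative_const has_derivative_Sm[OF T_memD(4)[OF p]], of k]
        by (simp add: bounded_bilinear.zero_left[OF bounded_bilinear_matrix_mult])
      then have "((\<lambda>q. (k ** Sm q) $ i) has_derivative (\<lambda>w. (k ** dSm p w) $ i)) (at p)"
        unfolding has_derivative_vec_nth_iff[of "\<lambda>q. k ** Sm q"] by blast
      then have "((\<lambda>q. covS (gm_field k) q $ i) has_derivative (\<lambda>w. (k ** dSm p w) $ i)) (at p)"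
        by (rule has_derivative_transform_within_open[OF _ open_T p]) (simp add: covS_gm_field k i)
      moreover have "((\<lambda>q. covS (gm_field k) q $ i) has_derivative (\<lambda>w. Df w $ i)) (at p)"
        using Df by (simp add: has_derivative_vec_nth_iff)
      ultimately have "Df w $ i = (k ** dSm p w) $ i"
        using has_derivative_unique by metis
      moreover have "(covS (gm_field k) p ** B) $ i = (k ** (Sm p ** B)) $ i"
        unfolding matrix_mul_assoc matrix_mult_row[of _ B] covS_gm_field[OF p k i] ..
      ultimately show ?thesis by (simp add: matrix_add_ldistrib)
    qed
    have fold: "dSm p (W p) + Sm p ** pform W p = covS W p" for W by (simp add: covS_def)
    have "covS (vf_bracket T X Y) p $ i = ((n ** m - m ** n) ** Sm p) $ i" if i: "i \<noteq> 1" for i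
    proof -
      have "(DY (X p) + covS Y p ** pform X p) $ i = (n ** covS X p) $ i"
        using row[OF n i D(2)[unfolded Y_def], of "X p" "pform X p"] by (simp only: fold Y_def)
      also have "\<dots> = (n ** (m ** Sm p)) $ i"
        by (rule hh_mult_cong[OF n]) (simp add: X_def covS_gm_field[OF p m])
      finally have 1: "(DY (X p) + covS Y p ** pform X p) $ i = (n ** (m ** Sm p)) $ i" .
      have "(DX (Y p) + covS X p ** pform Y p) $ i = (m ** covS Y p) $ i"
        using row[OF m i D(1)[unfolded X_def], of "Y p" "pform Y p"] by (simp only: fold X_def)
      also have "\<dots> = (m ** (n ** Sm p)) $ i"
        by (rule hh_mult_cong[OF m]) (simp add: Y_def covS_gm_field[OF p n])
      finally have 2: "(DX (Y p) + covS X p ** pform Y p) $ i = (m ** (n ** Sm p)) $ i" .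
      show ?thesis
        unfolding D(3)[symmetric] vector_minus_component 1 2
        by (simp add: bounded_bilinear.diff_left[OF bounded_bilinear_matrix_mult] matrix_mul_assoc)
    qed
    then have "vf_bracket T X Y p = gm_field_at (n ** m - m ** n) p"
      by (intro gm_field_at_unique[OF T_memD(2-4)[OF p]]) (simp add: covS_def pform_def)
    then show ?thesis using p by (simp add: X_def Y_def gm_field_def)
  qed
qed

end

section \<open>Spans of vector fields\<close>

text \<open>Coordinates on \<open>hh\<close>: a, b, c span the radical, d, e, f the trace-free
  block. The subspaces below are described by which of the six vanish.\<close>

definition hmat :: "complex \<Rightarrow> complex \<Rightarrow> complex \<Rightarrow> complex \<Rightarrow> complex \<Rightarrow> complex \<Rightarrow> complex^4^4" where
  "hmat a b c d e f = vector [vector [0, 0, 0, 0], vector [0, a, b, c], vector [0, 0, d, e], vector [0, 0, f, - d]]"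

lemma hmat_hh [simp]: "hmat a b c d e f \<in> hh"
proof -
  have "hmat a b c d e f $ i $ 1 = 0" for i
    using exhaust_4[of i] by (elim disjE) (simp_all add: hmat_def)
  then show ?thesis by (simp add: hh_def) (simp add: hmat_def vec_eq_4_iff)
qed

lemma hh_hmat:
  assumes "m \<in> hh"
  shows "m = hmat (m $ 2 $ 2) (m $ 2 $ 3) (m $ 2 $ 4) (m $ 3 $ 3) (m $ 3 $ 4) (m $ 4 $ 3)"
  using assms by (simp add: hh_def hmat_def vec_eq_4_iff add_eq_0_iff)

lemma hmat_eq_iff: "hmat a b c d e f = hmat a' b' c' d' e' f' \<longleftrightarrow>
    a = a' \<and> b = b' \<and> c = c' \<and> d = d' \<and> e = e' \<and> f = f'"
  by (auto simp: hmat_def vec_eq_4_iff)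

lemma hmat_add: "hmat a b c d e f + hmat a' b' c' d' e' f' = hmat (a + a') (b + b') (c + c') (d + d') (e + e') (f + f')"
  and hmat_mscale: "mscale k (hmat a b c d e f) = hmat (k * a) (k * b) (k * c) (k * d) (k * e) (k * f)"
  by (simp_all add: hmat_def vec_eq_4_iff)

text \<open>Written in the order of \<open>gm_field_bracket\<close>, unprimed field first. The last
  three coordinates involve only d, e, f and their primed versions, and the first is always
  0.\<close>

lemma hmat_commutator:
  "hmat a' b' c' d' e' f' ** hmat a b c d e f - hmat a b c d e f ** hmat a' b' c' d' e' f'
    = hmat 0 (a' * b - a * b' + b' * d - b * d' + c' * f - c * f') (a' * c - a * c' + b' * e - b * e' - c' * d + c * d')
        (e' * f - e * f') (2 * d' * e - 2 * d * e') (2 * d * f' - 2 * d' * f)"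
  by (simp add: hmat_def vec_eq_4_iff matrix_mult_4_nth algebra_simps)

lemma hh_closed:
  assumes "m \<in> hh" "n \<in> hh"
  shows "m + n \<in> hh" "mscale k m \<in> hh" "n ** m - m ** n \<in> hh"
proof -
  obtain a b c d e f a' b' c' d' e' f' where "m = hmat a b c d e f" "n = hmat a' b' c' d' e' f'"
    using hh_hmat[OF assms(1)] hh_hmat[OF assms(2)] by blast
  then show "m + n \<in> hh" "mscale k m \<in> hh" "n ** m - m ** n \<in> hh"
    by (simp_all add: hmat_add hmat_mscale hmat_commutator)
qed

section \<open>The Lie algebra of the group in coordinates\<close>

lemma Smat_gm_point: "Smat s = Sm (gm_point 0 s)"
  by (metis Smat_spart gm_point(2))

lemma bounded_linear_gm_point: "bounded_linear (gm_point 0)"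
  unfolding linear_conv_bounded_linear[symmetric]
  by (rule linearI) (simp_all add: vec_eq_6_iff gm_point_def)

lemma s_id_nth [simp]: "s_id $ 1 = 1" "s_id $ 2 = 0" "s_id $ 3 = 0" "s_id $ 4 = 1"
  by (simp_all add: s_id_def)

text \<open>The sign in \<open>lie_gen 4\<close> is the derivative of the inverse of s44 at 1, since
  the fourth parameter of \<open>hmat\<close> is entry (3,3).\<close>

lemma lie_gen:
  "lie_gen 1 = hmat 1 0 0 0 0 0" "lie_gen 2 = hmat 0 1 0 0 0 0"
  "lie_gen 3 = hmat 0 0 0 0 0 1" "lie_gen 4 = hmat 0 0 0 (- 1) 0 0"
proof -
  have 1: "Smat s_id = mat 1"
    by (simp add: Smat_def vec_eq_4_iff mat_def)
  have "(Smat has_derivative (\<lambda>v. dSm (gm_point 0 s_id) (gm_point 0 v))) (at s_id)"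
    unfolding Smat_gm_point[abs_def]
    by (rule has_derivative_compose[OF bounded_linear_imp_has_derivative[OF bounded_linear_gm_point] has_derivative_Sm])
      (simp add: gm_point_def)
  then have "frechet_derivative Smat (at s_id) = (\<lambda>v. dSm (gm_point 0 s_id) (gm_point 0 v))"
    by (rule frechet_derivative_at[symmetric])
  then have "lie_gen k = dSm (gm_point 0 s_id) (gm_point 0 (axis k 1))" for k
    using matrix_inv_eqI[of "mat 1 :: complex^4^4" "mat 1"] by (simp add: lie_gen_def 1)
  then show "lie_gen 1 = hmat 1 0 0 0 0 0" "lie_gen 2 = hmat 0 1 0 0 0 0"
    "lie_gen 3 = hmat 0 0 0 0 0 1" "lie_gen 4 = hmat 0 0 0 (- 1) 0 0"
    by (simp_all add: dSm_def hmat_def gm_point_def axis_4_nth)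
qed

lemma Lie_G_eq: "Lie_G = {hmat a b 0 d 0 f | a b d f. True}"
proof -
  have *: "(\<Sum>k\<in>UNIV. mscale (c k) (lie_gen k)) = hmat (c 1) (c 2) 0 (- c 4) 0 (c 3)" for c
    by (simp add: sum_4 lie_gen hmat_mscale hmat_add)
  show ?thesis
  proof (intro equalityI subsetI)
    fix m assume "m \<in> {hmat a b 0 d 0 f | a b d f. True}"
    then obtain a b d f where m: "m = hmat a b 0 d 0 f" by blast
    define c where "c k = (if k = 1 then a else if k = 2 then b else if k = 3 then f else - d)" for k :: 4
    have "m = (\<Sum>k\<in>UNIV. mscale (c k) (lie_gen k))"
      unfolding * m by (simp add: c_def)
    then show "m \<in> Lie_G" unfolding Lie_G_def by blast
  next
    fix m assume "m \<in> Lie_G"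
    then obtain c where "m = (\<Sum>k\<in>UNIV. mscale (c k) (lie_gen k))" unfolding Lie_G_def by blast
    then show "m \<in> {hmat a b 0 d 0 f | a b d f. True}" unfolding * by blast
  qed
qed

text \<open>Common form of \<open>module_span\<close> and \<open>const_span\<close>, with
  coefficients in a set \<open>C\<close> of functions, so that closure properties are proved once
  for both.\<close>

definition lincomb ::
  "(complex^'n::finite \<Rightarrow> complex) set \<Rightarrow> (complex^'n \<Rightarrow> complex^'n) set \<Rightarrow> (complex^'n \<Rightarrow> complex^'n) set" where
  "lincomb C B = {(\<lambda>x. \<Sum>b\<in>F. f b x *s b x) | F f. finite F \<and> F \<subseteq> B \<and> (\<forall>b\<in>F. f b \<in> C)}"

lemma module_span_lincomb: "module_span S B = lincomb (regular_functions S) B"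
  by (simp add: module_span_def lincomb_def)

lemma const_span_lincomb: "const_span B = lincomb (range (\<lambda>c _. c)) B"
proof (intro equalityI subsetI)
  fix X assume "X \<in> const_span B"
  then obtain F c where "X = (\<lambda>x. \<Sum>b\<in>F. c b *s b x)" "finite F" "F \<subseteq> B"
    unfolding const_span_def by blast
  then show "X \<in> lincomb (range (\<lambda>c _. c)) B"
    unfolding lincomb_def by (auto intro!: exI[where x = F] exI[where x = "\<lambda>b _. c b"])
next
  fix X assume "X \<in> lincomb (range (\<lambda>c _. c)) B"
  then obtain F f where X: "X = (\<lambda>x. \<Sum>b\<in>F. f b x *s b x)" "finite F" "F \<subseteq> B" "\<forall>b\<in>F. f b \<in> range (\<lambda>c _. c)"
    unfolding lincomb_def by blast
  have "\<forall>b\<in>F. \<exists>c. f b = (\<lambda>_. c)" using X(4) by blast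
  from bchoice[OF this] obtain c where c: "\<And>b. b \<in> F \<Longrightarrow> f b = (\<lambda>_. c b)" by blast
  have "X = (\<lambda>x. \<Sum>b\<in>F. c b *s b x)"
    unfolding X(1) by (intro ext sum.cong) (simp_all add: c)
  then show "X \<in> const_span B"
    unfolding const_span_def using X(2,3) by blast
qed

lemma lincomb_mono: "B \<subseteq> B' \<Longrightarrow> lincomb C B \<subseteq> lincomb C B'"
  unfolding lincomb_def by blast

lemma lincomb_base:
  assumes "b \<in> B" "g \<in> C"
  shows "(\<lambda>x. g x *s b x) \<in> lincomb C B"
  unfolding lincomb_def using assms by (auto intro!: exI[where x = "{b}"] exI[where x = "\<lambda>_. g"])

lemma lincomb_add:
  assumes C: "0 \<in> C" "\<And>f g. f \<in> C \<Longrightarrow> g \<in> C \<Longrightarrow> f + g \<in> C"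
    and "X \<in> lincomb C B" "Y \<in> lincomb C B"
  shows "X + Y \<in> lincomb C B"
proof -
  obtain F f where X: "X = (\<lambda>x. \<Sum>b\<in>F. f b x *s b x)" "finite F" "F \<subseteq> B" "\<forall>b\<in>F. f b \<in> C"
    using assms(3) unfolding lincomb_def by blast
  obtain G g where Y: "Y = (\<lambda>x. \<Sum>b\<in>G. g b x *s b x)" "finite G" "G \<subseteq> B" "\<forall>b\<in>G. g b \<in> C"
    using assms(4) unfolding lincomb_def by blast
  define f' where "f' b = (if b \<in> F then f b else 0)" for b
  define g' where "g' b = (if b \<in> G then g b else 0)" for b
  have fX: "X x = (\<Sum>b\<in>F \<union> G. f' b x *s b x)" for x
    unfolding X(1) by (rule sum.mono_neutral_cong_left) (use X(2) Y(2) in \<open>auto simp: f'_def\<close>)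
  have gY: "Y x = (\<Sum>b\<in>F \<union> G. g' b x *s b x)" for x
    unfolding Y(1) by (rule sum.mono_neutral_cong_left) (use X(2) Y(2) in \<open>auto simp: g'_def\<close>)
  have "X + Y = (\<lambda>x. \<Sum>b\<in>F \<union> G. (f' b + g' b) x *s b x)"
    by (simp add: fun_eq_iff fX gY sum.distrib[symmetric] vector_sadd_rdistrib)
  moreover have "f' b + g' b \<in> C" for b
    using C X(4) Y(4) by (auto simp: f'_def g'_def)
  ultimately show ?thesis
    unfolding lincomb_def using X(2,3) Y(2,3)
    by (auto intro!: exI[where x = "F \<union> G"] exI[where x = "\<lambda>b. f' b + g' b"])
qed

lemma lincomb_minimal:
  assumes "B \<subseteq> W" "0 \<in> W" "\<And>X Y. X \<in> W \<Longrightarrow> Y \<in> W \<Longrightarrow> X + Y \<in> W"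
    and "\<And>f X. f \<in> C \<Longrightarrow> X \<in> W \<Longrightarrow> (\<lambda>x. f x *s X x) \<in> W"
  shows "lincomb C B \<subseteq> W"
proof
  fix X assume "X \<in> lincomb C B"
  then obtain F f where X: "X = (\<lambda>x. \<Sum>b\<in>F. f b x *s b x)" "finite F" "F \<subseteq> B" "\<forall>b\<in>F. f b \<in> C"
    unfolding lincomb_def by blast
  have "(\<lambda>x. \<Sum>b\<in>F. f b x *s b x) \<in> W"
    using X(2-4)
  proof (induction F rule: finite_induct)
    case empty
    then show ?case using assms(2) by (simp add: zero_fun_def)
  next
    case (insert b F)
    have "(\<lambda>x. \<Sum>b\<in>insert b F. f b x *s b x) = (\<lambda>x. f b x *s b x) + (\<lambda>x. \<Sum>b\<in>F. f b x *s b x)"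
      using insert.hyps by (simp add: fun_eq_iff)
    also have "\<dots> \<in> W"
      using insert.IH insert.prems assms(1) by (intro assms(3,4)) auto
    finally show ?case .
  qed
  then show "X \<in> W" by (simp add: X(1))
qed

lemma regular_functions_closed:
  assumes "f \<in> regular_functions S" "g \<in> regular_functions S"
  shows "f + g \<in> regular_functions S" "0 \<in> regular_functions S"
  using assms holo_on_add[of f S g] holo_on_const[of 0 S]
  by (simp_all add: regular_functions_def plus_fun_def zero_fun_def)

lemma vector_fields_closed:
  assumes X: "X \<in> vector_fields S"
  shows "Y \<in> vector_fields S \<Longrightarrow> X + Y \<in> vector_fields S"
    "f \<in> regular_functions S \<Longrightarrow> (\<lambda>x. f x *s X x) \<in> vector_fields S"
proof -
  note X' = vector_fieldsD[OF X]
  show "X + Y \<in> vector_fields S" if Y: "Y \<in> vector_fields S"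
    by (rule vector_fieldsI) (simp_all add: holo_on_add X' vector_fieldsD[OF Y])
  show "(\<lambda>x. f x *s X x) \<in> vector_fields S" if f: "f \<in> regular_functions S"
    by (rule vector_fieldsI) (simp_all add: holo_on_mult X' regular_functionsD[OF f])
qed

lemma module_span_subset_vector_fields:
  assumes "B \<subseteq> vector_fields S"
  shows "module_span S B \<subseteq> vector_fields S"
proof -
  have "0 \<in> vector_fields S" by (rule vector_fieldsI) auto
  then show ?thesis
    unfolding module_span_lincomb using assms by (intro lincomb_minimal) (auto intro: vector_fields_closed)
qed

lemma const_span_add: "X \<in> const_span B \<Longrightarrow> Y \<in> const_span B \<Longrightarrow> X + Y \<in> const_span B"
  unfolding const_span_lincomb by (rule lincomb_add) (auto simp: zero_fun_def plus_fun_def)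

lemma const_span_base: "b \<in> B \<Longrightarrow> (\<lambda>x. c *s b x) \<in> const_span B"
  unfolding const_span_lincomb by (rule lincomb_base) auto

lemma const_span_minimal:
  assumes "B \<subseteq> W" "0 \<in> W" "\<And>X Y. X \<in> W \<Longrightarrow> Y \<in> W \<Longrightarrow> X + Y \<in> W"
    and "\<And>c X. X \<in> W \<Longrightarrow> (\<lambda>x. c *s X x) \<in> W"
  shows "const_span B \<subseteq> W"
  unfolding const_span_lincomb by (rule lincomb_minimal) (use assms in auto)

section \<open>Modular vector fields\<close>

context gm_moduli
begin

text \<open>Here the first row is prescribed as well: it must be 0. With entries (2,4) and (3,4)
  equal to 0 the field has no base component, so only dS times the inverse of S remains, and its
  first row is 0.\<close>

lemma is_R_g_iff: "is_R_g T A (hmat a b 0 d 0 f) R \<longleftrightarrow> R = gm_field (hmat a b 0 d 0 f)"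
proof
  assume "is_R_g T A (hmat a b 0 d 0 f) R"
  then show "R = gm_field (hmat a b 0 d 0 f)"
    by (intro eq_gm_fieldI) (auto simp: is_R_g_def)
next
  define m where "m = hmat a b 0 d 0 f"
  have "gm_matrix A p (gm_field m p) = m" if p: "p \<in> T" for p
  proof -
    have "gm_matrix A p (gm_field m p) $ i = m $ i" for i
    proof (cases "i = 1")
      case True
      have "gm_alpha_beta m p = 0"
        by (simp add: gm_alpha_beta_def m_def hmat_def vec_eq_iff forall_2)
      then have "zpart (gm_field m p) = 0"
        using p by (simp add: gm_field_def gm_field_at_def Let_def vec_eq_iff forall_2)
      moreover have "gm_form (zpart p) 0 = 0"
        by (simp add: gm_form_def vec_eq_iff)
      ultimately have "gm_form (zpart p) (zpart (gm_field m p)) = 0"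
        by metis
      then have "gm_matrix A p (gm_field m p) = dSm p (gm_field m p) ** Sm_inv p"
        using gm_matrix_explicit[OF p]
        by (simp add: bounded_bilinear.zero_right[OF bounded_bilinear_matrix_mult])
      then show ?thesis
        by (simp add: True vec_eq_4_iff matrix_mult_4_nth dSm_def m_def hmat_def)
    next
      case False
      then show ?thesis using p by (intro gm_matrix_gm_field) (simp_all add: m_def)
    qed
    then show ?thesis by (simp add: vec_eq_iff)
  qed
  then show "is_R_g T A (hmat a b 0 d 0 f) R" if "R = gm_field (hmat a b 0 d 0 f)"
    unfolding that is_R_g_def m_def by (simp add: gm_field_vector_fields)
qed

lemma R_g_eq: "R_g T A (hmat a b 0 d 0 f) = gm_field (hmat a b 0 d 0 f)"
  unfolding R_g_def is_R_g_iff by simp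

lemma is_modular_1:
  assumes "is_modular modular_matrix_1 T A R" shows "R = gm_field (hmat 0 0 0 0 1 0)"
proof (rule eq_gm_fieldI)
  show "gm_matrix A p (R p) $ i = hmat 0 0 0 0 1 0 $ i" if "p \<in> T" "i \<noteq> 1" for p i
  proof -
    obtain a b where "gm_matrix A p (R p) = modular_matrix_1 a b"
      using assms \<open>p \<in> T\<close> unfolding is_modular_def by blast
    then show ?thesis
      using exhaust_4[of i] \<open>i \<noteq> 1\<close> by (auto simp: modular_matrix_1_def hmat_def vec_eq_4_iff)
  qed
qed (use assms in \<open>simp add: is_modular_def\<close>)

lemma is_modular_2:
  assumes "is_modular modular_matrix_2 T A R" shows "R = gm_field (hmat 0 0 1 0 0 0)"
proof (rule eq_gm_fieldI)
  show "gm_matrix A p (R p) $ i = hmat 0 0 1 0 0 0 $ i" if "p \<in> T" "i \<noteq> 1" for p i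
  proof -
    obtain a b where "gm_matrix A p (R p) = modular_matrix_2 a b"
      using assms \<open>p \<in> T\<close> unfolding is_modular_def by blast
    then show ?thesis
      using exhaust_4[of i] \<open>i \<noteq> 1\<close> by (auto simp: modular_matrix_2_def hmat_def vec_eq_4_iff)
  qed
qed (use assms in \<open>simp add: is_modular_def\<close>)

lemma gm_matrix_row_1:
  assumes p: "p \<in> T"
  shows "gm_matrix A p v $ 1 = vector [0, - (v $ 2 / p $ 2) / (2 * p $ 3),
    v $ 2 / p $ 2 / 2 * (p $ 4 * p $ 6 / p $ 3) + (v $ 1 / p $ 1 + v $ 2 / p $ 2 / 2) * p $ 6, 0]"
  unfolding gm_matrix_explicit[OF p]
  by (simp add: vec_eq_4_iff matrix_mult_4_nth dSm_def Sm_def Sm_inv_def gm_form_def gm1_def gm2_def)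

lemma gm_field_zpart:
  assumes p: "p \<in> T"
  shows "gm_field m p $ 1 / p $ 1 = gm_alpha_beta m p $ 1" "gm_field m p $ 2 / p $ 2 = gm_alpha_beta m p $ 2"
  using moduli_baseD(1,2)[OF T_memD(2)[OF p]] p by (simp_all add: gm_field_def gm_field_at_def Let_def)

text \<open>Regularity of the functions Y is automatic. The one obstruction to a modular field is a
  zero of entry (1,2) or (1,3), as these have to be inverses.\<close>

lemma is_modularI:
  fixes M :: "complex \<Rightarrow> complex \<Rightarrow> complex^4^4"
  assumes m: "m \<in> hh" and M: "\<And>a b. M a b $ 1 = vector [0, a, b, 0]" "\<And>a b i. i \<noteq> 1 \<Longrightarrow> M a b $ i = m $ i"
    and nz: "\<And>p. p \<in> T \<Longrightarrow> gm_matrix A p (gm_field m p) $ 1 $ 2 \<noteq> 0"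
      "\<And>p. p \<in> T \<Longrightarrow> gm_matrix A p (gm_field m p) $ 1 $ 3 \<noteq> 0"
  shows "is_modular M T A (gm_field m)"
proof -
  define Y where "Y j p = (if p \<in> T then inverse (gm_matrix A p (gm_field m p) $ 1 $ j) else 0)" for j p
  have Y: "Y j \<in> regular_functions T" if "\<And>p. p \<in> T \<Longrightarrow> gm_matrix A p (gm_field m p) $ 1 $ j \<noteq> 0" for j
  proof -
    have "holo_on (\<lambda>p. inverse (gm_matrix A p (gm_field m p) $ 1 $ j)) T"
      by (rule holo_on_inverse[OF holo_on_gm_matrix[OF gm_field_vector_fields] that])
    then have "holo_on (Y j) T"
      by (rule holo_on_cong_open[OF _ open_T]) (simp add: Y_def)
    then show ?thesis by (simp add: regular_functions_def Y_def)
  qed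
  have "Y 2 p \<noteq> 0 \<and> Y 3 p \<noteq> 0 \<and> gm_matrix A p (gm_field m p) = M (inverse (Y 2 p)) (inverse (Y 3 p))"
    if p: "p \<in> T" for p
  proof -
    have "gm_matrix A p (gm_field m p) $ i = M (inverse (Y 2 p)) (inverse (Y 3 p)) $ i" for i
    proof (cases "i = 1")
      case True
      have "gm_matrix A p (gm_field m p) $ 1 $ 1 = 0" "gm_matrix A p (gm_field m p) $ 1 $ 4 = 0"
        by (simp_all add: gm_matrix_row_1[OF p])
      then show ?thesis
        unfolding True M(1) vec_eq_4_iff vector_4_nth using p by (simp add: Y_def)
    next
      case False
      then show ?thesis using gm_matrix_gm_field[OF p m False] by (simp add: M)
    qed
    then have "gm_matrix A p (gm_field m p) = M (inverse (Y 2 p)) (inverse (Y 3 p))"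
      unfolding vec_eq_iff[of "gm_matrix A p (gm_field m p)"] by blast
    moreover have "Y 2 p \<noteq> 0" "Y 3 p \<noteq> 0" using nz[OF p] p by (simp_all add: Y_def)
    ultimately show ?thesis by blast
  qed
  then show ?thesis
    unfolding is_modular_def using Y[OF nz(1)] Y[OF nz(2)] gm_field_vector_fields by blast
qed

text \<open>With s22 and s23 in coordinates 3 and 4, the assumed expressions are, up to nowhere
  vanishing factors, entries (1,2) and (1,3) of the first candidate. For the second candidate (1,2)
  vanishes nowhere and (1,3) is the first expression again.\<close>

lemma modular_exist:
  assumes nz: "\<And>p. p \<in> T \<Longrightarrow> p $ 4 + 4 * p $ 1 * p $ 3 \<noteq> 0"
    "\<And>p. p \<in> T \<Longrightarrow> discr (zpart p) * (p $ 3)^2 - (1 - 4 * p $ 2) * (p $ 4 + 4 * p $ 1 * p $ 3)^2 \<noteq> 0"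
  shows "\<exists>R. is_modular modular_matrix_1 T A R" "\<exists>R. is_modular modular_matrix_2 T A R"
proof -
  have b: "p $ 3 \<noteq> 0" "p $ 6 \<noteq> 0" "p $ 4 + 4 * p $ 1 * p $ 3 \<noteq> 0" "1 - 4 * p $ 2 \<noteq> 0" "p $ 1 \<noteq> 0" if "p \<in> T" for p
    using T_memD[OF that] nz(1)[OF that] moduli_baseD[of "zpart p"] by auto
  let ?m = "hmat 0 0 0 0 1 0"
  have "is_modular modular_matrix_1 T A (gm_field ?m)"
  proof (rule is_modularI)
    show "modular_matrix_1 a b $ 1 = vector [0, a, b, 0]" for a b by (simp add: modular_matrix_1_def)
    show "modular_matrix_1 a b $ i = ?m $ i" if "i \<noteq> 1" for a b i
      using exhaust_4[of i] that by (auto simp: modular_matrix_1_def hmat_def vec_eq_4_iff)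
    fix p assume p: "p \<in> T"
    have c: "gm_alpha_beta ?m p $ 2 = - 2 * (1 - 4 * p $ 2) * (p $ 6)^2 * (p $ 4 + 4 * p $ 1 * p $ 3) / p $ 3"
      using b(1)[OF p] by (simp add: gm_alpha_beta_def Let_def hmat_def field_simps)
    have c1: "gm_alpha_beta ?m p $ 1 = discr (zpart p) * (p $ 6)^2 - (1 - 4 * p $ 1) / 2 * gm_alpha_beta ?m p $ 2"
      by (simp add: gm_alpha_beta_def Let_def hmat_def)
    show "gm_matrix A p (gm_field ?m p) $ 1 $ 2 \<noteq> 0"
      using b[OF p] unfolding gm_matrix_row_1[OF p] gm_field_zpart[OF p] by (simp add: c)
    have "gm_matrix A p (gm_field ?m p) $ 1 $ 3
      = (p $ 6)^3 / (p $ 3)^2 * (discr (zpart p) * (p $ 3)^2 - (1 - 4 * p $ 2) * (p $ 4 + 4 * p $ 1 * p $ 3)^2)"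
      unfolding gm_matrix_row_1[OF p] gm_field_zpart[OF p] vector_4_nth c1 c
      using b(1)[OF p] by (simp add: divide_simps power2_eq_square power3_eq_cube; simp add: algebra_simps)
    then show "gm_matrix A p (gm_field ?m p) $ 1 $ 3 \<noteq> 0"
      using b[OF p] nz(2)[OF p] by simp
  qed simp
  then show "\<exists>R. is_modular modular_matrix_1 T A R" by blast
  let ?n = "hmat 0 0 1 0 0 0"
  have "is_modular modular_matrix_2 T A (gm_field ?n)"
  proof (rule is_modularI)
    show "modular_matrix_2 a b $ 1 = vector [0, a, b, 0]" for a b by (simp add: modular_matrix_2_def)
    show "modular_matrix_2 a b $ i = ?n $ i" if "i \<noteq> 1" for a b i
      using exhaust_4[of i] that by (auto simp: modular_matrix_2_def hmat_def vec_eq_4_iff)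
    fix p assume p: "p \<in> T"
    have c: "gm_alpha_beta ?n p $ 2 = 2 * (1 - 4 * p $ 2) * p $ 6 / p $ 3"
      by (simp add: gm_alpha_beta_def Let_def hmat_def)
    have c1: "gm_alpha_beta ?n p $ 1 = - ((1 - 4 * p $ 1) / 2 * gm_alpha_beta ?n p $ 2)"
      by (simp add: gm_alpha_beta_def Let_def hmat_def)
    show "gm_matrix A p (gm_field ?n p) $ 1 $ 2 \<noteq> 0"
      using b[OF p] unfolding gm_matrix_row_1[OF p] gm_field_zpart[OF p] by (simp add: c)
    have "gm_matrix A p (gm_field ?n p) $ 1 $ 3
      = (p $ 6)^2 / (p $ 3)^2 * ((1 - 4 * p $ 2) * (p $ 4 + 4 * p $ 1 * p $ 3))"
      unfolding gm_matrix_row_1[OF p] gm_field_zpart[OF p] vector_4_nth c1 c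
      using b(1)[OF p] by (simp add: divide_simps power2_eq_square power3_eq_cube; simp add: algebra_simps)
    then show "gm_matrix A p (gm_field ?n p) $ 1 $ 3 \<noteq> 0"
      using b[OF p] by simp
  qed simp
  then show "\<exists>R. is_modular modular_matrix_2 T A R" by blast
qed

text \<open>Conjugation by S keeps the zero pattern and the trace of the lower 2 by 2 block, and in
  the trace of the dS part -ds44/s44 and ds44/s44 cancel.\<close>

lemma gm_matrix_hh_rows:
  fixes v :: "complex^6"
  assumes p: "p \<in> T" and i: "i \<noteq> 1"
  defines "M \<equiv> gm_matrix A p v"
  shows "M $ i = hmat (M $ 2 $ 2) (M $ 2 $ 3) (M $ 2 $ 4) (M $ 3 $ 3) (M $ 3 $ 4) (M $ 4 $ 3) $ i"
proof -
  have "M $ 2 $ 1 = 0" "M $ 3 $ 1 = 0" "M $ 4 $ 1 = 0" "M $ 3 $ 2 = 0" "M $ 4 $ 2 = 0"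
    unfolding M_def gm_matrix_explicit[OF p]
    by (simp_all add: matrix_mult_4_nth dSm_def Sm_def Sm_inv_def gm_form_entries[OF T_memD(2)[OF p]])
  moreover have "M $ 4 $ 4 = - M $ 3 $ 3"
    unfolding M_def gm_matrix_explicit[OF p] using T_memD(4)[OF p]
    by (simp add: matrix_mult_4_nth dSm_def Sm_def Sm_inv_def gm_form_entries(1-4)[OF T_memD(2)[OF p]]
        divide_simps power2_eq_square; simp add: algebra_simps)
  ultimately show ?thesis
    using exhaust_4[of i] i by (auto simp: hmat_def vec_eq_4_iff)
qed

lemma gm_field_at_hmat:
  "gm_field_at (hmat a b c d e f) p = a *s gm_field_at (hmat 1 0 0 0 0 0) p + b *s gm_field_at (hmat 0 1 0 0 0 0) p
    + c *s gm_field_at (hmat 0 0 1 0 0 0) p + (- d) *s gm_field_at (hmat 0 0 0 (- 1) 0 0) p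
    + e *s gm_field_at (hmat 0 0 0 0 1 0) p + f *s gm_field_at (hmat 0 0 0 0 0 1) p"
  unfolding gm_field_at_linear[symmetric] by (simp add: hmat_mscale hmat_add)

end

text \<open>The labels of \<open>R_1\<close>, \<open>R_2\<close>, \<open>R_g22\<close>,
  \<open>R_g23\<close>, \<open>R_g43\<close>, \<open>R_g44\<close>, in this order.\<close>

definition gm_basis :: "(complex^4^4) set" where
  "gm_basis = {hmat 0 0 0 0 1 0, hmat 0 0 1 0 0 0, hmat 1 0 0 0 0 0, hmat 0 1 0 0 0 0, hmat 0 0 0 0 0 1, hmat 0 0 0 (- 1) 0 0}"

lemma gm_basis_hh: "gm_basis \<subseteq> hh" by (simp add: gm_basis_def)

lemma card_gm_basis: "card gm_basis = 6" "finite gm_basis"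
  by (simp_all add: gm_basis_def hmat_eq_iff)

section \<open>The vector fields as a free module of rank six\<close>

context gm_moduli
begin

lemma card_gm_field_basis: "card (gm_field ` gm_basis) = 6"
  using card_image[OF inj_on_subset[OF gm_field_inj gm_basis_hh]] card_gm_basis by simp

text \<open>By linearity a relation at a point x is \<open>gm_field_at\<close> of a single element
  of \<open>hh\<close>, and this map is injective at each point of \<open>T\<close>.\<close>

lemma module_independent_basis: "module_independent T (gm_field ` gm_basis)"
  unfolding module_independent_def
proof (intro allI impI ballI)
  fix f b x assume f: "(\<forall>b\<in>gm_field ` gm_basis. f b \<in> regular_functions T)
      \<and> (\<forall>x\<in>T. (\<Sum>b\<in>gm_field ` gm_basis. f b x *s b x) = 0)"
    and b: "b \<in> gm_field ` gm_basis" and x: "x \<in> T"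
  define c where "c m = f (gm_field m) x" for m
  have "0 = (\<Sum>b\<in>gm_field ` gm_basis. f b x *s b x)" using f x by simp
  also have "\<dots> = (\<Sum>m\<in>gm_basis. c m *s gm_field_at m x)"
    using x by (subst sum.reindex[OF inj_on_subset[OF gm_field_inj gm_basis_hh]]) (simp add: c_def gm_field_def)
  also have "\<dots> = gm_field_at (hmat (c (hmat 1 0 0 0 0 0)) (c (hmat 0 1 0 0 0 0)) (c (hmat 0 0 1 0 0 0))
      (- c (hmat 0 0 0 (- 1) 0 0)) (c (hmat 0 0 0 0 1 0)) (c (hmat 0 0 0 0 0 1))) x"
    unfolding gm_field_at_hmat[of "c _"] by (simp add: gm_basis_def hmat_eq_iff algebra_simps)
  finally have "gm_field_at (hmat (c (hmat 1 0 0 0 0 0)) (c (hmat 0 1 0 0 0 0)) (c (hmat 0 0 1 0 0 0))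
      (- c (hmat 0 0 0 (- 1) 0 0)) (c (hmat 0 0 0 0 1 0)) (c (hmat 0 0 0 0 0 1))) x = gm_field_at (hmat 0 0 0 0 0 0) x"
    by (simp add: gm_field_at_hmat[of 0 0 0 0 0 0])
  from gm_field_at_inj[OF x _ _ this]
  have "\<forall>m\<in>gm_basis. c m = 0" by (simp add: hmat_eq_iff gm_basis_def)
  then show "f b x = 0" using b by (auto simp: c_def)
qed

lemma vector_fields_module_span: "module_span T (gm_field ` gm_basis) = vector_fields T"
proof
  show "module_span T (gm_field ` gm_basis) \<subseteq> vector_fields T"
    by (rule module_span_subset_vector_fields) (auto intro: gm_field_vector_fields)
  show "vector_fields T \<subseteq> module_span T (gm_field ` gm_basis)"
  proof
    fix W assume W: "W \<in> vector_fields T"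
    define c where "c i j p = (if p \<in> T then gm_matrix A p (W p) $ i $ j else 0)" for i j p
    have c: "c i j \<in> regular_functions T" for i j
    proof -
      have "holo_on (c i j) T"
        by (rule holo_on_cong_open[OF holo_on_gm_matrix[OF W] open_T]) (simp add: c_def)
      then show ?thesis by (simp add: regular_functions_def c_def)
    qed
    have c': "(\<lambda>p. - c i j p) \<in> regular_functions T" for i j
      using c[of i j] by (auto simp: regular_functions_def)
    define g where "g h m = (\<lambda>p. h p *s gm_field m p)" for h m
    have g: "g h m \<in> module_span T (gm_field ` gm_basis)" if "h \<in> regular_functions T" "m \<in> gm_basis" for h m
      unfolding module_span_lincomb g_def by (rule lincomb_base) (use that in auto)
    \<comment> \<open>The coefficients of W are six entries of its own connection matrix; that of
      \<open>R_g44\<close> carries a minus sign because its label has -1 at (3,3).\<close>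
    have "W = g (c 2 2) (hmat 1 0 0 0 0 0) + g (c 2 3) (hmat 0 1 0 0 0 0) + g (c 2 4) (hmat 0 0 1 0 0 0)
        + g (\<lambda>p. - c 3 3 p) (hmat 0 0 0 (- 1) 0 0) + g (c 3 4) (hmat 0 0 0 0 1 0) + g (c 4 3) (hmat 0 0 0 0 0 1)"
    proof
      fix p
      show "W p = (g (c 2 2) (hmat 1 0 0 0 0 0) + g (c 2 3) (hmat 0 1 0 0 0 0) + g (c 2 4) (hmat 0 0 1 0 0 0)
        + g (\<lambda>p. - c 3 3 p) (hmat 0 0 0 (- 1) 0 0) + g (c 3 4) (hmat 0 0 0 0 1 0) + g (c 4 3) (hmat 0 0 0 0 0 1)) p"
      proof (cases "p \<in> T")
        case p: True
        have cM: "c i j p = gm_matrix A p (W p) $ i $ j" for i j using p by (simp add: c_def)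
        have "W p = gm_field_at (gm_matrix A p (W p)) p" by (simp add: gm_field_at_gm_matrix[OF p])
        also have "\<dots> = gm_field_at (hmat (c 2 2 p) (c 2 3 p) (c 2 4 p) (c 3 3 p) (c 3 4 p) (c 4 3 p)) p"
          unfolding cM by (rule gm_field_at_cong, rule gm_matrix_hh_rows[OF p])
        finally show ?thesis
          using p unfolding gm_field_at_hmat[of "c _ _ _"] by (simp add: g_def gm_field_def)
      next
        case False
        then show ?thesis using vector_fieldsD(2)[OF W] by (simp add: g_def gm_field_def)
      qed
    qed
    also have "\<dots> \<in> module_span T (gm_field ` gm_basis)"
    proof -
      have add: "X + Y \<in> module_span T (gm_field ` gm_basis)"
        if "X \<in> module_span T (gm_field ` gm_basis)" "Y \<in> module_span T (gm_field ` gm_basis)" for X Y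
        using that unfolding module_span_lincomb
        by (intro lincomb_add) (auto intro: regular_functions_closed c)
      show ?thesis by (intro add g c c') (simp_all add: gm_basis_def)
    qed
    finally show "W \<in> module_span T (gm_field ` gm_basis)" .
  qed
qed

end

section \<open>The Gauss--Manin Lie algebra\<close>

lemma hmat_0: "hmat 0 0 0 0 0 0 = 0"
  by (simp add: hmat_def vec_eq_4_iff)

lemma mscale_simps: "mscale 1 m = m" "mscale (c + d) m = mscale c m + mscale d m"
    "mscale (c * d) m = mscale c (mscale d m)" "mscale c (m + n) = mscale c m + mscale c n"
    "mscale c (m - n) = mscale c m - mscale c n"
  for m n :: "complex^'n::finite^'m::finite"
  by (simp_all add: vec_eq_iff algebra_simps)

lemmas matrix_diff_rdistrib = bounded_bilinear.diff_left[OF bounded_bilinear_matrix_mult]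

lemma zero_hh: "0 \<in> hh"
  using hmat_hh[of 0 0 0 0 0 0] by (simp add: hmat_0)

context gm_moduli
begin

lemma gm_field_0: "gm_field 0 = 0"
proof -
  have "mscale 0 0 = (0 :: complex^4^4)" by (simp add: vec_eq_iff)
  then show ?thesis using gm_field_linear(2)[of 0 0] by (simp add: zero_fun_def)
qed

lemma gm_field_add: "gm_field m + gm_field n = gm_field (m + n)"
  and gm_field_scale: "(\<lambda>p. c *s gm_field m p) = gm_field (mscale c m)"
  by (simp_all add: gm_field_linear)

lemma const_span_gm_field_subset:
  assumes "K \<subseteq> J" "0 \<in> J" "\<And>m n. m \<in> J \<Longrightarrow> n \<in> J \<Longrightarrow> m + n \<in> J" "\<And>c m. m \<in> J \<Longrightarrow> mscale c m \<in> J"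
  shows "const_span (gm_field ` K) \<subseteq> gm_field ` J"
proof (rule const_span_minimal)
  show "gm_field ` K \<subseteq> gm_field ` J" using assms(1) by blast
  show "0 \<in> gm_field ` J" using assms(2) gm_field_0 by force
  show "X + Y \<in> gm_field ` J" if "X \<in> gm_field ` J" "Y \<in> gm_field ` J" for X Y
    using that assms(3) by (auto simp: gm_field_add)
  show "(\<lambda>x. c *s X x) \<in> gm_field ` J" if "X \<in> gm_field ` J" for c X
    using that assms(4) by (auto simp: gm_field_scale)
qed

lemma gm_field_hmat:
  "gm_field (hmat a b c d e f) = (\<lambda>p. a *s gm_field (hmat 1 0 0 0 0 0) p) + (\<lambda>p. b *s gm_field (hmat 0 1 0 0 0 0) p)
    + (\<lambda>p. c *s gm_field (hmat 0 0 1 0 0 0) p) + (\<lambda>p. (- d) *s gm_field (hmat 0 0 0 (- 1) 0 0) p)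
    + (\<lambda>p. e *s gm_field (hmat 0 0 0 0 1 0) p) + (\<lambda>p. f *s gm_field (hmat 0 0 0 0 0 1) p)"
  unfolding gm_field_scale gm_field_add by (simp add: hmat_mscale hmat_add)

text \<open>The set K is only sandwiched between \<open>gm_basis\<close> and \<open>hh\<close> so as
  to cover both the six basis labels and the full generating set with all of
  \<open>Lie_G\<close>.\<close>

lemma const_span_hh:
  assumes "gm_basis \<subseteq> K" "K \<subseteq> hh"
  shows "const_span (gm_field ` K) = gm_field ` hh"
proof
  show "const_span (gm_field ` K) \<subseteq> gm_field ` hh"
    using assms(2) zero_hh by (rule const_span_gm_field_subset) (rule hh_closed; assumption)+
  show "gm_field ` hh \<subseteq> const_span (gm_field ` K)"
  proof (rule image_subsetI)
    fix m assume "m \<in> hh"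
    have b: "(\<lambda>p. c *s gm_field h p) \<in> const_span (gm_field ` K)" if "h \<in> gm_basis" for c h
      using that assms(1) by (intro const_span_base) auto
    show "gm_field m \<in> const_span (gm_field ` K)"
      by (subst hh_hmat[OF \<open>m \<in> hh\<close>], subst gm_field_hmat)
        (intro const_span_add b; simp add: gm_basis_def)
  qed
qed

lemma const_span_ideal:
  "const_span (gm_field ` {hmat 0 0 1 0 0 0, hmat 1 0 0 0 0 0, hmat 0 1 0 0 0 0})
    = gm_field ` {hmat a b c 0 0 0 | a b c. True}" (is "const_span (gm_field ` ?K) = gm_field ` ?J")
proof
  show "const_span (gm_field ` ?K) \<subseteq> gm_field ` ?J"
  proof (rule const_span_gm_field_subset)
    show "0 \<in> ?J" unfolding hmat_0[symmetric] by blast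
    show "m + n \<in> ?J" if "m \<in> ?J" "n \<in> ?J" for m n
      using that by (clarsimp simp: hmat_add) auto
    show "mscale c m \<in> ?J" if "m \<in> ?J" for c m
      using that by (clarsimp simp: hmat_mscale) auto
  qed auto
  show "gm_field ` ?J \<subseteq> const_span (gm_field ` ?K)"
  proof (rule image_subsetI)
    fix m assume "m \<in> ?J"
    then obtain a b c where m: "m = hmat a b c 0 0 0" by blast
    have "gm_field m = (\<lambda>p. a *s gm_field (hmat 1 0 0 0 0 0) p) + (\<lambda>p. b *s gm_field (hmat 0 1 0 0 0 0) p)
        + (\<lambda>p. c *s gm_field (hmat 0 0 1 0 0 0) p)"
      unfolding m gm_field_scale gm_field_add by (simp add: hmat_mscale hmat_add)
    also have "\<dots> \<in> const_span (gm_field ` ?K)"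
      by (intro const_span_add const_span_base) auto
    finally show "gm_field m \<in> const_span (gm_field ` ?K)" .
  qed
qed

end

text \<open>\<open>R_1\<close> and \<open>R_2\<close> are definite descriptions and mean something
  only if modular fields exist, which fails when one of the first-row entries has a zero on
  \<open>T\<close>.\<close>

locale gm_modular = gm_moduli +
  assumes modular_1: "\<exists>R. is_modular modular_matrix_1 T A R"
    and modular_2: "\<exists>R. is_modular modular_matrix_2 T A R"
begin

lemma R_eq:
  "R_1 T A = gm_field (hmat 0 0 0 0 1 0)" "R_2 T A = gm_field (hmat 0 0 1 0 0 0)"
  "R_g22 T A = gm_field (hmat 1 0 0 0 0 0)" "R_g23 T A = gm_field (hmat 0 1 0 0 0 0)"
  "R_g43 T A = gm_field (hmat 0 0 0 0 0 1)" "R_g44 T A = gm_field (hmat 0 0 0 (- 1) 0 0)"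
proof -
  show "R_1 T A = gm_field (hmat 0 0 0 0 1 0)"
    unfolding R_1_def using modular_1 is_modular_1 by (metis the_equality)
  show "R_2 T A = gm_field (hmat 0 0 1 0 0 0)"
    unfolding R_2_def using modular_2 is_modular_2 by (metis the_equality)
qed (simp_all add: lie_gen R_g_eq)

lemma basis_eq: "{R_1 T A, R_2 T A, R_g22 T A, R_g23 T A, R_g43 T A, R_g44 T A} = gm_field ` gm_basis"
  unfolding R_eq by (simp add: gm_basis_def)

lemma generators_eq: "gm_generators T A = gm_field ` (Lie_G \<union> {hmat 0 0 0 0 1 0, hmat 0 0 1 0 0 0})"
proof -
  have "R_g T A ` Lie_G = gm_field ` Lie_G"
    by (rule image_cong) (auto simp: Lie_G_eq R_g_eq)
  then show ?thesis by (simp add: gm_generators_def R_eq image_Un)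
qed

lemma generators_span:
  "gm_basis \<subseteq> Lie_G \<union> {hmat 0 0 0 0 1 0, hmat 0 0 1 0 0 0}"
  "Lie_G \<union> {hmat 0 0 0 0 1 0, hmat 0 0 1 0 0 0} \<subseteq> hh"
  by (auto simp: gm_basis_def Lie_G_eq hmat_eq_iff)

lemma carrier_eq: "lcarrier (gm_lie_algebra T A) = gm_field ` hh"
proof -
  have "lcarrier (gm_lie_algebra T A) = const_span (gm_generators T A)" by (simp add: gm_lie_algebra_def)
  then show ?thesis unfolding generators_eq const_span_hh[OF generators_span] .
qed

lemma gm_module_eq: "gm_module T A = vector_fields T"
proof
  show "gm_module T A \<subseteq> vector_fields T"
    unfolding gm_module_def generators_eq
    by (rule module_span_subset_vector_fields) (auto intro: gm_field_vector_fields)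
  have "gm_field ` gm_basis \<subseteq> gm_generators T A"
    unfolding generators_eq using generators_span(1) by blast
  then show "vector_fields T \<subseteq> gm_module T A"
    unfolding gm_module_def vector_fields_module_span[symmetric] module_span_lincomb by (rule lincomb_mono)
qed

lemma lie_ops [simp]: "lscale (gm_lie_algebra T A) = (\<lambda>c X p. c *s X p)" "lbracket (gm_lie_algebra T A) = vf_bracket T"
  by (simp_all add: gm_lie_algebra_def)

text \<open>Each axiom is pulled back along \<open>gm_field\<close> to \<open>hh\<close>, where it
  is an identity for the opposite matrix commutator.\<close>

lemma complex_lie_algebra_gm: "complex_lie_algebra (gm_lie_algebra T A)"
proof -
  note s = gm_field_add gm_field_scale gm_field_bracket hh_closed
  note d = matrix_add_ldistrib matrix_add_rdistrib
  have c: "k ** (m + n) - (m + n) ** k = (k ** m - m ** k) + (k ** n - n ** k)"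
    "(m + n) ** k - k ** (m + n) = (m ** k - k ** m) + (n ** k - k ** n)"
    "n ** mscale a m - mscale a m ** n = mscale a (n ** m - m ** n)"
    "mscale a m ** n - n ** mscale a m = mscale a (m ** n - n ** m)" for a and k m n :: "complex^4^4"
    by (simp_all add: d mscale_mult mscale_simps)
  have jacobi: "(k ** n - n ** k) ** m - m ** (k ** n - n ** k) + ((m ** k - k ** m) ** n - n ** (m ** k - k ** m))
      + ((n ** m - m ** n) ** k - k ** (n ** m - m ** n)) = 0" for k m n :: "complex^4^4"
    by (simp add: matrix_diff_ldistrib matrix_diff_rdistrib matrix_mul_assoc)
  have "0 \<in> gm_field ` hh" using zero_hh gm_field_0 by force
  moreover have "\<forall>x\<in>gm_field ` hh. \<forall>y\<in>gm_field ` hh. x + y \<in> gm_field ` hh \<and> vf_bracket T x y \<in> gm_field ` hh"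
    by (auto simp only: s intro!: imageI elim!: imageE)
  moreover have "\<forall>a. \<forall>x\<in>gm_field ` hh. (\<lambda>p. a *s x p) \<in> gm_field ` hh"
    by (auto simp only: s intro!: imageI elim!: imageE)
  moreover have "\<forall>x\<in>gm_field ` hh. (\<lambda>p. 1 *s x p) = x \<and> vf_bracket T x x = 0"
    by (auto simp: gm_field_bracket gm_field_0)
  moreover have "\<forall>a b. \<forall>x\<in>gm_field ` hh. (\<lambda>p. (a + b) *s x p) = (\<lambda>p. a *s x p) + (\<lambda>p. b *s x p)
      \<and> (\<lambda>p. (a * b) *s x p) = (\<lambda>p. a *s (b *s x p))"
    by (simp add: fun_eq_iff vector_sadd_rdistrib vector_smult_assoc)
  moreover have "\<forall>a. \<forall>x\<in>gm_field ` hh. \<forall>y\<in>gm_field ` hh.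
      (\<lambda>p. a *s (x + y) p) = (\<lambda>p. a *s x p) + (\<lambda>p. a *s y p)
      \<and> vf_bracket T (\<lambda>p. a *s x p) y = (\<lambda>p. a *s vf_bracket T x y p)
      \<and> vf_bracket T x (\<lambda>p. a *s y p) = (\<lambda>p. a *s vf_bracket T x y p)"
    by (intro allI ballI; elim imageE; simp only: s c mscale_simps simp_thms)
  moreover have "\<forall>x\<in>gm_field ` hh. \<forall>y\<in>gm_field ` hh. \<forall>w\<in>gm_field ` hh.
      vf_bracket T (x + y) w = vf_bracket T x w + vf_bracket T y w
      \<and> vf_bracket T w (x + y) = vf_bracket T w x + vf_bracket T w y
      \<and> vf_bracket T x (vf_bracket T y w) + vf_bracket T y (vf_bracket T w x) + vf_bracket T w (vf_bracket T x y) = 0"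
    by (intro allI ballI; elim imageE; simp only: s c jacobi gm_field_0 simp_thms)
  ultimately show ?thesis
    unfolding complex_lie_algebra_def carrier_eq lie_ops by (intro conjI)
qed

text \<open>If one factor has d = e = f = 0, the last three coordinates in
  \<open>hmat_commutator\<close> vanish.\<close>

lemma lie_ideal_gm: "lie_ideal (gm_field ` {hmat a b c 0 0 0 | a b c. True}) (gm_lie_algebra T A)" (is "lie_ideal (gm_field ` ?J) _")
  unfolding lie_ideal_def carrier_eq lie_ops
proof (intro conjI ballI allI)
  show "gm_field ` ?J \<subseteq> gm_field ` hh" by auto
  show "0 \<in> gm_field ` ?J" unfolding gm_field_0[symmetric] hmat_0[symmetric] by blast
  show "x + y \<in> gm_field ` ?J" if "x \<in> gm_field ` ?J" "y \<in> gm_field ` ?J" for x y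
    using that by (clarsimp simp: gm_field_add hmat_add) blast
  show "(\<lambda>p. c *s x p) \<in> gm_field ` ?J" if "x \<in> gm_field ` ?J" for c x
    using that by (clarsimp simp: gm_field_scale hmat_mscale) blast
  show "vf_bracket T x y \<in> gm_field ` ?J" if x: "x \<in> gm_field ` hh" and y: "y \<in> gm_field ` ?J" for x y
  proof -
    obtain m where m: "x = gm_field m" "m \<in> hh" using x by blast
    obtain a b c d e f where "m = hmat a b c d e f" using hh_hmat[OF m(2)] by blast
    moreover obtain a' b' c' where "y = gm_field (hmat a' b' c' 0 0 0)" using y by blast
    ultimately show ?thesis
      using m(1) by (simp add: gm_field_bracket hmat_commutator) blast
  qed
qed

text \<open>The span of the three fields is already an ideal, so generating one adds nothing;
  conversely every ideal containing them is a complex subspace and contains their span.\<close>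

lemma ideal_eq:
  "ideal_generated (gm_lie_algebra T A) {R_2 T A, R_g22 T A, R_g23 T A} = gm_field ` {hmat a b c 0 0 0 | a b c. True}"
    (is "?I = gm_field ` ?J")
  "const_span {R_2 T A, R_g22 T A, R_g23 T A} = gm_field ` {hmat a b c 0 0 0 | a b c. True}"
proof -
  have K: "{R_2 T A, R_g22 T A, R_g23 T A} = gm_field ` {hmat 0 0 1 0 0 0, hmat 1 0 0 0 0 0, hmat 0 1 0 0 0 0}"
    unfolding R_eq by simp
  show 2: "const_span {R_2 T A, R_g22 T A, R_g23 T A} = gm_field ` ?J"
    unfolding K by (rule const_span_ideal)
  show "?I = gm_field ` ?J"
  proof
    have "{R_2 T A, R_g22 T A, R_g23 T A} \<subseteq> gm_field ` ?J" unfolding K by auto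
    then show "?I \<subseteq> gm_field ` ?J" unfolding ideal_generated_def using lie_ideal_gm by blast
    have "const_span {R_2 T A, R_g22 T A, R_g23 T A} \<subseteq> I"
      if "lie_ideal I (gm_lie_algebra T A)" "{R_2 T A, R_g22 T A, R_g23 T A} \<subseteq> I" for I
      using that by (intro const_span_minimal) (auto simp: lie_ideal_def)
    then show "gm_field ` ?J \<subseteq> ?I" unfolding 2 ideal_generated_def by blast
  qed
qed

end

text \<open>The plane of e1 and e2 is acted on by the negative of right multiplication of row
  vectors by M, and e3 is sent to 0. The sign compensates for right multiplication reversing
  products.\<close>

definition V_action :: "complex^2^2 \<Rightarrow> complex^3 \<Rightarrow> complex^3" where
  "V_action M x = vector [- (x $ 1 * M $ 1 $ 1 + x $ 2 * M $ 2 $ 1), - (x $ 1 * M $ 1 $ 2 + x $ 2 * M $ 2 $ 2), 0]"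

text \<open>Since \<open>[X\<^sub>m, X\<^sub>n] = X\<^bsub>nm - mn\<^esub>\<close> reverses the matrix commutator, \<open>sl2\<close> is embedded with a minus
  sign.\<close>

definition V_sl2_matrix :: "(complex^3) \<times> (complex^2^2) \<Rightarrow> complex^4^4" where
  "V_sl2_matrix = (\<lambda>(x, M). hmat (x $ 3) (x $ 1) (x $ 2) (- M $ 1 $ 1) (- M $ 1 $ 2) (- M $ 2 $ 1))"

section \<open>The semidirect product of \<open>L_V\<close> and \<open>sl2\<close>\<close>

lemma sl2_carrier: "M \<in> lcarrier sl2 \<longleftrightarrow> M $ 2 $ 2 = - M $ 1 $ 1"
  by (auto simp: sl2_def trace_def sum_2 add_eq_0_iff)

lemma matrix_mult_2_nth: "(M ** N) $ i $ j = M $ i $ 1 * N $ 1 $ j + M $ i $ 2 * N $ 2 $ j"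
  for M N :: "complex^2^2"
  by (simp add: matrix_matrix_mult_def sum_2)

lemma vec_eq_3_iff: "v = w \<longleftrightarrow> v $ 1 = w $ 1 \<and> v $ 2 = w $ 2 \<and> v $ 3 = w $ 3" for v w :: "'a^3"
  by (simp add: vec_eq_iff forall_3)

lemma mat_eq_2_iff: "M = N \<longleftrightarrow> M $ 1 $ 1 = N $ 1 $ 1 \<and> M $ 1 $ 2 = N $ 1 $ 2 \<and> M $ 2 $ 1 = N $ 2 $ 1 \<and> M $ 2 $ 2 = N $ 2 $ 2"
  for M N :: "'a^2^2"
  by (auto simp: vec_eq_iff forall_2)

lemma lie_action_V: "lie_action sl2 L_V V_action"
  unfolding lie_action_def
  by (intro conjI ballI allI; simp add: sl2_carrier)
    (simp_all add: L_V_def sl2_def V_action_def vec_eq_3_iff matrix_mult_2_nth algebra_simps)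

lemma V_sl2_bij: "bij_betw V_sl2_matrix (lcarrier L_V \<times> lcarrier sl2) hh"
  unfolding bij_betw_def
proof
  show "inj_on V_sl2_matrix (lcarrier L_V \<times> lcarrier sl2)"
    by (auto intro!: inj_onI simp: V_sl2_matrix_def hmat_eq_iff sl2_carrier vec_eq_3_iff mat_eq_2_iff)
  show "V_sl2_matrix ` (lcarrier L_V \<times> lcarrier sl2) = hh"
  proof (intro equalityI subsetI)
    fix m assume m: "m \<in> hh"
    define x :: "complex^3" where "x = vector [m $ 2 $ 3, m $ 2 $ 4, m $ 2 $ 2]"
    define M :: "complex^2^2" where "M = vector [vector [- m $ 3 $ 3, - m $ 3 $ 4], vector [- m $ 4 $ 3, m $ 3 $ 3]]"
    have "V_sl2_matrix (x, M) = hmat (m $ 2 $ 2) (m $ 2 $ 3) (m $ 2 $ 4) (m $ 3 $ 3) (m $ 3 $ 4) (m $ 4 $ 3)"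
      by (simp add: V_sl2_matrix_def x_def M_def)
    then have "V_sl2_matrix (x, M) = m" using hh_hmat[OF m] by simp
    moreover have "(x, M) \<in> lcarrier L_V \<times> lcarrier sl2"
      by (simp add: sl2_carrier L_V_def M_def)
    ultimately show "m \<in> V_sl2_matrix ` (lcarrier L_V \<times> lcarrier sl2)" by (metis imageI)
  qed (auto simp: V_sl2_matrix_def)
qed

context gm_modular
begin

text \<open>The basis e1, e2, e3 of type V corresponds to \<open>R_g23\<close>, \<open>R_2\<close>,
  \<open>R_g22\<close>, the last of which acts on the first two as a scalar.\<close>

lemma lie_iso_V_sl2:
  "lie_iso (semidirect L_V sl2 V_action) (gm_lie_algebra T A) (gm_field \<circ> V_sl2_matrix)"
  unfolding lie_iso_def
proof (intro conjI ballI allI)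
  let ?L = "semidirect L_V sl2 V_action"
  have c: "lcarrier ?L = lcarrier L_V \<times> lcarrier sl2" by (simp add: semidirect_def)
  show "bij_betw (gm_field \<circ> V_sl2_matrix) (lcarrier ?L) (lcarrier (gm_lie_algebra T A))"
    unfolding c carrier_eq by (rule bij_betw_trans[OF V_sl2_bij]) (simp add: bij_betw_def gm_field_inj)
  fix X assume X: "X \<in> lcarrier ?L"
  obtain x M where X': "X = (x, M)" "M $ 2 $ 2 = - M $ 1 $ 1"
    using X by (auto simp: c sl2_carrier)
  show "(gm_field \<circ> V_sl2_matrix) (lscale ?L k X) = lscale (gm_lie_algebra T A) k ((gm_field \<circ> V_sl2_matrix) X)" for k
    by (simp add: X' semidirect_def V_sl2_matrix_def gm_field_scale hmat_mscale) (simp add: L_V_def sl2_def)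
  fix Y assume Y: "Y \<in> lcarrier ?L"
  obtain y N where Y': "Y = (y, N)" "N $ 2 $ 2 = - N $ 1 $ 1"
    using Y by (auto simp: c sl2_carrier)
  show "(gm_field \<circ> V_sl2_matrix) (X + Y) = (gm_field \<circ> V_sl2_matrix) X + (gm_field \<circ> V_sl2_matrix) Y"
    by (simp add: X' Y' V_sl2_matrix_def gm_field_add hmat_add)
  have "V_sl2_matrix (lbracket ?L X Y) = V_sl2_matrix Y ** V_sl2_matrix X - V_sl2_matrix X ** V_sl2_matrix Y"
    by (simp add: X'(1) Y'(1) semidirect_def V_sl2_matrix_def hmat_commutator hmat_eq_iff)
      (simp add: L_V_def sl2_def V_action_def matrix_mult_2_nth X'(2) Y'(2) algebra_simps)
  moreover have "V_sl2_matrix Z \<in> hh" for Z by (cases Z) (simp add: V_sl2_matrix_def)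
  ultimately show "(gm_field \<circ> V_sl2_matrix) (lbracket ?L X Y)
      = lbracket (gm_lie_algebra T A) ((gm_field \<circ> V_sl2_matrix) X) ((gm_field \<circ> V_sl2_matrix) Y)"
    by (simp add: gm_field_bracket)
qed

lemma V_image_ideal:
  "(gm_field \<circ> V_sl2_matrix) ` (lcarrier L_V \<times> {0}) = gm_field ` {hmat a b c 0 0 0 | a b c. True}"
proof -
  have "V_sl2_matrix ` (lcarrier L_V \<times> {0}) = {hmat a b c 0 0 0 | a b c. True}"
  proof (intro equalityI subsetI)
    fix m assume "m \<in> {hmat a b c 0 0 0 | a b c. True}"
    then obtain a b c where "m = hmat a b c 0 0 0" by blast
    then have "m = V_sl2_matrix (vector [b, c, a], 0)" by (simp add: V_sl2_matrix_def)
    then show "m \<in> V_sl2_matrix ` (lcarrier L_V \<times> {0})" by (simp add: L_V_def)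
  qed (auto simp: V_sl2_matrix_def hmat_eq_iff)
  then show ?thesis by (simp only: image_comp[symmetric])
qed

end

text \<open>At \<open>s_id\<close> the two expressions become 4 z1 and 1 - 8 z1. Both are non-zero
  at a suitable point of \<open>U\<close>, and openness then gives a product neighbourhood on which
  both expressions stay non-zero.\<close>

lemma local_moduli_data_shrink:
  assumes "local_moduli_data U V"
  obtains U' V' where "U' \<subseteq> U" "V' \<subseteq> V" "local_moduli_data U' V'"
    "\<And>z s. z \<in> U' \<Longrightarrow> s \<in> V' \<Longrightarrow> s $ 2 + 4 * z $ 1 * s $ 1 \<noteq> 0"
    "\<And>z s. z \<in> U' \<Longrightarrow> s \<in> V' \<Longrightarrow> discr z * (s $ 1)^2 - (1 - 4 * z $ 2) * (s $ 2 + 4 * z $ 1 * s $ 1)^2 \<noteq> 0"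
proof -
  have UV: "open U" "U \<noteq> {}" "U \<subseteq> moduli_base" "open V" "s_id \<in> V" "\<forall>s\<in>V. s $ 1 \<noteq> 0 \<and> s $ 4 \<noteq> 0"
    using assms by (simp_all add: local_moduli_data_def)
  obtain z0 where z0: "z0 \<in> U" "8 * z0 $ 1 \<noteq> 1"
  proof -
    obtain z where z: "z \<in> U" using UV(2) by blast
    obtain e where e: "e > 0" "ball z e \<subseteq> U" using UV(1) z open_contains_ball by blast
    \<comment> \<open>A nearby point with another first coordinate: at least one of z and w avoids
      z1 = 1/8.\<close>
    define w where "w = z + of_real (e/2) *s axis 1 1"
    have "norm (axis 1 1 :: complex^2) = 1" by (simp add: norm_vec_def axis_def L2_set_def sum_2)
    then have "w \<in> ball z e"
      using e(1) by (simp add: w_def dist_norm norm_vector_scalar_mult del: of_real_divide)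
    then have "w \<in> U" using e(2) by blast
    moreover have "w $ 1 \<noteq> z $ 1" using e(1) by (simp add: w_def)
    ultimately show ?thesis using that[OF z] that[of w] by (metis mult_cancel_left zero_neq_numeral)
  qed
  define W :: "((complex^2) \<times> (complex^4)) set" where
    "W = {(z, s). s $ 2 + 4 * z $ 1 * s $ 1 \<noteq> 0} \<inter>
      {(z, s). discr z * (s $ 1)^2 - (1 - 4 * z $ 2) * (s $ 2 + 4 * z $ 1 * s $ 1)^2 \<noteq> 0} \<inter> (U \<times> V)"
  have "open W"
    unfolding W_def discr_def case_prod_beta
    by (intro open_Int open_Collect_neq open_Times UV continuous_intros)
  moreover have "(z0, s_id) \<in> W"
  proof -
    have "z0 $ 1 \<noteq> 0" using z0(1) UV(3) moduli_baseD(1) by blast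
    moreover have "discr z0 - (1 - 4 * z0 $ 2) * (4 * z0 $ 1)^2 = 1 - 8 * z0 $ 1"
      by (simp add: discr_def power2_eq_square algebra_simps)
    then have "discr z0 - (1 - 4 * z0 $ 2) * (4 * z0 $ 1)^2 \<noteq> 0" using z0(2) by simp
    ultimately show ?thesis using z0 UV(5) by (simp add: W_def)
  qed
  ultimately obtain U' V' where *: "open U'" "open V'" "(z0, s_id) \<in> U' \<times> V'" "U' \<times> V' \<subseteq> W"
    by (rule open_prod_elim)
  show ?thesis
  proof
    have sub: "z \<in> U \<and> s \<in> V" if "z \<in> U'" "s \<in> V'" for z s
      using *(4) that by (auto simp: W_def)
    show "U' \<subseteq> U" "V' \<subseteq> V" using sub *(3) by auto
    then show "local_moduli_data U' V'"
      unfolding local_moduli_data_def using * UV by auto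
    fix z s assume zs: "z \<in> U'" "s \<in> V'"
    then have "(z, s) \<in> W" using *(4) by blast
    then show "s $ 2 + 4 * z $ 1 * s $ 1 \<noteq> 0"
      "discr z * (s $ 1)^2 - (1 - 4 * z $ 2) * (s $ 2 + 4 * z $ 1 * s $ 1)^2 \<noteq> 0"
      by (simp_all add: W_def)
  qed
qed

theorem theorem3:
  fixes U :: "(complex^2) set" and V :: "(complex^4) set"
  assumes "local_moduli_data U V"
  shows
    "(\<exists>A. gauss_manin_connection U A) \<and>
     (\<exists>U' V'. U' \<subseteq> U \<and> V' \<subseteq> V \<and> local_moduli_data U' V' \<and>
        (\<forall>A. gauss_manin_connection U' A \<longrightarrow>
           (\<exists>R. is_modular modular_matrix_1 (enhanced_moduli U' V') A R) \<and>
           (\<exists>R. is_modular modular_matrix_2 (enhanced_moduli U' V') A R))) \<and>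
     (\<forall>A T. T = enhanced_moduli U V \<and> gauss_manin_connection U A \<and>
        (\<exists>R. is_modular modular_matrix_1 T A R) \<and> (\<exists>R. is_modular modular_matrix_2 T A R) \<longrightarrow>
        (\<exists>!R. is_modular modular_matrix_1 T A R) \<and>
        (\<exists>!R. is_modular modular_matrix_2 T A R) \<and>
        (\<forall>g\<in>Lie_G. \<exists>!R. is_R_g T A g R) \<and>
        (let B = {R_1 T A, R_2 T A, R_g22 T A, R_g23 T A, R_g43 T A, R_g44 T A} in
           card B = 6 \<and> module_independent T B \<and>
           gm_module T A = module_span T B \<and>
           lcarrier (gm_lie_algebra T A) = const_span B) \<and>
        (\<forall>X\<in>gm_module T A. \<forall>Y\<in>gm_module T A. vf_bracket T X Y \<in> gm_module T A) \<and>
        complex_lie_algebra (gm_lie_algebra T A) \<and>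
        (let I = ideal_generated (gm_lie_algebra T A) {R_2 T A, R_g22 T A, R_g23 T A} in
           lie_ideal I (gm_lie_algebra T A) \<and>
           I = const_span {R_2 T A, R_g22 T A, R_g23 T A} \<and>
           (\<exists>\<phi> \<Phi>. lie_action sl2 L_V \<phi> \<and>
              lie_iso (semidirect L_V sl2 \<phi>) (gm_lie_algebra T A) \<Phi> \<and>
              \<Phi> ` (lcarrier L_V \<times> {0}) = I)))"
proof (intro conjI)
  show "\<exists>A. gauss_manin_connection U A"
    using assms gauss_manin_connection_gm_form by (auto simp: local_moduli_data_def)
  obtain U' V' where UV: "U' \<subseteq> U" "V' \<subseteq> V" "local_moduli_data U' V'"
    "\<And>z s. z \<in> U' \<Longrightarrow> s \<in> V' \<Longrightarrow> s $ 2 + 4 * z $ 1 * s $ 1 \<noteq> 0"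
    "\<And>z s. z \<in> U' \<Longrightarrow> s \<in> V' \<Longrightarrow> discr z * (s $ 1)^2 - (1 - 4 * z $ 2) * (s $ 2 + 4 * z $ 1 * s $ 1)^2 \<noteq> 0"
    using local_moduli_data_shrink[OF assms] by blast
  have "(\<exists>R. is_modular modular_matrix_1 (enhanced_moduli U' V') A R) \<and>
      (\<exists>R. is_modular modular_matrix_2 (enhanced_moduli U' V') A R)" if "gauss_manin_connection U' A" for A
  proof -
    interpret gm_moduli U' V' A "enhanced_moduli U' V'"
      using UV(3) that by unfold_locales simp_all
    have "p $ 4 + 4 * p $ 1 * p $ 3 \<noteq> 0"
      "discr (zpart p) * (p $ 3)^2 - (1 - 4 * p $ 2) * (p $ 4 + 4 * p $ 1 * p $ 3)^2 \<noteq> 0"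
      if "p \<in> enhanced_moduli U' V'" for p
      using that UV(4)[of "zpart p" "spart p"] UV(5)[of "zpart p" "spart p"] by (simp_all add: enhanced_moduli_def)
    then show ?thesis using modular_exist by blast
  qed
  then show "\<exists>U' V'. U' \<subseteq> U \<and> V' \<subseteq> V \<and> local_moduli_data U' V' \<and>
        (\<forall>A. gauss_manin_connection U' A \<longrightarrow>
           (\<exists>R. is_modular modular_matrix_1 (enhanced_moduli U' V') A R) \<and>
           (\<exists>R. is_modular modular_matrix_2 (enhanced_moduli U' V') A R))"
    using UV(1-3) by blast
next
  show "\<forall>A T. T = enhanced_moduli U V \<and> gauss_manin_connection U A \<and>
        (\<exists>R. is_modular modular_matrix_1 T A R) \<and> (\<exists>R. is_modular modular_matrix_2 T A R) \<longrightarrow>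
        (\<exists>!R. is_modular modular_matrix_1 T A R) \<and>
        (\<exists>!R. is_modular modular_matrix_2 T A R) \<and>
        (\<forall>g\<in>Lie_G. \<exists>!R. is_R_g T A g R) \<and>
        (let B = {R_1 T A, R_2 T A, R_g22 T A, R_g23 T A, R_g43 T A, R_g44 T A} in
           card B = 6 \<and> module_independent T B \<and>
           gm_module T A = module_span T B \<and>
           lcarrier (gm_lie_algebra T A) = const_span B) \<and>
        (\<forall>X\<in>gm_module T A. \<forall>Y\<in>gm_module T A. vf_bracket T X Y \<in> gm_module T A) \<and>
        complex_lie_algebra (gm_lie_algebra T A) \<and>
        (let I = ideal_generated (gm_lie_algebra T A) {R_2 T A, R_g22 T A, R_g23 T A} in
           lie_ideal I (gm_lie_algebra T A) \<and>
           I = const_span {R_2 T A, R_g22 T A, R_g23 T A} \<and>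
           (\<exists>\<phi> \<Phi>. lie_action sl2 L_V \<phi> \<and>
              lie_iso (semidirect L_V sl2 \<phi>) (gm_lie_algebra T A) \<Phi> \<and>
              \<Phi> ` (lcarrier L_V \<times> {0}) = I))"
  proof (intro allI impI, elim conjE)
    fix A T assume T: "T = enhanced_moduli U V" and A: "gauss_manin_connection U A"
      and m: "\<exists>R. is_modular modular_matrix_1 T A R" "\<exists>R. is_modular modular_matrix_2 T A R"
    interpret gm_modular U V A T
      using assms T A m by unfold_locales
    show "(\<exists>!R. is_modular modular_matrix_1 T A R) \<and>
        (\<exists>!R. is_modular modular_matrix_2 T A R) \<and>
        (\<forall>g\<in>Lie_G. \<exists>!R. is_R_g T A g R) \<and>
        (let B = {R_1 T A, R_2 T A, R_g22 T A, R_g23 T A, R_g43 T A, R_g44 T A} in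
           card B = 6 \<and> module_independent T B \<and>
           gm_module T A = module_span T B \<and>
           lcarrier (gm_lie_algebra T A) = const_span B) \<and>
        (\<forall>X\<in>gm_module T A. \<forall>Y\<in>gm_module T A. vf_bracket T X Y \<in> gm_module T A) \<and>
        complex_lie_algebra (gm_lie_algebra T A) \<and>
        (let I = ideal_generated (gm_lie_algebra T A) {R_2 T A, R_g22 T A, R_g23 T A} in
           lie_ideal I (gm_lie_algebra T A) \<and>
           I = const_span {R_2 T A, R_g22 T A, R_g23 T A} \<and>
           (\<exists>\<phi> \<Phi>. lie_action sl2 L_V \<phi> \<and>
              lie_iso (semidirect L_V sl2 \<phi>) (gm_lie_algebra T A) \<Phi> \<and>
              \<Phi> ` (lcarrier L_V \<times> {0}) = I))"
      \<comment> \<open>All spans, modules and ideals become images under \<open>gm_field\<close> of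
        explicit subsets of \<open>hh\<close>, or the set of all vector fields, so the claimed
        equalities turn into reflexivity.\<close>
      unfolding Let_def basis_eq ideal_eq gm_module_eq vector_fields_module_span carrier_eq
        const_span_hh[OF subset_refl gm_basis_hh]
    proof (intro conjI ballI)
      show "\<exists>!R. is_modular modular_matrix_1 T A R" using m(1) is_modular_1 by metis
      show "\<exists>!R. is_modular modular_matrix_2 T A R" using m(2) is_modular_2 by metis
      show "\<exists>!R. is_R_g T A g R" if "g \<in> Lie_G" for g
        using that unfolding Lie_G_eq by (auto simp: is_R_g_iff)
      show "vf_bracket T X Y \<in> vector_fields T" if "X \<in> vector_fields T" "Y \<in> vector_fields T" for X Y
        using that by (rule vf_bracket_vector_fields[OF open_T])
      show "\<exists>\<phi> \<Phi>. lie_action sl2 L_V \<phi> \<and> lie_iso (semidirect L_V sl2 \<phi>) (gm_lie_algebra T A) \<Phi> \<and>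
          \<Phi> ` (lcarrier L_V \<times> {0}) = gm_field ` {hmat a b c 0 0 0 | a b c. True}"
        using lie_action_V lie_iso_V_sl2 V_image_ideal by blast
    qed (rule refl card_gm_field_basis module_independent_basis complex_lie_algebra_gm lie_ideal_gm)+
  qed
qed

end
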